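(* Let $R>0$ and $\alpha,\gamma\in\mathbb{R}$. Let $\phi:(0,\infty)\to(0,\infty)$ be a twice differentiable $C^1$ function satisfying $(\phi_1)$–$(\phi_3)$ with constants $\gamma_1,\gamma_2>1$ (see context). Let $f\in C(\mathbb{R})\cap C^1(\mathbb{R}\setminus\{0\})$ satisfy $(f_1)$–$(f_3)$ (see context), with $d_\infty>0$ the constant of $(f_2)$. Assume $$\gamma\ge\max\left\{\alpha,\frac{-\alpha}{\gamma_1-1}\right\}.$$ Then there is a positive number $\Lambda$ such that for each $\lambda\in(0,\Lambda]$ the problem $$-(r^\alpha\phi(|u'(r)|)u'(r))'=\lambda r^\gamma f(u(r)),\quad 0<r<R,\qquad u'(0)=u(R)=0,$$ admits a positive solution $u_0$ and an infinite sequence $\{u_\ell\}_{\ell=1}^\infty$ of solutions such that, for every $\ell\ge1$, $$u_\ell(0)=d_\ell\quad\text{and}\quad u_\ell \text{ has precisely } \ell \text{ zeroes in } (0,R),$$ where $\{d_\ell\}_{\ell=1}^\infty$ is an infinite sequence of real numbers with $$d_\infty>d_1>\cdots>d_\ell>\cdots>0.$$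
   Context: Conditions on $\phi$: $(\phi_1)$ $t\phi(t)\to0$ as $t\to0$ and $t\phi(t)\to\infty$ as $t\to\infty$; $(\phi_2)$ $t\mapsto t\phi(t)$ is strictly increasing in $(0,\infty)$; $(\phi_3)$ there are constants $\gamma_1,\gamma_2>1$ such that $\gamma_1-1\le \frac{(t\phi(t))'}{\phi(t)}\le\gamma_2-1$ for all $t>0$. These constants are fixed. Conditions on $f$: $(f_1)$ $tf(t)>0$ for $t\ne0$; $(f_2)$ there exists $d_\infty>0$ such that $f$ is nondecreasing in $(-\infty,d_\infty]$ (this $d_\infty$ is fixed); $(f_3)$ $\liminf_{\nu\to0^{\pm}}\int_0^\nu|f(t)|^{\frac{-1}{\gamma_1-1}}\operatorname{sgn}(f(t))\,dt<\infty$ (for both one-sided limits), which is taken to be equivalent to: $\int_{-x}^0[-f(t)]^{\frac{-1}{\gamma_1-1}}dt<\infty$ and $\int_0^y[f(t)]^{\frac{-1}{\gamma_1-1}}dt<\infty$ for all $x,y>0$. Conventions: $\phi(|s|)s$ is read as $0$ when $s=0$. A solution of the boundary value problem is a function $u\in C^1([0,R])$ such that $r^\alpha\phi(|u'(r)|)u'(r)$ is differentiable on $(0,R)$, the equation holds for $0<r<R$, and $u'(0)=0$, $u(R)=0$. A positive solution is one with $u>0$ on $(0,R)$. *)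

theory Defs
  imports "HOL-Analysis.Analysis"
begin

text \<open>
  Solutions of the boundary value problem
  \<open>-(r^\<alpha> \<phi>(|u'|) u')' = lam r^\<gamma> f(u)\<close> on \<open>(0,R)\<close>, \<open>u'(0) = u(R) = 0\<close>, in the class \<open>C\<^sup>1([0,R])\<close>.
  The derivative \<open>u'\<close> is one-sided at the two end points, hence the relativised filter; the values
  of \<open>u\<close> outside \<open>[0,R]\<close> are irrelevant. The convention \<open>\<phi>(|s|) s = 0\<close> for \<open>s = 0\<close> holds
  automatically, whatever value the total function \<open>\<phi>\<close> takes at \<open>0\<close>.
\<close>

definition bvp_solution ::
  "real \<Rightarrow> real \<Rightarrow> real \<Rightarrow> (real \<Rightarrow> real) \<Rightarrow> (real \<Rightarrow> real) \<Rightarrow> real \<Rightarrow> (real \<Rightarrow> real) \<Rightarrow> bool"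
  where
  "bvp_solution R \<alpha> \<gamma> \<phi> f lam u \<longleftrightarrow>
    (\<exists>u'. (\<forall>r\<in>{0..R}. (u has_real_derivative u' r) (at r within {0..R})) \<and>
          continuous_on {0..R} u' \<and>
          (\<forall>r\<in>{0<..<R}.
             (\<lambda>s. s powr \<alpha> * \<phi> \<bar>u' s\<bar> * u' s) differentiable (at r) \<and>
             - deriv (\<lambda>s. s powr \<alpha> * \<phi> \<bar>u' s\<bar> * u' s) r = lam * r powr \<gamma> * f (u r)) \<and>
          u' 0 = 0 \<and> u R = 0)"

definition positive_bvp_solution ::
  "real \<Rightarrow> real \<Rightarrow> real \<Rightarrow> (real \<Rightarrow> real) \<Rightarrow> (real \<Rightarrow> real) \<Rightarrow> real \<Rightarrow> (real \<Rightarrow> real) \<Rightarrow> bool"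
  where
  "positive_bvp_solution R \<alpha> \<gamma> \<phi> f lam u \<longleftrightarrow>
    bvp_solution R \<alpha> \<gamma> \<phi> f lam u \<and> (\<forall>r\<in>{0<..<R}. u r > 0)"

end

theory Submission
  imports Defs "HOL-Complex_Analysis.Great_Picard"
begin

text \<open>
  Shooting. With \<open>g\<close> the inverse of \<open>t \<mapsto> t \<phi>(\<bar>t\<bar>)\<close>, a solution with \<open>u(0) = d\<close> is a fixed point of
  \<open>u(r) = d - \<integral>\<^sub>0\<^sup>r g (s\<^bsup>-\<alpha>\<^esup> \<integral>\<^sub>0\<^sup>s lam t\<^bsup>\<gamma>\<^esup> f(u(t)) dt) ds\<close>, where \<open>f\<close> may be cut off because a weighted energy decreases
  along solutions; the condition on \<open>\<gamma>\<close> is what makes it decrease. The energy decays at most polynomially,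
  so all zeros of \<open>u\<close> are simple. Although neither \<open>f\<close> nor \<open>g\<close> need be Lipschitz at \<open>0\<close>, solutions are
  unique: near a critical point \<open>f\<close> is Lipschitz and \<open>g\<close> is controlled by \<open>y g'(y) \<le> g(y) / (\<gamma>\<^sub>1 - 1)\<close>, and
  elsewhere one uses the energy as unknown in place of \<open>u'\<close>. Hence the orbit depends continuously on \<open>d\<close>
  in \<open>C\<^sup>1\<close>, and its number of zeros changes only when a zero crosses \<open>r = R\<close>. For \<open>d = d_inf\<close> and small
  \<open>lam\<close> there is no zero, while \<open>(f\<^sub>3)\<close> bounds the length of a monotone arc by a quantity that vanishes
  with its amplitude, so the number of zeros tends to infinity as \<open>d\<close> tends to \<open>0\<close>.
\<close>

section \<open>The inverse profile\<close>

text \<open>Put \<open>p = 1 / (\<gamma>\<^sub>1 - 1)\<close>. The two bounds on \<gamma> act in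
  different places. From \<gamma> \<ge> \<alpha> the exponent 1 + \<gamma> - \<alpha> is at least 1,
  so \<open>\<phi>(|u'|) u'\<close> vanishes at r = 0 even if r^(-\<alpha>) is singular there. From
  \<gamma> \<ge> -\<alpha> p and \<gamma> \<ge> 0 the energy decreases, because P(y) \<le> y g(y)
  \<le> (1 + p) P(y). The exponent in (f_3) matches the same p: g(y) / y^p is nonincreasing for y >
  0, so at distance t from the start of a decreasing arc of |u|, |u'| is at least a constant times
  (t |f(u)|)^p, and dividing by |f(u)|^p leaves the integrand of (f_3). The cut-off has to be
  harmless for all lam at once. Its lower level -m is chosen so that the primitive of f is larger at
  -m than at \<open>d_inf\<close>; multiplying f by lam preserves this, so m, the bound on f and
  finally \<Lambda> are fixed before lam. Contraction fails where f or g is not Lipschitz, so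
  existence of orbits comes from compactness, and so does continuity in d once uniqueness is
  known.\<close>

definition prim :: "(real \<Rightarrow> real) \<Rightarrow> real \<Rightarrow> real"
  where "prim h = (SOME H. H 0 = 0 \<and> (\<forall>y. (H has_real_derivative h y) (at y)))"

text \<open>A primitive on the whole line is required, on both sides of 0;
  \<open>integral {0..y}\<close> would be 0 for every negative y.\<close>

lemma prim:
  assumes "continuous_on UNIV h"
  shows prim_0: "prim h 0 = 0" and DERIV_prim: "(prim h has_real_derivative h y) (at y)"
proof -
  have "\<exists>F. \<forall>x::real. -\<infinity> < ereal x \<longrightarrow> ereal x < \<infinity> \<longrightarrow> (F has_vector_derivative h x) (at x)"
    using assms by (intro einterval_antiderivative) (auto simp: continuous_on_eq_continuous_at)
  then obtain F where F: "\<And>x. (F has_real_derivative h x) (at x)"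
    by (auto simp: has_real_derivative_iff_has_vector_derivative)
  have "\<exists>H. H 0 = 0 \<and> (\<forall>y. (H has_real_derivative h y) (at y))"
    by (rule exI[of _ "\<lambda>y. F y - F 0"]) (auto intro!: derivative_eq_intros F)
  from someI_ex[OF this] show "prim h 0 = 0" "(prim h has_real_derivative h y) (at y)"
    unfolding prim_def by auto
qed

lemma prim_continuous: "continuous_on UNIV h \<Longrightarrow> continuous_on A (prim h)"
  by (meson DERIV_prim DERIV_isCont continuous_at_imp_continuous_on)

text \<open>The bound on the derivative is the lower half of (\<phi>_3) rewritten for the inverse
  function, with \<open>p = 1 / (\<gamma>\<^sub>1 - 1)\<close>. It is stated for y > 0 because g may
  fail to be differentiable at 0.\<close>

locale odd_profile =
  fixes g :: "real \<Rightarrow> real" and p :: real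
  assumes p_pos: "p > 0"
    and g_cont: "continuous_on UNIV g"
    and g_odd: "g (- y) = - g y"
    and g_strict: "strict_mono g"
    and g_deriv: "y > 0 \<Longrightarrow> \<exists>g'. (g has_real_derivative g') (at y) \<and> g' \<le> p * g y / y"
begin

definition P where "P = prim g"

lemma g_0 [simp]: "g 0 = 0"
  using g_odd[of 0] by simp

lemma g_less_iff [simp]: "g x < g y \<longleftrightarrow> x < y"
  using g_strict by (simp add: strict_mono_less)

lemma g_le_iff [simp]: "g x \<le> g y \<longleftrightarrow> x \<le> y"
  using g_strict by (simp add: strict_mono_less_eq)

lemma g_pos_iff [simp]: "g y > 0 \<longleftrightarrow> y > 0"
  using g_less_iff[of 0 y] by simp

lemma g_nonneg_iff [simp]: "g y \<ge> 0 \<longleftrightarrow> y \<ge> 0"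
  using g_le_iff[of 0 y] by simp

lemma g_nonpos_iff [simp]: "g y \<le> 0 \<longleftrightarrow> y \<le> 0"
  using g_le_iff[of y 0] by simp

lemma g_eq_0_iff [simp]: "g y = 0 \<longleftrightarrow> y = 0"
  by (metis g_nonneg_iff g_nonpos_iff order.eq_iff)

lemma g_abs: "\<bar>g y\<bar> = g \<bar>y\<bar>"
  using g_odd[of y] by (cases "y \<ge> 0") auto

lemma g_cont_on: "continuous_on A g"
  using g_cont continuous_on_subset by blast

lemma P_0 [simp]: "P 0 = 0"
  unfolding P_def by (rule prim_0[OF g_cont])

lemma P_deriv: "(P has_real_derivative g y) (at y)"
  unfolding P_def by (rule DERIV_prim[OF g_cont])

lemma P_cont: "continuous_on A P"
  unfolding P_def by (rule prim_continuous[OF g_cont])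

lemma P_even: "P (- y) = P y"
proof -
  have "((\<lambda>y. P (- y) - P y) has_real_derivative 0) (at z)" for z
  proof -
    have "((\<lambda>y. P (- y) - P y) has_real_derivative (g (-z) * (-1) - g z)) (at z)"
      by (intro derivative_intros DERIV_chain2[OF P_deriv] P_deriv)
    then show ?thesis by (simp add: g_odd)
  qed
  from DERIV_isconst_all[of "\<lambda>y. P (- y) - P y" y 0] this show ?thesis by simp
qed

lemma P_abs: "P \<bar>y\<bar> = P y"
  using P_even[of y] by (cases "y \<ge> 0") auto

lemma P_mvt:
  assumes "y1 < y2" obtains z where "y1 < z" "z < y2" "P y2 - P y1 = (y2 - y1) * g z"
  using MVT2[OF assms, of P g] P_deriv by blast

lemma P_le: "P y \<le> y * g y"
proof -
  have *: "P y \<le> y * g y" if pos: "y > 0" for y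
  proof -
    obtain z where "0 < z" "z < y" "P y - P 0 = (y - 0) * g z"
      using P_mvt[OF pos] by blast
    with pos show ?thesis by (simp add: mult_left_mono)
  qed
  show ?thesis
    using *[of y] *[of "-y"] by (cases y "0::real" rule: linorder_cases) (auto simp: P_even g_odd)
qed

lemma P_pos: "y \<noteq> 0 \<Longrightarrow> P y > 0"
proof -
  have *: "P y > 0" if pos: "y > 0" for y
  proof -
    obtain z where "0 < z" "z < y" "P y - P 0 = (y - 0) * g z"
      using P_mvt[OF pos] by blast
    with pos show ?thesis by simp
  qed
  show "y \<noteq> 0 \<Longrightarrow> P y > 0"
    using *[of y] *[of "-y"] by (cases y "0::real" rule: linorder_cases) (auto simp: P_even)
qed

lemma P_nonneg: "P y \<ge> 0"
  by (metis P_0 P_pos less_eq_real_def)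

text \<open>The difference of the two sides has derivative p g(y) - y g'(y) \<ge> 0 on y > 0.
  Together with \<open>P_le\<close> this encloses y g(y) between multiples of P(y), so that either
  sign of \<alpha> can be handled in the energy balance.\<close>

lemma P_ge: "y * g y \<le> (1 + p) * P y"
proof -
  have *: "y * g y \<le> (1 + p) * P y" if y: "y > 0" for y
  proof -
    let ?Z = "\<lambda>y. (1 + p) * P y - y * g y"
    have "?Z 0 \<le> ?Z y"
    proof (rule DERIV_nonneg_imp_increasing_open[of 0 y ?Z])
      fix x :: real assume "0 < x" "x < y"
      then obtain g' where g': "(g has_real_derivative g') (at x)" "g' \<le> p * g x / x"
        using g_deriv by blast
      have "(?Z has_real_derivative ((1 + p) * g x - (1 * g x + g' * x))) (at x)"
        by (intro derivative_intros DERIV_cmult P_deriv g')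
      moreover have "(1 + p) * g x - (1 * g x + g' * x) \<ge> 0"
        using g'(2) \<open>0 < x\<close> by (simp add: field_simps)
      ultimately show "\<exists>y. (?Z has_real_derivative y) (at x) \<and> 0 \<le> y" by blast
    qed (use y in \<open>auto intro!: continuous_intros P_cont g_cont_on\<close>)
    then show ?thesis by simp
  qed
  show ?thesis
    using *[of y] *[of "-y"] by (cases y "0::real" rule: linorder_cases) (auto simp: P_even g_odd)
qed

text \<open>On [m, Y] the derivative is at most p g(z) / z \<le> p g(Y) / m. The explicit dependence
  on m matters: near a critical point m tends to 0, but the difference of the arguments is of the
  same order.\<close>

lemma g_lipschitz:
  assumes "0 < m" "m \<le> \<bar>y1\<bar>" "m \<le> \<bar>y2\<bar>" "\<bar>y1\<bar> \<le> Y" "\<bar>y2\<bar> \<le> Y" "y1 * y2 > 0"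
  shows "\<bar>g y1 - g y2\<bar> \<le> p * g Y / m * \<bar>y1 - y2\<bar>"
proof -
  have *: "\<bar>g y1 - g y2\<bar> \<le> p * g Y / m * \<bar>y1 - y2\<bar>"
    if lt: "m \<le> y1" "y1 < y2" "y2 \<le> Y" for y1 y2
  proof -
    have "\<exists>g'. \<forall>y>0. (g has_real_derivative g' y) (at y) \<and> g' y \<le> p * g y / y"
      using g_deriv by metis
    then obtain g' where g': "\<And>y. y > 0 \<Longrightarrow> (g has_real_derivative g' y) (at y)"
      "\<And>y. y > 0 \<Longrightarrow> g' y \<le> p * g y / y" by blast
    obtain z where z: "y1 < z" "z < y2" "g y2 - g y1 = (y2 - y1) * g' z"
      using MVT2[OF lt(2), of g g'] g'(1) lt \<open>0 < m\<close> by force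
    have "g' z \<le> p * g z / z" using g'(2) z that assms(1) by simp
    also have "\<dots> \<le> p * g Y / m"
      using z that assms(1) p_pos by (intro frac_le mult_left_mono mult_nonneg_nonneg) auto
    finally have "g y2 - g y1 \<le> (y2 - y1) * (p * g Y / m)"
      unfolding z(3) using lt by (intro mult_left_mono) auto
    moreover have "g y1 < g y2" using lt by simp
    ultimately show ?thesis using lt by (simp add: mult.commute)
  qed
  have **: "\<bar>g y1 - g y2\<bar> \<le> p * g Y / m * \<bar>y1 - y2\<bar>"
    if "m \<le> y1" "y1 \<le> Y" "m \<le> y2" "y2 \<le> Y" for y1 y2
    using that *[of y1 y2] *[of y2 y1] by (cases y1 y2 rule: linorder_cases) (auto simp: abs_minus_commute)
  show ?thesis
  proof (cases "y1 > 0")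
    case True
    then have "y2 > 0" using assms by (simp add: zero_less_mult_iff)
    then show ?thesis using ** True assms by simp
  next
    case False
    then have "y1 < 0" "y2 < 0" using assms by (auto simp: zero_less_mult_iff)
    then show ?thesis using **[of "-y1" "-y2"] assms by (auto simp: g_odd abs_minus_commute)
  qed
qed

lemma P_lower_lipschitz:
  assumes "0 < m" "m \<le> \<bar>y1\<bar>" "m \<le> \<bar>y2\<bar>" "y1 * y2 > 0"
  shows "g m * \<bar>y1 - y2\<bar> \<le> \<bar>P y1 - P y2\<bar>"
proof -
  have *: "g m * \<bar>y1 - y2\<bar> \<le> \<bar>P y1 - P y2\<bar>"
    if lt: "m \<le> y1" "y1 < y2" for y1 y2
  proof -
    obtain z where z: "y1 < z" "z < y2" "P y2 - P y1 = (y2 - y1) * g z"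
      using P_mvt[OF lt(2)] by blast
    have "g m * (y2 - y1) \<le> P y2 - P y1"
      using z lt by (simp add: mult.commute)
    moreover have "\<bar>y1 - y2\<bar> = y2 - y1" using lt by simp
    ultimately show ?thesis by simp
  qed
  have **: "g m * \<bar>y1 - y2\<bar> \<le> \<bar>P y1 - P y2\<bar>"
    if "m \<le> y1" "m \<le> y2" for y1 y2
    using that *[of y1 y2] *[of y2 y1] by (cases y1 y2 rule: linorder_cases) (auto simp: abs_minus_commute)
  show ?thesis
  proof (cases "y1 > 0")
    case True
    then have "y2 > 0" using assms by (simp add: zero_less_mult_iff)
    then show ?thesis using ** True assms by simp
  next
    case False
    then have "y1 < 0" "y2 < 0" using assms by (auto simp: zero_less_mult_iff)
    then show ?thesis using **[of "-y1" "-y2"] assms by (auto simp: P_even abs_minus_commute)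
  qed
qed

lemma P_upper_lipschitz:
  assumes "\<bar>y1\<bar> \<le> Y" "\<bar>y2\<bar> \<le> Y"
  shows "\<bar>P y1 - P y2\<bar> \<le> g Y * \<bar>y1 - y2\<bar>"
proof -
  have *: "\<bar>P y1 - P y2\<bar> \<le> g Y * \<bar>y1 - y2\<bar>" if "\<bar>y1\<bar> \<le> Y" "\<bar>y2\<bar> \<le> Y" and lt: "y1 < y2" for y1 y2
  proof -
    obtain z where z: "y1 < z" "z < y2" "P y2 - P y1 = (y2 - y1) * g z"
      using P_mvt[OF lt] by blast
    have "\<bar>g z\<bar> \<le> g Y" using z that by (simp add: g_abs)
    then have "\<bar>(y2 - y1) * g z\<bar> \<le> g Y * \<bar>y1 - y2\<bar>"
      using z by (simp add: abs_mult mult.commute mult_right_mono)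
    then show ?thesis using z(3) by linarith
  qed
  show ?thesis
    using assms *[of y1 y2] *[of y2 y1] by (cases y1 y2 rule: linorder_cases) (auto simp: abs_minus_commute)
qed

text \<open>The quotient g(y) / y^p is nonincreasing for y > 0, because y g' \<le> p g. This power
  is what the integrability condition on f has to compensate.\<close>

lemma g_lower_power:
  assumes "0 \<le> y" "y \<le> Y" "0 < Y"
  shows "g y \<ge> g Y * (y / Y) powr p"
proof (cases "y = 0")
  case False
  then have y: "y > 0" using assms by simp
  have "g Y * Y powr (-p) \<le> g y * y powr (-p)"
  proof (rule DERIV_nonpos_imp_nonincreasing[of y Y "\<lambda>y. g y * y powr (-p)"])
    fix x assume "y \<le> x" "x \<le> Y"
    then have x: "x > 0" using y by simp
    then obtain g' where g': "(g has_real_derivative g') (at x)" "g' \<le> p * g x / x"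
      using g_deriv by blast
    have "((\<lambda>y. g y * y powr (-p)) has_real_derivative
        (g' * x powr (-p) + ((-p) * x powr (-p - 1)) * g x)) (at x)"
      by (intro derivative_intros g' has_real_derivative_powr x)
    moreover have "g' * x powr (-p) + ((-p) * x powr (-p - 1)) * g x
        = x powr (-p) * (g' - p * g x / x)"
      using x by (simp add: powr_diff field_simps)
    moreover have "\<dots> \<le> 0" using g'(2) x by (simp add: mult_nonneg_nonpos)
    ultimately show "\<exists>z. ((\<lambda>y. g y * y powr (-p)) has_real_derivative z) (at x) \<and> z \<le> 0" by metis
  qed (use assms in simp)
  then show ?thesis
    using y assms by (simp add: powr_minus powr_divide field_simps)
qed (use assms in simp)

end

section \<open>The integral equation\<close>

lemma integral_lipschitz:
  fixes h :: "real \<Rightarrow> real"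
  assumes cont: "continuous_on {0..R} h" and bound: "\<And>s. s \<in> {0..R} \<Longrightarrow> \<bar>h s\<bar> \<le> L"
    and ab: "a \<in> {0..R}" "b \<in> {0..R}"
  shows "\<bar>integral {0..a} h - integral {0..b} h\<bar> \<le> L * \<bar>a - b\<bar>"
proof -
  have *: "\<bar>integral {0..a} h - integral {0..b} h\<bar> \<le> L * \<bar>a - b\<bar>"
    if "0 \<le> a" "a \<le> b" "b \<le> R" for a b
  proof -
    have int: "h integrable_on {0..b}"
      using that by (intro integrable_continuous_real continuous_on_subset[OF cont]) auto
    have "integral {0..a} h + integral {a..b} h = integral {0..b} h"
      using Henstock_Kurzweil_Integration.integral_combine[OF that(1,2) int] .
    moreover have "norm (integral {a..b} h) \<le> L * (b - a)"
      using that bound by (intro integral_bound continuous_on_subset[OF cont]) auto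
    ultimately show ?thesis using that by simp
  qed
  show ?thesis using *[of a b] *[of b a] ab by (cases "a \<le> b") (auto simp: abs_minus_commute)
qed

lemma lipschitz_extract_uniform_limit:
  fixes u :: "nat \<Rightarrow> real \<Rightarrow> real"
  assumes lip: "\<And>n r s. r \<in> {0..R} \<Longrightarrow> s \<in> {0..R} \<Longrightarrow> \<bar>u n r - u n s\<bar> \<le> L * \<bar>r - s\<bar>"
    and bound: "\<And>n r. r \<in> {0..R} \<Longrightarrow> \<bar>u n r\<bar> \<le> M"
  obtains v k where "strict_mono (k :: nat \<Rightarrow> nat)" "uniform_limit {0..R} (\<lambda>n. u (k n)) v sequentially"
proof -
  have "\<exists>d>0. \<forall>n y. y \<in> {0..R} \<and> norm (x - y) < d \<longrightarrow> norm (u n x - u n y) < e"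
    if "x \<in> {0..R}" "e > 0" for x e
  proof (intro exI conjI allI impI)
    show "e / (\<bar>L\<bar> + 1) > 0" using that by simp
    fix n y assume y: "y \<in> {0..R} \<and> norm (x - y) < e / (\<bar>L\<bar> + 1)"
    have "\<bar>u n x - u n y\<bar> \<le> L * \<bar>x - y\<bar>" using lip that y by blast
    also have "\<dots> \<le> (\<bar>L\<bar> + 1) * \<bar>x - y\<bar>" by (intro mult_right_mono) auto
    also have "\<dots> < e" using y by (simp add: field_simps)
    finally show "norm (u n x - u n y) < e" by simp
  qed
  moreover have "norm (u n x) \<le> M" if "x \<in> {0..R}" for n x using bound that by simp
  ultimately obtain v k where "strict_mono (k :: nat \<Rightarrow> nat)"
    "\<And>e. 0 < e \<Longrightarrow> \<exists>N. \<forall>n x. n \<ge> N \<and> x \<in> {0..R} \<longrightarrow> norm (u (k n) x - v x) < e"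
    using Arzela_Ascoli[of "{0..R}" u M, OF compact_Icc] by metis
  then have "uniform_limit {0..R} (\<lambda>n. u (k n)) v sequentially"
    unfolding uniform_limit_sequentially_iff dist_norm by blast
  then show ?thesis using that \<open>strict_mono k\<close> by blast
qed

text \<open>Here \<open>f\<close> stands for lam times the cut-off nonlinearity, hence the global
  bound \<open>B\<close>. A cut-off has kinks at its two levels, so away from 0 only a local
  Lipschitz condition is kept from C^1.\<close>

locale shooting = odd_profile +
  fixes R \<alpha> \<gamma> B :: real and f :: "real \<Rightarrow> real"
  assumes R_pos: "R > 0"
    and gamma: "\<gamma> \<ge> 0" "\<gamma> \<ge> \<alpha>" "\<gamma> \<ge> - \<alpha> * p"
    and f_ucont: "uniformly_continuous_on UNIV f"
    and f_bound: "\<bar>f x\<bar> \<le> B"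
    and f_sign: "x \<noteq> 0 \<Longrightarrow> x * f x > 0"
    and f_lip: "x \<noteq> 0 \<Longrightarrow> \<exists>\<delta>>0. \<exists>L. \<forall>s t. \<bar>s - x\<bar> < \<delta> \<longrightarrow> \<bar>t - x\<bar> < \<delta> \<longrightarrow> \<bar>f s - f t\<bar> \<le> L * \<bar>s - t\<bar>"
begin

text \<open>Agrees with \<open>s powr \<gamma>\<close> for \<open>s > 0\<close>, but is continuous at \<open>0\<close> also when \<open>\<gamma> = 0\<close>,
  where \<open>0 powr 0 = 0\<close>.\<close>
definition k where "k s = (if \<gamma> = 0 then 1 else s powr \<gamma>)"

text \<open>For a solution u, \<open>W u\<close> is the weighted flux
  \<open>r^\<alpha> \<phi>(|u'|) u'\<close>, \<open>Y u\<close> is \<open>\<phi>(|u'|) u'\<close>,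
  and \<open>V u\<close> is the derivative u'. All three are read off from u by integration, so they
  make sense for any continuous u.\<close>

definition W where "W u r = - integral {0..r} (\<lambda>s. k s * f (u s))"
definition Y where "Y u r = r powr (-\<alpha>) * W u r"
definition V where "V u r = g (Y u r)"

text \<open>For \<open>\<epsilon> = 0\<close> this is the initial value problem; \<open>\<epsilon> > 0\<close> gives Tonelli's delayed approximations.\<close>
definition sol where
  "sol \<epsilon> d u \<longleftrightarrow> continuous_on {0..R} u \<and> (\<forall>r\<in>{0..R}. u r = d + integral {0..max 0 (r - \<epsilon>)} (V u))"

definition C where "C = R powr (1 + \<gamma> - \<alpha>)"

lemma k_pos: "s > 0 \<Longrightarrow> k s = s powr \<gamma>"
  by (simp add: k_def)

lemma k_nonneg: "k s \<ge> 0"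
  by (simp add: k_def)

lemma k_mono: "0 \<le> s \<Longrightarrow> s \<le> r \<Longrightarrow> k s \<le> k r"
  using gamma by (auto simp: k_def intro: powr_mono2)

lemma k_cont: "continuous_on {0..} k"
proof (cases "\<gamma> = 0")
  case True
  then have "k = (\<lambda>_. 1)" unfolding fun_eq_iff k_def by simp
  then show ?thesis by simp
next
  case False
  then have "k = (\<lambda>s. s powr \<gamma>)" unfolding fun_eq_iff k_def by simp
  then show ?thesis
    using False gamma by (auto intro!: continuous_on_powr'[OF continuous_on_id continuous_on_const])
qed

lemma f_cont: "continuous_on A f"
  using uniformly_continuous_imp_continuous[OF f_ucont] continuous_on_subset by blast

lemma B_nonneg: "B \<ge> 0"
  using f_bound[of 0] by linarith

lemma f_pos: "x > 0 \<Longrightarrow> f x > 0" and f_neg: "x < 0 \<Longrightarrow> f x < 0"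
  using f_sign[of x] by (auto simp: zero_less_mult_iff)

lemma C_pos: "C > 0"
  using R_pos by (simp add: C_def)

lemma powr_le_C: "0 \<le> r \<Longrightarrow> r \<le> R \<Longrightarrow> r powr (1 + \<gamma> - \<alpha>) \<le> C"
  unfolding C_def using gamma by (intro powr_mono2) auto

lemma kf_cont: "continuous_on {0..R} u \<Longrightarrow> continuous_on {0..R} (\<lambda>s. k s * f (u s))"
  by (intro continuous_intros continuous_on_subset[OF k_cont] continuous_on_compose2[OF f_cont[of UNIV]]) auto

text \<open>The weight is nondecreasing and may be replaced by its value at r; one more factor r
  comes from the length of the interval. The resulting exponent 1 + \<gamma> - \<alpha> is positive
  and absorbs r^(-\<alpha>).\<close>

lemma k_integral_bound:
  assumes h: "continuous_on {0..r} h" and r: "r > 0" "r \<le> R" and M: "\<And>s. s \<in> {0..r} \<Longrightarrow> \<bar>h s\<bar> \<le> M"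
  shows "\<bar>r powr (-\<alpha>) * integral {0..r} (\<lambda>s. k s * h s)\<bar> \<le> M * r powr (1 + \<gamma> - \<alpha>)"
proof -
  have "norm (integral {0..r} (\<lambda>s. k s * h s)) \<le> (k r * M) * (r - 0)"
  proof (rule integral_bound)
    show "continuous_on {0..r} (\<lambda>s. k s * h s)"
      by (intro continuous_intros continuous_on_subset[OF k_cont] h) auto
    fix s assume s: "s \<in> {0..r}"
    show "norm (k s * h s) \<le> k r * M"
      using M[OF s] k_mono[of s r] s k_nonneg by (auto simp: abs_mult intro!: mult_mono)
  qed (use r in auto)
  then have "\<bar>r powr (-\<alpha>) * integral {0..r} (\<lambda>s. k s * h s)\<bar> \<le> r powr (-\<alpha>) * (k r * M * r)"
    by (simp add: abs_mult mult_left_mono)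
  also have "r powr (1 + \<gamma> - \<alpha>) = r * r powr \<gamma> * r powr (-\<alpha>)"
    using r powr_add[of r "1 + \<gamma>" "-\<alpha>"] powr_add[of r 1 \<gamma>] by simp
  then have "r powr (-\<alpha>) * (k r * M * r) = M * r powr (1 + \<gamma> - \<alpha>)"
    using r by (simp add: k_pos)
  finally show ?thesis .
qed

lemma W_0 [simp]: "W u 0 = 0" by (simp add: W_def)
lemma Y_0 [simp]: "Y u 0 = 0" by (simp add: Y_def)
lemma V_0 [simp]: "V u 0 = 0" by (simp add: V_def)

lemma W_deriv:
  assumes "continuous_on {0..R} u" "r \<in> {0..R}"
  shows "(W u has_real_derivative - (k r * f (u r))) (at r within {0..R})"
  unfolding W_def by (intro derivative_intros integral_has_real_derivative kf_cont assms)

lemma Y_bound: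
  assumes "continuous_on {0..R} u" "r \<in> {0..R}"
  shows "\<bar>Y u r\<bar> \<le> B * r powr (1 + \<gamma> - \<alpha>)"
proof (cases "r = 0")
  case False
  then have "\<bar>r powr (-\<alpha>) * integral {0..r} (\<lambda>s. k s * f (u s))\<bar> \<le> B * r powr (1 + \<gamma> - \<alpha>)"
    using assms f_bound
    by (intro k_integral_bound continuous_on_compose2[OF f_cont[of UNIV]] continuous_on_subset[OF assms(1)]) auto
  then show ?thesis by (simp add: Y_def W_def)
qed simp

lemma Y_bound': "continuous_on {0..R} u \<Longrightarrow> r \<in> {0..R} \<Longrightarrow> \<bar>Y u r\<bar> \<le> B * C"
  using Y_bound[of u r] powr_le_C[of r] B_nonneg by (smt (verit) atLeastAtMost_iff mult_left_mono)

lemma V_bound: "continuous_on {0..R} u \<Longrightarrow> r \<in> {0..R} \<Longrightarrow> \<bar>V u r\<bar> \<le> g (B * C)"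
  using Y_bound'[of u r] by (simp add: V_def g_abs)

lemma W_cont: "continuous_on {0..R} u \<Longrightarrow> continuous_on {0..R} (W u)"
  by (rule DERIV_continuous_on[OF W_deriv])

text \<open>Only r = 0 is delicate, where r^(-\<alpha>) may blow up; there \<open>Y_bound\<close>
  squeezes the function to 0.\<close>

lemma Y_cont:
  assumes u: "continuous_on {0..R} u"
  shows "continuous_on {0..R} (Y u)"
  unfolding continuous_on_eq_continuous_within
proof
  fix r assume r: "r \<in> {0..R}"
  show "continuous (at r within {0..R}) (Y u)"
  proof (cases "r = 0")
    case True
    have c: "continuous_on {0..R} (\<lambda>r. B * r powr (1 + \<gamma> - \<alpha>))"
      using gamma by (intro continuous_intros continuous_on_powr') auto
    have "((\<lambda>r. B * r powr (1 + \<gamma> - \<alpha>)) \<longlongrightarrow> 0) (at 0 within {0..R})"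
      using c r True by (force simp: continuous_on_def)
    moreover have "\<forall>\<^sub>F r in at 0 within {0..R}. norm (Y u r) \<le> B * r powr (1 + \<gamma> - \<alpha>)"
      using Y_bound[OF u] by (auto simp: eventually_at_filter)
    ultimately have "(Y u \<longlongrightarrow> 0) (at 0 within {0..R})"
      by (rule Lim_null_comparison[rotated])
    then show ?thesis using True by (simp add: continuous_within)
  next
    case False
    have "continuous (at r within {0..R}) (W u)"
      using W_cont[OF u] r by (simp add: continuous_on_eq_continuous_within)
    then show ?thesis
      unfolding Y_def using False r
      by (intro continuous_intros) auto
  qed
qed

lemma V_cont: "continuous_on {0..R} u \<Longrightarrow> continuous_on {0..R} (V u)"
  unfolding V_def by (intro continuous_on_compose2[OF g_cont_on[of UNIV] Y_cont]) auto

lemma V_cong: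
  assumes "\<And>s. s \<in> {0..r} \<Longrightarrow> u s = v s"
  shows "V u r = V v r"
proof -
  have "integral {0..r} (\<lambda>s. k s * f (u s)) = integral {0..r} (\<lambda>s. k s * f (v s))"
    using assms by (intro integral_cong) auto
  then show ?thesis by (simp add: V_def Y_def W_def)
qed

text \<open>Uniform continuity of f passes uniform convergence through the integral, with
  \<open>C\<close> bounding r^(1 + \<gamma> - \<alpha>). As all fluxes stay in the compact interval
  [-BC, BC], uniform continuity of g there does the rest.\<close>

lemma V_uniform_limit:
  assumes u: "\<And>n. continuous_on {0..R} (u n)" and lim: "uniform_limit {0..R} u v sequentially"
  shows "continuous_on {0..R} v" and "uniform_limit {0..R} (\<lambda>n. V (u n)) (V v) sequentially"
proof -
  show v: "continuous_on {0..R} v"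
    using uniform_limit_theorem[OF _ lim] u by simp
  have Ylim: "uniform_limit {0..R} (\<lambda>n. Y (u n)) (Y v) sequentially"
  proof (rule uniform_limitI)
    fix e :: real assume e: "e > 0"
    define e' where "e' = e / (2 * C)"
    have "e' > 0" using e C_pos by (simp add: e'_def)
    then obtain \<delta> where \<delta>: "\<delta> > 0" "\<And>x y. dist x y < \<delta> \<Longrightarrow> dist (f x) (f y) < e'"
      using f_ucont unfolding uniformly_continuous_on_def by (metis UNIV_I dist_commute)
    have "\<forall>\<^sub>F n in sequentially. \<forall>x\<in>{0..R}. dist (u n x) (v x) < \<delta>"
      using uniform_limitD[OF lim \<delta>(1)] .
    then show "\<forall>\<^sub>F n in sequentially. \<forall>x\<in>{0..R}. dist (Y (u n) x) (Y v x) < e"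
    proof eventually_elim
      case (elim n)
      show ?case
      proof
        fix r assume r: "r \<in> {0..R}"
        show "dist (Y (u n) r) (Y v r) < e"
        proof (cases "r = 0")
          case False
          have sub: "continuous_on {0..r} (u n)" "continuous_on {0..r} v"
            using r by (auto intro: continuous_on_subset[OF u] continuous_on_subset[OF v])
          have int: "(\<lambda>s. k s * f (u n s)) integrable_on {0..r}" "(\<lambda>s. k s * f (v s)) integrable_on {0..r}"
            using r by (auto intro!: integrable_continuous_real continuous_on_subset[OF kf_cont[OF u]]
                continuous_on_subset[OF kf_cont[OF v]])
          have "\<bar>r powr (-\<alpha>) * integral {0..r} (\<lambda>s. k s * (f (u n s) - f (v s)))\<bar> \<le> e' * r powr (1 + \<gamma> - \<alpha>)"
          proof (rule k_integral_bound)
            show "continuous_on {0..r} (\<lambda>s. f (u n s) - f (v s))"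
              by (intro continuous_intros continuous_on_compose2[OF f_cont[of UNIV]] sub) auto
            fix s assume "s \<in> {0..r}"
            then have "dist (u n s) (v s) < \<delta>" using elim r by auto
            from \<delta>(2)[OF this] show "\<bar>f (u n s) - f (v s)\<bar> \<le> e'" by (simp add: dist_real_def)
          qed (use False r in auto)
          also have "\<dots> \<le> e' * C"
            using powr_le_C[of r] r \<open>e' > 0\<close> by (intro mult_left_mono) auto
          also have "\<dots> < e" using C_pos e by (simp add: e'_def)
          also have "integral {0..r} (\<lambda>s. k s * (f (u n s) - f (v s))) = W v r - W (u n) r"
            unfolding W_def using Henstock_Kurzweil_Integration.integral_diff[OF int]
            by (simp add: right_diff_distrib)
          finally show ?thesis
            by (simp add: Y_def dist_real_def right_diff_distrib abs_minus_commute)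
        qed (use e in simp)
      qed
    qed
  qed
  have uc: "uniformly_continuous_on {- (B * C)..B * C} g"
    by (intro compact_uniformly_continuous g_cont_on) auto
  show "uniform_limit {0..R} (\<lambda>n. V (u n)) (V v) sequentially"
    unfolding V_def
    by (rule uniform_limit_compose_uniformly_continuous_on[OF Ylim uc])
      (use Y_bound'[OF u] in \<open>auto simp: abs_le_iff minus_le_iff intro!: always_eventually\<close>)
qed

section \<open>Delayed approximations and compactness of families of orbits\<close>

lemma sol_cont: "sol \<epsilon> d u \<Longrightarrow> continuous_on {0..R} u"
  by (simp add: sol_def)

lemma sol_eq: "sol 0 d u \<Longrightarrow> r \<in> {0..R} \<Longrightarrow> u r = d + integral {0..r} (V u)"
  by (auto simp: sol_def)

lemma sol_lipschitz:
  assumes "sol \<epsilon> d u" "\<epsilon> \<ge> 0" "r \<in> {0..R}" "s \<in> {0..R}"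
  shows "\<bar>u r - u s\<bar> \<le> g (B * C) * \<bar>r - s\<bar>"
proof -
  note u = sol_cont[OF assms(1)]
  have "\<bar>integral {0..max 0 (r - \<epsilon>)} (V u) - integral {0..max 0 (s - \<epsilon>)} (V u)\<bar>
      \<le> g (B * C) * \<bar>max 0 (r - \<epsilon>) - max 0 (s - \<epsilon>)\<bar>"
    using assms by (intro integral_lipschitz[OF V_cont[OF u]] V_bound[OF u]) auto
  also have "\<dots> \<le> g (B * C) * \<bar>r - s\<bar>"
    using B_nonneg C_pos by (intro mult_left_mono) auto
  finally show ?thesis using assms by (auto simp: sol_def)
qed

text \<open>The delayed right-hand side at r uses u only on [0, r - \<epsilon>]. Hence the iterates
  \<open>U n\<close> and \<open>U (Suc n)\<close> agree on [0, n \<epsilon>], and the iteration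
  becomes stationary once n \<epsilon> exceeds R; no contraction enters.\<close>

lemma tonelli:
  assumes \<epsilon>: "\<epsilon> > 0"
  obtains u where "sol \<epsilon> d u"
proof -
  define T where "T u r = d + integral {0..max 0 (r - \<epsilon>)} (V u)" for u r
  define U where "U n = (T ^^ n) (\<lambda>_. d)" for n
  have U_Suc: "U (Suc n) = T (U n)" for n by (simp add: U_def)
  have T_cont: "continuous_on {0..R} (T u)" if u: "continuous_on {0..R} u" for u
  proof -
    have *: "continuous_on {0..R} (\<lambda>x. integral {0..x} (V u))"
      using V_cont[OF u] by (intro indefinite_integral_continuous_1 integrable_continuous_real)
    have "continuous_on {0..R} (\<lambda>r. integral {0..max 0 (r - \<epsilon>)} (V u))"
      by (rule continuous_on_compose2[OF *]) (use \<epsilon> in \<open>auto intro!: continuous_intros\<close>)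
    then show ?thesis
      unfolding T_def by (intro continuous_on_add continuous_on_const)
  qed
  have cont: "continuous_on {0..R} (U n)" for n
    by (induction n) (use T_cont in \<open>auto simp: U_Suc U_def\<close>)
  have agree: "U (Suc n) r = U n r" if "r \<in> {0..R}" "r \<le> real n * \<epsilon>" for n r
    using that
  proof (induction n arbitrary: r)
    case 0
    then show ?case using \<epsilon> by (simp add: U_def T_def)
  next
    case (Suc n)
    have "integral {0..max 0 (r - \<epsilon>)} (V (U (Suc n))) = integral {0..max 0 (r - \<epsilon>)} (V (U n))"
    proof (intro integral_cong V_cong)
      fix s t assume st: "s \<in> {0..max 0 (r - \<epsilon>)}" "t \<in> {0..s}"
      have "max 0 (r - \<epsilon>) \<le> real n * \<epsilon>"
        using Suc.prems \<epsilon> by (simp add: algebra_simps)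
      then have "t \<le> real n * \<epsilon>"
        using st by (meson atLeastAtMost_iff order_trans)
      moreover have "t \<in> {0..R}" using st Suc.prems \<epsilon> by auto
      ultimately have "t \<in> {0..R}" "t \<le> real n * \<epsilon>" by auto
      then show "U (Suc n) t = U n t" by (rule Suc.IH)
    qed
    then show ?case by (simp add: U_Suc T_def)
  qed
  obtain n :: nat where n: "R / \<epsilon> < real n" using reals_Archimedean2 by blast
  have "U n r = T (U n) r" if "r \<in> {0..R}" for r
    using agree[of r n] that n \<epsilon> by (simp add: U_Suc field_simps)
  then have "sol \<epsilon> d (U n)" using cont by (simp add: sol_def T_def)
  then show ?thesis by (rule that)
qed

text \<open>The Lipschitz constant g(BC) does not depend on the delay, so a subsequence converges
  uniformly. Delay and initial value vary together in order to serve two purposes: existence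
  (constant d, delay tending to 0) and continuous dependence (no delay, d tending to
  \<open>d0\<close>).\<close>

lemma sol_compact:
  assumes sol: "\<And>n. sol (\<epsilon> n) (d n) (u n)" and \<epsilon>: "\<And>n. \<epsilon> n \<ge> 0" "\<epsilon> \<longlonglongrightarrow> 0" and d: "d \<longlonglongrightarrow> d0"
  obtains l v where "strict_mono (l :: nat \<Rightarrow> nat)" "sol 0 d0 v"
    "uniform_limit {0..R} (\<lambda>n. u (l n)) v sequentially"
    "uniform_limit {0..R} (\<lambda>n. V (u (l n))) (V v) sequentially"
proof -
  note cont = sol_cont[OF sol]
  obtain D where D: "\<And>n. \<bar>d n\<bar> \<le> D"
    using convergent_imp_Bseq[OF convergentI[OF d]] by (auto simp: Bseq_def)
  have u0: "u n 0 = d n" for n using sol[of n] R_pos \<epsilon>(1)[of n] by (auto simp: sol_def)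
  have "\<bar>u n r\<bar> \<le> D + g (B * C) * R" if "r \<in> {0..R}" for n r
  proof -
    have "\<bar>u n r - u n 0\<bar> \<le> g (B * C) * \<bar>r - 0\<bar>"
      using that by (intro sol_lipschitz[OF sol \<epsilon>(1)]) auto
    also have "\<dots> \<le> g (B * C) * R"
      using that B_nonneg C_pos by (intro mult_left_mono) auto
    finally show ?thesis using D[of n] u0[of n] by linarith
  qed
  then obtain v l where l: "strict_mono (l :: nat \<Rightarrow> nat)"
    and lim: "uniform_limit {0..R} (\<lambda>n. u (l n)) v sequentially"
    using lipschitz_extract_uniform_limit[of R u, OF sol_lipschitz[OF sol \<epsilon>(1)]] by metis
  note v = V_uniform_limit[OF cont lim]
  have "v r = d0 + integral {0..r} (V v)" if r: "r \<in> {0..R}" for r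
  proof (rule LIMSEQ_unique)
    show "(\<lambda>n. u (l n) r) \<longlonglongrightarrow> v r"
      using tendsto_uniform_limitI[OF lim r] .
    \<comment> \<open>Two errors are controlled separately: shortening the interval costs at most L
      times the delay, and changing the integrand costs at most R times its uniform distance to the
      limit.\<close>
    have "(\<lambda>n. integral {0..max 0 (r - \<epsilon> (l n))} (V (u (l n))) - integral {0..r} (V v)) \<longlonglongrightarrow> 0"
    proof (rule tendstoI)
      fix e :: real assume e: "e > 0"
      define L where "L = g (B * C)"
      have el: "(\<lambda>n. \<epsilon> (l n)) \<longlonglongrightarrow> 0" using LIMSEQ_subseq_LIMSEQ[OF \<epsilon>(2) l] by (simp add: o_def)
      have L0: "L \<ge> 0" using B_nonneg C_pos by (simp add: L_def)
      have "\<forall>\<^sub>F n in sequentially. \<epsilon> (l n) < e / (2 * (L + 1))"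
        using order_tendstoD(2)[OF el] e L0 by simp
      moreover have "\<forall>\<^sub>F n in sequentially. \<forall>x\<in>{0..R}. dist (V (u (l n)) x) (V v x) < e / (3 * R)"
        using uniform_limitD[OF v(2)] e R_pos by simp
      ultimately show "\<forall>\<^sub>F n in sequentially.
          dist (integral {0..max 0 (r - \<epsilon> (l n))} (V (u (l n))) - integral {0..r} (V v)) 0 < e"
      proof eventually_elim
        case (elim n)
        let ?h = "V (u (l n))"
        have "\<bar>integral {0..max 0 (r - \<epsilon> (l n))} ?h - integral {0..r} ?h\<bar> \<le> L * \<bar>max 0 (r - \<epsilon> (l n)) - r\<bar>"
          unfolding L_def using r R_pos \<epsilon>(1)[of "l n"] by (intro integral_lipschitz[OF V_cont[OF cont]] V_bound[OF cont]) auto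
        also have "\<dots> \<le> L * \<epsilon> (l n)"
          using r \<epsilon>(1)[of "l n"] L0 by (intro mult_left_mono) auto
        also have "\<dots> \<le> L * (e / (2 * (L + 1)))"
          using elim L0 by (intro mult_left_mono) auto
        also have "\<dots> < e / 2" using e L0 by (simp add: field_simps)
        finally have 1: "\<bar>integral {0..max 0 (r - \<epsilon> (l n))} ?h - integral {0..r} ?h\<bar> < e / 2" .
        have sub: "continuous_on {0..r} ?h" "continuous_on {0..r} (V v)"
          using r by (auto intro: continuous_on_subset[OF V_cont[OF cont]] continuous_on_subset[OF V_cont[OF v(1)]])
        have "norm (integral {0..r} (\<lambda>s. ?h s - V v s)) \<le> e / (3 * R) * (r - 0)"
        proof (rule integral_bound)
          fix s assume "s \<in> {0..r}"
          then show "norm (?h s - V v s) \<le> e / (3 * R)" using elim r by (force simp: dist_norm)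
        qed (use r sub in \<open>auto intro: continuous_intros\<close>)
        also have "\<dots> \<le> e / (3 * R) * R"
          using r R_pos e by (intro mult_left_mono) auto
        also have "\<dots> < e / 2" using R_pos e by simp
        also have "integral {0..r} (\<lambda>s. ?h s - V v s) = integral {0..r} ?h - integral {0..r} (V v)"
          by (intro Henstock_Kurzweil_Integration.integral_diff integrable_continuous_real sub)
        finally show ?case using 1 unfolding dist_norm real_norm_def diff_0_right by linarith
      qed
    qed
    then have "(\<lambda>n. (integral {0..max 0 (r - \<epsilon> (l n))} (V (u (l n))) - integral {0..r} (V v))
        + (d (l n) + integral {0..r} (V v))) \<longlonglongrightarrow> 0 + (d0 + integral {0..r} (V v))"
      using LIMSEQ_subseq_LIMSEQ[OF d l] by (intro tendsto_intros) (simp_all add: o_def)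
    moreover have "u (l n) r = d (l n) + integral {0..max 0 (r - \<epsilon> (l n))} (V (u (l n)))" for n
      using sol[of "l n"] r by (simp add: sol_def)
    ultimately show "(\<lambda>n. u (l n) r) \<longlonglongrightarrow> d0 + integral {0..r} (V v)"
      by (simp add: algebra_simps)
  qed
  then have "sol 0 d0 v" using v(1) by (simp add: sol_def)
  then show ?thesis using that[OF l _ lim v(2)] by blast
qed

lemma sol_exists: obtains u where "sol 0 d u"
proof -
  have "\<forall>n. \<exists>u. sol (1 / real (Suc n)) d u"
    using tonelli by (metis of_nat_0_less_iff zero_less_Suc zero_less_divide_1_iff)
  then obtain u where "\<And>n. sol (1 / real (Suc n)) d (u n)" by metis
  then obtain v where "sol 0 d v"
    by (rule sol_compact[of "\<lambda>n. 1 / real (Suc n)" "\<lambda>_. d" u d])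
      (use LIMSEQ_inverse_real_of_nat in \<open>auto simp: inverse_eq_divide\<close>)
  then show ?thesis by (rule that)
qed

end

section \<open>Energy\<close>

lemma mean_value_within:
  fixes h :: "real \<Rightarrow> real"
  assumes "a < b" and h: "\<And>x. x \<in> {a..b} \<Longrightarrow> (h has_real_derivative h' x) (at x within {a..b})"
  obtains z where "a < z" "z < b" "h b - h a = (b - a) * h' z"
proof -
  obtain z where "z \<in> {a<..<b}" "h b - h a = h' z * (b - a)"
    using mvt_simple[OF assms(1), of h "\<lambda>x. (*) (h' x)"] h by (auto simp: has_field_derivative_def)
  then show ?thesis using that[of z] by (simp add: mult.commute)
qed

context shooting
begin

definition F where "F = prim f"

text \<open>As \<open>P\<close> is a Legendre transform, \<open>P (Y u r)\<close> is the integral of \<open>s (s \<phi>(s))'\<close> over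
  \<open>[0, \<bar>u'(r)\<bar>]\<close>. The weight \<open>r powr (\<alpha> - \<gamma>)\<close> removes \<open>f\<close> from \<open>E'\<close>.\<close>
definition E where "E u r = r powr (\<alpha> - \<gamma>) * P (Y u r) + F (u r)"

text \<open>Multiplied by r^(\<alpha> - \<gamma> - 1) and evaluated at \<open>Y u r\<close>, this is
  the derivative of the energy. The term in P stems from the weight of E, the term in y g(y) from
  the factor r^(-\<alpha>) in Y.\<close>

definition dissip where "dissip y = (\<alpha> - \<gamma>) * P y - \<alpha> * (y * g y)"

lemma F_0 [simp]: "F 0 = 0"
  unfolding F_def by (rule prim_0[OF f_cont])

lemma F_deriv: "(F has_real_derivative f y) (at y)"
  unfolding F_def by (rule DERIV_prim[OF f_cont])

lemma F_cont: "continuous_on A F"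
  unfolding F_def by (rule prim_continuous[OF f_cont])

lemma F_strict_mono_pos: "0 \<le> x \<Longrightarrow> x < y \<Longrightarrow> F x < F y"
proof -
  assume *: "0 \<le> x" "x < y"
  obtain z where z: "x < z" "z < y" "F y - F x = (y - x) * f z"
    using MVT2[OF *(2), of F f] F_deriv by blast
  then have "f z > 0" using f_pos * by simp
  then have "(y - x) * f z > 0" using * by simp
  then show ?thesis using z(3) by linarith
qed

lemma F_strict_mono_neg: "x \<le> 0 \<Longrightarrow> y < x \<Longrightarrow> F x < F y"
proof -
  assume *: "x \<le> 0" "y < x"
  obtain z where z: "y < z" "z < x" "F x - F y = (x - y) * f z"
    using MVT2[OF *(2), of F f] F_deriv by blast
  then have "f z < 0" using f_neg * by simp
  then have "(x - y) * f z < 0" using * by (simp add: mult_pos_neg)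
  then show ?thesis using z(3) by linarith
qed

lemma F_pos: "x \<noteq> 0 \<Longrightarrow> F x > 0"
  using F_strict_mono_pos[of 0 x] F_strict_mono_neg[of 0 x] by (cases "x > 0") auto

lemma F_nonneg: "F x \<ge> 0"
  using F_pos[of x] by (cases "x = 0") auto

lemma F_lipschitz: "\<bar>F x - F y\<bar> \<le> B * \<bar>x - y\<bar>"
proof -
  have *: "\<bar>F x - F y\<bar> \<le> B * \<bar>x - y\<bar>" if lt: "x < y" for x y
  proof -
    obtain z where z: "F y - F x = (y - x) * f z"
      using MVT2[OF lt, of F f] F_deriv by blast
    have "\<bar>(y - x) * f z\<bar> \<le> B * \<bar>x - y\<bar>"
      using f_bound[of z] lt by (simp add: abs_mult mult.commute mult_left_mono)
    then show ?thesis using z by linarith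
  qed
  show ?thesis
    using *[of x y] *[of y x] by (cases x y rule: linorder_cases) (auto simp: abs_minus_commute)
qed

lemma sol_0: "sol 0 d u \<Longrightarrow> u 0 = d"
  using sol_eq[of d u 0] R_pos by simp

lemma sol_deriv:
  assumes "sol 0 d u" "r \<in> {0..R}"
  shows "(u has_real_derivative V u r) (at r within {0..R})"
proof -
  have "((\<lambda>r. d + integral {0..r} (V u)) has_real_derivative (0 + V u r)) (at r within {0..R})"
    by (intro DERIV_add DERIV_const integral_has_real_derivative V_cont[OF sol_cont[OF assms(1)]] assms)
  then show ?thesis
    using has_field_derivative_transform_within[OF _ zero_less_one assms(2)] sol_eq[OF assms(1)] by simp
qed

lemma sol_deriv_at: "sol 0 d u \<Longrightarrow> 0 < r \<Longrightarrow> r < R \<Longrightarrow> (u has_real_derivative V u r) (at r)"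
  using sol_deriv[of d u r] by (simp add: at_within_Icc_at)

lemma W_deriv_at:
  "continuous_on {0..R} u \<Longrightarrow> 0 < r \<Longrightarrow> r < R \<Longrightarrow> (W u has_real_derivative - (r powr \<gamma> * f (u r))) (at r)"
  using W_deriv[of u r] by (simp add: at_within_Icc_at k_pos)

lemma E_deriv:
  assumes u: "sol 0 d u" and r: "0 < r" "r < R"
  shows "(E u has_real_derivative r powr (\<alpha> - \<gamma> - 1) * dissip (Y u r)) (at r)"
proof -
  note Wd = W_deriv_at[OF sol_cont[OF u] r]
  have Yd: "(Y u has_real_derivative
      ((-\<alpha>) * r powr (-\<alpha> - 1) * W u r + - (r powr \<gamma> * f (u r)) * r powr (-\<alpha>))) (at r)"
    unfolding Y_def by (intro DERIV_mult has_real_derivative_powr Wd r)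
  have "(E u has_real_derivative
      ((\<alpha> - \<gamma>) * r powr (\<alpha> - \<gamma> - 1) * P (Y u r) +
       g (Y u r) * ((-\<alpha>) * r powr (-\<alpha> - 1) * W u r + - (r powr \<gamma> * f (u r)) * r powr (-\<alpha>)) * r powr (\<alpha> - \<gamma>)
       + f (u r) * V u r)) (at r)"
    unfolding E_def
    by (intro DERIV_add DERIV_mult has_real_derivative_powr r DERIV_chain2[OF P_deriv Yd]
        DERIV_chain2[OF F_deriv sol_deriv_at[OF u r]])
  moreover have "(\<alpha> - \<gamma>) * r powr (\<alpha> - \<gamma> - 1) * P (Y u r) +
       g (Y u r) * ((-\<alpha>) * r powr (-\<alpha> - 1) * W u r + - (r powr \<gamma> * f (u r)) * r powr (-\<alpha>)) * r powr (\<alpha> - \<gamma>)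
       + f (u r) * V u r = r powr (\<alpha> - \<gamma> - 1) * dissip (Y u r)"
  proof -
    have 1: "r powr (\<alpha> - \<gamma> - 1) = r powr (\<alpha> - \<gamma>) / r" "r powr (-\<alpha> - 1) = r powr (-\<alpha>) / r"
      using r by (simp_all add: powr_diff)
    have 2: "r powr (\<alpha> - \<gamma>) * (r powr \<gamma> * r powr (-\<alpha>)) = 1"
      using r by (simp flip: powr_add)
    have 3: "g (Y u r) * (- (r powr \<gamma> * f (u r)) * r powr (-\<alpha>)) * r powr (\<alpha> - \<gamma>) + f (u r) * V u r
      = (1 - r powr (\<alpha> - \<gamma>) * (r powr \<gamma> * r powr (-\<alpha>))) * (f (u r) * g (Y u r))"
      by (simp add: V_def algebra_simps)
    have "(\<alpha> - \<gamma>) * r powr (\<alpha> - \<gamma> - 1) * P (Y u r) +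
       g (Y u r) * ((-\<alpha>) * r powr (-\<alpha> - 1) * W u r + - (r powr \<gamma> * f (u r)) * r powr (-\<alpha>)) * r powr (\<alpha> - \<gamma>)
       + f (u r) * V u r
      = (\<alpha> - \<gamma>) * r powr (\<alpha> - \<gamma> - 1) * P (Y u r) +
       g (Y u r) * ((-\<alpha>) * r powr (-\<alpha> - 1) * W u r) * r powr (\<alpha> - \<gamma>)
      + (g (Y u r) * (- (r powr \<gamma> * f (u r)) * r powr (-\<alpha>)) * r powr (\<alpha> - \<gamma>) + f (u r) * V u r)"
      by (simp add: algebra_simps)
    also have "\<dots> = (\<alpha> - \<gamma>) * r powr (\<alpha> - \<gamma> - 1) * P (Y u r) +
       g (Y u r) * ((-\<alpha>) * r powr (-\<alpha> - 1) * W u r) * r powr (\<alpha> - \<gamma>)"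
      unfolding 3 2 by simp
    also have "\<dots> = r powr (\<alpha> - \<gamma> - 1) * dissip (Y u r)"
      unfolding 1 dissip_def Y_def using r by (simp add: field_simps)
    finally show ?thesis .
  qed
  ultimately show ?thesis by metis
qed

text \<open>For \<alpha> \<ge> 0, \<open>P_le\<close> leaves at most -\<gamma> P(y). For \<alpha> <
  0, \<open>P_ge\<close> leaves at most -(\<gamma> + \<alpha> p) P(y). Both are nonpositive by the
  assumptions on \<gamma>.\<close>

lemma dissip_nonpos: "dissip y \<le> 0"
proof (cases "\<alpha> \<ge> 0")
  case True
  have "\<alpha> * P y \<le> \<alpha> * (y * g y)" by (intro mult_left_mono P_le True)
  moreover have "\<gamma> * P y \<ge> 0" using gamma P_nonneg by simp
  ultimately show ?thesis by (simp add: dissip_def algebra_simps)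
next
  case False
  then have "(-\<alpha>) * (y * g y) \<le> (-\<alpha>) * ((1 + p) * P y)" by (intro mult_left_mono P_ge) auto
  moreover have "(-\<alpha> * p) * P y \<le> \<gamma> * P y" by (intro mult_right_mono gamma P_nonneg)
  ultimately show ?thesis by (simp add: dissip_def algebra_simps)
qed

text \<open>The decay exponent: dissip(y) \<ge> -K P(y), so that r^K E is nondecreasing.\<close>

definition K where "K = \<gamma> + \<bar>\<alpha>\<bar> * (2 + p)"

lemma dissip_ge: "dissip y \<ge> - K * P y"
proof -
  have "\<alpha> * (y * g y) \<le> \<bar>\<alpha>\<bar> * (y * g y)"
    by (intro mult_right_mono) (auto simp: zero_le_mult_iff)
  also have "\<dots> \<le> \<bar>\<alpha>\<bar> * ((1 + p) * P y)" by (intro mult_left_mono P_ge) auto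
  finally have "\<alpha> * (y * g y) \<le> \<bar>\<alpha>\<bar> * ((1 + p) * P y)" .
  moreover have "- \<alpha> * P y \<le> \<bar>\<alpha>\<bar> * P y" by (intro mult_right_mono P_nonneg) auto
  ultimately show ?thesis by (simp add: dissip_def K_def algebra_simps)
qed

lemma E_cont:
  assumes u: "sol 0 d u" and "0 < s"
  shows "continuous_on {s..R} (E u)"
  unfolding E_def using assms(2)
  by (intro continuous_intros continuous_on_compose2[OF P_cont[of UNIV]] continuous_on_compose2[OF F_cont[of UNIV]]
      continuous_on_subset[OF Y_cont[OF sol_cont[OF u]]] continuous_on_subset[OF sol_cont[OF u]]) auto

lemma E_antimono:
  assumes u: "sol 0 d u" and s: "0 < s" "s \<le> r" "r \<le> R"
  shows "E u r \<le> E u s"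
proof (rule DERIV_nonpos_imp_decreasing_open[OF s(2)])
  fix x assume x: "s < x" "x < r"
  show "\<exists>y. (E u has_real_derivative y) (at x) \<and> y \<le> 0"
    using E_deriv[OF u, of x] dissip_nonpos[of "Y u x"] x s
    by (intro exI[of _ "x powr (\<alpha> - \<gamma> - 1) * dissip (Y u x)"]) (auto simp: mult_nonneg_nonpos)
qed (use E_cont[OF u s(1)] s in \<open>auto intro: continuous_on_subset\<close>)

text \<open>The energy may be undefined at 0 because of its weight, so the initial value is reached
  as a limit. Since P(Y) \<le> |Y| g(|Y|) and |Y| \<le> B s^(1 + \<gamma> - \<alpha>), the weighted
  term is O(s), and the energy tends to at most F(d) as s decreases to 0.\<close>

lemma F_sol_le:
  assumes u: "sol 0 d u" and r: "r \<in> {0..R}"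
  shows "F (u r) \<le> F d"
proof (cases "r = 0")
  case True
  then show ?thesis using sol_0[OF u] by simp
next
  case False
  then have r0: "r > 0" using r by simp
  have bound: "F (u r) \<le> B * s * g (B * C) + F (u s)" if s: "0 < s" "s \<le> r" for s
  proof -
    have "P (Y u s) \<le> \<bar>Y u s\<bar> * g \<bar>Y u s\<bar>" using P_le[of "\<bar>Y u s\<bar>"] by (simp add: P_abs)
    also have "\<dots> \<le> (B * s powr (1 + \<gamma> - \<alpha>)) * g (B * C)"
      using s r Y_bound[OF sol_cont[OF u], of s] Y_bound'[OF sol_cont[OF u], of s] B_nonneg
      by (intro mult_mono) auto
    finally have "s powr (\<alpha> - \<gamma>) * P (Y u s) \<le> s powr (\<alpha> - \<gamma>) * ((B * s powr (1 + \<gamma> - \<alpha>)) * g (B * C))"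
      by (intro mult_left_mono) auto
    also have "\<dots> = (s powr (\<alpha> - \<gamma>) * s powr (1 + \<gamma> - \<alpha>)) * (B * g (B * C))" by (simp add: algebra_simps)
    also have "s powr (\<alpha> - \<gamma>) * s powr (1 + \<gamma> - \<alpha>) = s" using s by (simp flip: powr_add)
    finally have "E u s \<le> B * s * g (B * C) + F (u s)" by (simp add: E_def algebra_simps)
    moreover have "E u r \<le> E u s" using E_antimono[OF u] s r by simp
    moreover have "F (u r) \<le> E u r" using P_nonneg by (simp add: E_def)
    ultimately show ?thesis by linarith
  qed
  have "continuous_on {0..R} (\<lambda>s. B * s * g (B * C) + F (u s))"
    by (intro continuous_intros continuous_on_compose2[OF F_cont[of UNIV]] sol_cont[OF u]) auto
  then have "((\<lambda>s. B * s * g (B * C) + F (u s)) \<longlongrightarrow> B * 0 * g (B * C) + F (u 0)) (at 0 within {0..R})"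
    using R_pos unfolding continuous_on_def by (elim ballE[where x = 0]) auto
  then have "((\<lambda>s. B * s * g (B * C) + F (u s)) \<longlongrightarrow> F d) (at_right 0)"
    using at_within_Icc_at_right[OF R_pos] sol_0[OF u] by simp
  moreover have "\<forall>\<^sub>F s in at_right 0. F (u r) \<le> B * s * g (B * C) + F (u s)"
    using bound eventually_at_right_less[of 0] eventually_at_right_real[OF r0]
    by (auto elim: eventually_mono)
  ultimately show ?thesis by (rule tendsto_lowerbound) simp
qed

text \<open>Near r = 0 the orbit is positive, hence so is F(u) and with it the energy. As r^K E is
  nondecreasing, the energy cannot reach 0 afterwards.\<close>

lemma E_pos:
  assumes u: "sol 0 d u" and d: "d > 0" and r: "0 < r" "r \<le> R"
  shows "E u r > 0"
proof -
  have "\<forall>\<^sub>F s in at 0 within {0..R}. u s > 0"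
    using sol_cont[OF u] R_pos d sol_0[OF u] by (auto simp: continuous_on_def intro: order_tendstoD)
  then have "\<forall>\<^sub>F s in at_right 0. u s > 0" using at_within_Icc_at_right[OF R_pos] by simp
  moreover have "\<forall>\<^sub>F s in at_right 0. s \<in> {0<..<r}" using eventually_at_right_real[OF r(1)] .
  ultimately have "\<forall>\<^sub>F s in at_right 0. u s > 0 \<and> s \<in> {0<..<r}" by eventually_elim simp
  then obtain s where s: "u s > 0" "0 < s" "s < r"
    using eventually_happens[of _ "at_right (0::real)"] by fastforce
  have "E u s > 0" using F_pos[of "u s"] s P_nonneg by (simp add: E_def add_nonneg_pos)
  have "E u s * s powr K \<le> E u r * r powr K"
  proof (rule DERIV_nonneg_imp_increasing_open[of s r "\<lambda>r. E u r * r powr K"])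
    fix x assume x: "s < x" "x < r"
    let ?D = "x powr (\<alpha> - \<gamma> - 1) * dissip (Y u x) * x powr K + K * x powr (K - 1) * E u x"
    have "((\<lambda>r. E u r * r powr K) has_real_derivative ?D) (at x)"
      using x s r by (intro DERIV_mult E_deriv[OF u] has_real_derivative_powr) auto
    moreover have "?D \<ge> 0"
    proof -
      have "x powr (\<alpha> - \<gamma> - 1) = x powr (\<alpha> - \<gamma>) / x" "x powr (K - 1) = x powr K / x"
        using x s by (simp_all add: powr_diff)
      then have D: "?D = x powr (K - 1) * (x powr (\<alpha> - \<gamma>) * dissip (Y u x) + K * E u x)"
        by (simp add: algebra_simps add_divide_distrib)
      have "x powr (\<alpha> - \<gamma>) * (- K * P (Y u x)) \<le> x powr (\<alpha> - \<gamma>) * dissip (Y u x)"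
        by (intro mult_left_mono dissip_ge) auto
      moreover have "K * F (u x) \<ge> 0" using F_nonneg gamma p_pos by (simp add: K_def)
      ultimately have "x powr (\<alpha> - \<gamma>) * dissip (Y u x) + K * E u x \<ge> 0"
        by (simp add: E_def algebra_simps)
      then show ?thesis unfolding D by (intro mult_nonneg_nonneg) auto
    qed
    ultimately show "\<exists>y. ((\<lambda>r. E u r * r powr K) has_real_derivative y) (at x) \<and> 0 \<le> y"
      by blast
  next
    show "continuous_on {s..r} (\<lambda>r. E u r * r powr K)"
      using s r by (intro continuous_intros continuous_on_subset[OF E_cont[OF u s(2)]]) auto
  qed (use s in auto)
  moreover have "E u s * s powr K > 0" using \<open>E u s > 0\<close> s by simp
  ultimately have "E u r * r powr K > 0" by linarith
  then show ?thesis by (simp add: zero_less_mult_iff)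
qed

text \<open>Both terms of the energy vanish at a common zero of u and u', contradicting
  \<open>E_pos\<close>. The point r = 0 is excluded by u(0) = d > 0.\<close>

lemma no_double_zero:
  assumes u: "sol 0 d u" and d: "d > 0" and r: "r \<in> {0..R}" and "u r = 0"
  shows "V u r \<noteq> 0"
proof
  assume "V u r = 0"
  then have "E u r = 0" using assms by (simp add: E_def V_def)
  moreover have "r \<noteq> 0" using assms sol_0[OF u] by auto
  ultimately show False using E_pos[OF u d, of r] r by auto
qed

end

section \<open>Uniqueness\<close>

lemma gronwall_zero:
  fixes N :: "real \<Rightarrow> real"
  assumes cont: "continuous_on {a..b} N" and zero: "N a = 0"
    and deriv: "\<And>x. a < x \<Longrightarrow> x < b \<Longrightarrow> \<exists>N'. (N has_real_derivative N') (at x) \<and> N' \<le> c * N x"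
    and x: "x \<in> {a..b}"
  shows "N x \<le> 0"
proof -
  have "N x * exp (- c * x) \<le> N a * exp (- c * a)"
  proof (rule DERIV_nonpos_imp_decreasing_open[of a x "\<lambda>x. N x * exp (- c * x)"])
    fix y assume y: "a < y" "y < x"
    then obtain N' where N': "(N has_real_derivative N') (at y)" "N' \<le> c * N y"
      using deriv[of y] x by auto
    have "((\<lambda>x. N x * exp (- c * x)) has_real_derivative (N' - c * N y) * exp (- c * y)) (at y)"
      by (auto intro!: derivative_eq_intros N' simp: algebra_simps)
    then show "\<exists>z. ((\<lambda>x. N x * exp (- c * x)) has_real_derivative z) (at y) \<and> z \<le> 0"
      using N'(2) by (intro exI conjI) (auto simp: mult_nonpos_nonneg)
  qed (use x in \<open>auto intro!: continuous_intros continuous_on_subset[OF cont]\<close>)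
  then show ?thesis using zero by (simp add: mult_le_0_iff)
qed

lemma continuous_near_right:
  fixes h :: "real \<Rightarrow> real"
  assumes "continuous_on {0..R} h" "r0 \<in> {0..<R}" "e > 0"
  obtains \<delta> where "\<delta> > 0" "r0 + \<delta> \<le> R" "\<And>s. s \<in> {r0..r0 + \<delta>} \<Longrightarrow> \<bar>h s - h r0\<bar> < e"
proof -
  obtain d where d: "d > 0" "\<And>s. s \<in> {0..R} \<Longrightarrow> dist s r0 < d \<Longrightarrow> dist (h s) (h r0) < e"
    using assms unfolding continuous_on_iff by force
  show ?thesis
  proof (rule that[of "min (d / 2) (R - r0)"])
    fix s assume "s \<in> {r0..r0 + min (d / 2) (R - r0)}"
    then show "\<bar>h s - h r0\<bar> < e"
      using d(2)[of s] assms d(1) by (auto simp: dist_real_def)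
  qed (use assms d in auto)
qed

text \<open>Turns a Lipschitz bound in |a| + |b| into N' \<le> 4 c N for N = a^2 + b^2, which unlike
  |a| + |b| can be differentiated.\<close>

lemma sum_square_bound:
  fixes a b a' b' c :: real
  assumes "\<bar>a'\<bar> \<le> c * (\<bar>a\<bar> + \<bar>b\<bar>)" "\<bar>b'\<bar> \<le> c * (\<bar>a\<bar> + \<bar>b\<bar>)" "c \<ge> 0"
  shows "2 * a * a' + 2 * b * b' \<le> 4 * c * (a\<^sup>2 + b\<^sup>2)"
proof -
  have "a * a' \<le> \<bar>a\<bar> * \<bar>a'\<bar>" "b * b' \<le> \<bar>b\<bar> * \<bar>b'\<bar>" by (simp_all flip: abs_mult)
  moreover have "\<bar>a\<bar> * \<bar>a'\<bar> \<le> \<bar>a\<bar> * (c * (\<bar>a\<bar> + \<bar>b\<bar>))" "\<bar>b\<bar> * \<bar>b'\<bar> \<le> \<bar>b\<bar> * (c * (\<bar>a\<bar> + \<bar>b\<bar>))"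
    using assms by (auto intro: mult_left_mono)
  ultimately have "2 * a * a' + 2 * b * b' \<le> 2 * c * (\<bar>a\<bar> + \<bar>b\<bar>)\<^sup>2"
    by (simp add: power2_eq_square algebra_simps)
  also have "\<dots> \<le> 2 * c * (2 * (\<bar>a\<bar>\<^sup>2 + \<bar>b\<bar>\<^sup>2))"
    using assms(3) sum_squares_bound[of "\<bar>a\<bar>" "\<bar>b\<bar>"]
    by (intro mult_left_mono) (auto simp: power2_sum)
  finally show ?thesis by (simp add: algebra_simps)
qed

context shooting
begin

lemma dissip_lipschitz:
  assumes "0 < m" "m \<le> \<bar>y1\<bar>" "m \<le> \<bar>y2\<bar>" "\<bar>y1\<bar> \<le> b" "\<bar>y2\<bar> \<le> b" "y1 * y2 > 0"
  shows "\<bar>dissip y1 - dissip y2\<bar> \<le> (\<bar>\<alpha> - \<gamma>\<bar> * g b + \<bar>\<alpha>\<bar> * (g b + b * (p * g b / m))) * \<bar>y1 - y2\<bar>"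
proof -
  have b: "0 \<le> b" using assms by linarith
  have "y1 * g y1 - y2 * g y2 = (y1 - y2) * g y1 + y2 * (g y1 - g y2)" by (simp add: algebra_simps)
  moreover have "\<bar>(y1 - y2) * g y1\<bar> \<le> \<bar>y1 - y2\<bar> * g b"
    unfolding abs_mult using assms by (intro mult_left_mono) (auto simp: g_abs)
  moreover have "\<bar>y2 * (g y1 - g y2)\<bar> \<le> b * (p * g b / m * \<bar>y1 - y2\<bar>)"
    unfolding abs_mult using assms g_lipschitz[OF assms] b by (intro mult_mono) auto
  ultimately have "\<bar>y1 * g y1 - y2 * g y2\<bar> \<le> (g b + b * (p * g b / m)) * \<bar>y1 - y2\<bar>"
    by (simp add: algebra_simps)
  then have "\<bar>\<alpha> * (y1 * g y1 - y2 * g y2)\<bar> \<le> \<bar>\<alpha>\<bar> * ((g b + b * (p * g b / m)) * \<bar>y1 - y2\<bar>)"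
    unfolding abs_mult by (intro mult_left_mono) auto
  moreover have "\<bar>(\<alpha> - \<gamma>) * (P y1 - P y2)\<bar> \<le> \<bar>\<alpha> - \<gamma>\<bar> * (g b * \<bar>y1 - y2\<bar>)"
    unfolding abs_mult using assms by (intro mult_left_mono P_upper_lipschitz) auto
  moreover have "dissip y1 - dissip y2 = (\<alpha> - \<gamma>) * (P y1 - P y2) - \<alpha> * (y1 * g y1 - y2 * g y2)"
    by (simp add: dissip_def algebra_simps)
  ultimately have "\<bar>dissip y1 - dissip y2\<bar> \<le> \<bar>\<alpha> - \<gamma>\<bar> * (g b * \<bar>y1 - y2\<bar>)
      + \<bar>\<alpha>\<bar> * ((g b + b * (p * g b / m)) * \<bar>y1 - y2\<bar>)" by linarith
  then show ?thesis by (simp add: algebra_simps)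
qed

text \<open>Away from critical points, \<open>(u, E)\<close> solves a system which is Lipschitz even where \<open>f\<close> is not,
  as it involves \<open>f\<close> only through its primitive.\<close>

lemma extend_agreement_noncritical:
  assumes u: "sol 0 d u" and v: "sol 0 d v" and r0: "r0 \<in> {0..<R}"
    and agree: "\<And>s. s \<in> {0..r0} \<Longrightarrow> u s = v s" and Y0: "Y u r0 \<noteq> 0"
  obtains \<delta> where "\<delta> > 0" "r0 + \<delta> \<le> R" "\<And>s. s \<in> {r0..r0 + \<delta>} \<Longrightarrow> u s = v s"
proof -
  note uc = sol_cont[OF u] and vc = sol_cont[OF v]
  have r0_pos: "r0 > 0" using r0 Y0 by (cases "r0 = 0") auto
  have WW: "W u r0 = W v r0"
    unfolding W_def using agree by (intro arg_cong[where f = uminus] integral_cong) auto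
  then have YY: "Y u r0 = Y v r0" by (simp add: Y_def)
  \<comment> \<open>Staying within half of the initial flux keeps both fluxes on the same side of 0
    and at distance at least m from it, as the Lipschitz bounds on g and P demand.\<close>
  define m where "m = \<bar>Y u r0\<bar> / 2"
  have m: "m > 0" using Y0 by (simp add: m_def)
  obtain \<delta>1 where \<delta>1: "\<delta>1 > 0" "r0 + \<delta>1 \<le> R" "\<And>s. s \<in> {r0..r0 + \<delta>1} \<Longrightarrow> \<bar>Y u s - Y u r0\<bar> < m"
    using continuous_near_right[OF Y_cont[OF uc] r0 m] by blast
  obtain \<delta>2 where \<delta>2: "\<delta>2 > 0" "r0 + \<delta>2 \<le> R" "\<And>s. s \<in> {r0..r0 + \<delta>2} \<Longrightarrow> \<bar>Y v s - Y v r0\<bar> < m"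
    using continuous_near_right[OF Y_cont[OF vc] r0 m] by blast
  define \<delta> where "\<delta> = min \<delta>1 \<delta>2"
  have \<delta>: "\<delta> > 0" "r0 + \<delta> \<le> R" using \<delta>1 \<delta>2 by (auto simp: \<delta>_def)
  define b where "b = B * C"
  have near: "m \<le> \<bar>Y u s\<bar>" "m \<le> \<bar>Y v s\<bar>" "\<bar>Y u s\<bar> \<le> b" "\<bar>Y v s\<bar> \<le> b" "Y u s * Y v s > 0"
    if s: "s \<in> {r0..r0 + \<delta>}" for s
  proof -
    have 1: "\<bar>Y u s - Y u r0\<bar> < m" "\<bar>Y v s - Y u r0\<bar> < m"
      using \<delta>1(3)[of s] \<delta>2(3)[of s] s YY by (auto simp: \<delta>_def)
    then show "m \<le> \<bar>Y u s\<bar>" "m \<le> \<bar>Y v s\<bar>" unfolding m_def by linarith+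
    show "\<bar>Y u s\<bar> \<le> b" "\<bar>Y v s\<bar> \<le> b"
      using s r0 \<delta> Y_bound'[OF uc, of s] Y_bound'[OF vc, of s] by (auto simp: b_def)
    have "Y u s > 0 \<and> Y v s > 0 \<or> Y u s < 0 \<and> Y v s < 0"
      using 1 Y0 unfolding m_def by linarith
    then show "Y u s * Y v s > 0" by (auto simp: zero_less_mult_iff)
  qed
  \<comment> \<open>\<open>l1\<close> is the Lipschitz constant of the flux Y as a function of (u,
    E). Multiplying it by \<open>l2\<close> and \<open>l3\<close> gives those of u' and E'.\<close>
  define l1 where "l1 = R powr (\<gamma> - \<alpha>) * (1 + B) / g m"
  define l2 where "l2 = p * g b / m"
  define l3 where "l3 = r0 powr (\<alpha> - \<gamma> - 1) * (\<bar>\<alpha> - \<gamma>\<bar> * g b + \<bar>\<alpha>\<bar> * (g b + b * (p * g b / m)))"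
  have b: "b \<ge> 0" using B_nonneg C_pos by (simp add: b_def)
  have l_nonneg: "l1 \<ge> 0" "l2 \<ge> 0" "l3 \<ge> 0"
    using b B_nonneg m p_pos by (auto simp: l1_def l2_def l3_def intro!: mult_nonneg_nonneg divide_nonneg_nonneg)
  define N where "N s = (u s - v s)\<^sup>2 + (E u s - E v s)\<^sup>2" for s
  have "N s \<le> 0" if "s \<in> {r0..r0 + \<delta>}" for s
  proof (rule gronwall_zero[of r0 "r0 + \<delta>" N "4 * ((l2 + l3) * l1)"])
    show "continuous_on {r0..r0 + \<delta>} N"
      unfolding N_def using r0 \<delta>
      by (intro continuous_intros continuous_on_subset[OF E_cont[OF u r0_pos]]
          continuous_on_subset[OF E_cont[OF v r0_pos]] continuous_on_subset[OF uc] continuous_on_subset[OF vc]) auto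
    show "N r0 = 0" using agree[of r0] r0 YY by (simp add: N_def E_def)
    show "s \<in> {r0..r0 + \<delta>}" by fact
    fix x assume x: "r0 < x" "x < r0 + \<delta>"
    then have x': "0 < x" "x < R" "x \<in> {r0..r0 + \<delta>}" using r0_pos \<delta> by auto
    note nx = near[OF x'(3)]
    let ?S = "\<bar>u x - v x\<bar> + \<bar>E u x - E v x\<bar>"
    \<comment> \<open>The flux is recovered from (u, E): P is bi-Lipschitz on the range in question,
      and F is Lipschitz because f is bounded.\<close>
    have PP: "P (Y w x) = x powr (\<gamma> - \<alpha>) * (E w x - F (w x))" for w
      using x' by (simp add: E_def flip: powr_add mult.assoc)
    have "g m * \<bar>Y u x - Y v x\<bar> \<le> \<bar>P (Y u x) - P (Y v x)\<bar>"
      by (intro P_lower_lipschitz m nx)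
    also have "\<dots> = x powr (\<gamma> - \<alpha>) * \<bar>(E u x - E v x) - (F (u x) - F (v x))\<bar>"
    proof -
      have "P (Y u x) - P (Y v x) = x powr (\<gamma> - \<alpha>) * ((E u x - E v x) - (F (u x) - F (v x)))"
        unfolding PP by (simp add: algebra_simps)
      then show ?thesis by (simp add: abs_mult)
    qed
    also have "\<dots> \<le> R powr (\<gamma> - \<alpha>) * ((1 + B) * ?S)"
    proof (intro mult_mono powr_mono2)
      have "\<bar>F (u x) - F (v x)\<bar> \<le> B * \<bar>u x - v x\<bar>" by (rule F_lipschitz)
      also have "B * \<bar>u x - v x\<bar> \<le> B * ?S" using B_nonneg by (intro mult_left_mono) auto
      finally have "\<bar>F (u x) - F (v x)\<bar> \<le> B * ?S" .
      moreover have "\<bar>(E u x - E v x) - (F (u x) - F (v x))\<bar> \<le> \<bar>E u x - E v x\<bar> + \<bar>F (u x) - F (v x)\<bar>"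
        by (rule abs_triangle_ineq4)
      moreover have "(1 + B) * ?S = ?S + B * ?S" by (simp add: algebra_simps)
      ultimately show "\<bar>(E u x - E v x) - (F (u x) - F (v x))\<bar> \<le> (1 + B) * ?S"
        using abs_ge_zero[of "u x - v x"] by linarith
    qed (use x' gamma in auto)
    finally have dY: "\<bar>Y u x - Y v x\<bar> \<le> l1 * ?S"
      using m by (simp add: l1_def field_simps)
    have dV: "\<bar>V u x - V v x\<bar> \<le> l2 * (l1 * ?S)"
    proof -
      have "\<bar>V u x - V v x\<bar> \<le> l2 * \<bar>Y u x - Y v x\<bar>"
        unfolding V_def l2_def by (intro g_lipschitz m nx)
      also have "\<dots> \<le> l2 * (l1 * ?S)" using l_nonneg dY by (intro mult_left_mono)
      finally show ?thesis .
    qed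
    have dE: "\<bar>x powr (\<alpha> - \<gamma> - 1) * dissip (Y u x) - x powr (\<alpha> - \<gamma> - 1) * dissip (Y v x)\<bar> \<le> l3 * (l1 * ?S)"
    proof -
      have "x powr (\<alpha> - \<gamma> - 1) \<le> r0 powr (\<alpha> - \<gamma> - 1)"
        using x r0_pos gamma by (intro powr_mono2') auto
      then have "x powr (\<alpha> - \<gamma> - 1) * \<bar>dissip (Y u x) - dissip (Y v x)\<bar> \<le> r0 powr (\<alpha> - \<gamma> - 1) *
          ((\<bar>\<alpha> - \<gamma>\<bar> * g b + \<bar>\<alpha>\<bar> * (g b + b * (p * g b / m))) * \<bar>Y u x - Y v x\<bar>)"
        by (intro mult_mono dissip_lipschitz m nx) auto
      then have "\<bar>x powr (\<alpha> - \<gamma> - 1) * dissip (Y u x) - x powr (\<alpha> - \<gamma> - 1) * dissip (Y v x)\<bar> \<le> l3 * \<bar>Y u x - Y v x\<bar>"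
        by (simp add: l3_def abs_mult mult.assoc flip: right_diff_distrib)
      also have "\<dots> \<le> l3 * (l1 * ?S)" using l_nonneg dY by (intro mult_left_mono)
      finally show ?thesis .
    qed
    let ?N' = "2 * (u x - v x) * (V u x - V v x) + 2 * (E u x - E v x) *
        (x powr (\<alpha> - \<gamma> - 1) * dissip (Y u x) - x powr (\<alpha> - \<gamma> - 1) * dissip (Y v x))"
    have "(N has_real_derivative ?N') (at x)"
      unfolding N_def using x'
      by (auto intro!: derivative_eq_intros sol_deriv_at[OF u] sol_deriv_at[OF v] E_deriv[OF u] E_deriv[OF v]
          simp: algebra_simps)
    moreover have "?N' \<le> 4 * ((l2 + l3) * l1) * N x"
      unfolding N_def
    proof (rule sum_square_bound)
      have "l2 * (l1 * ?S) \<ge> 0" "l3 * (l1 * ?S) \<ge> 0"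
        using l_nonneg by (auto intro!: mult_nonneg_nonneg)
      then show "\<bar>V u x - V v x\<bar> \<le> (l2 + l3) * l1 * ?S"
        "\<bar>x powr (\<alpha> - \<gamma> - 1) * dissip (Y u x) - x powr (\<alpha> - \<gamma> - 1) * dissip (Y v x)\<bar> \<le> (l2 + l3) * l1 * ?S"
        using dV dE by (simp_all only: distrib_right mult.assoc)
    qed (use l_nonneg in auto)
    ultimately show "\<exists>N'. (N has_real_derivative N') (at x) \<and> N' \<le> 4 * ((l2 + l3) * l1) * N x" by blast
  qed
  then have "u s = v s" if "s \<in> {r0..r0 + \<delta>}" for s
    using that unfolding N_def by (smt (verit) zero_le_power2 power2_eq_iff_nonneg zero_eq_power2)
  then show ?thesis using that \<delta> by blast
qed

text \<open>Let M be the maximal distance of u and v on [r0, r0 + \<delta>], and \<rho> the integral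
  of the weight over [r0, s]. Both fluxes W(s) have the sign of -f(u r0) and modulus at least c
  \<rho>, since f(u) and f(v) stay away from 0; their difference is at most |L| M \<rho>. In
  \<open>g_lipschitz\<close> the lower bound m then carries the same factor s^(-\<alpha>) \<rho> as
  the difference of the arguments, and both cancel. So |u' - v'| \<le> \<kappa> M although g may be
  singular at 0, and a short interval forces M = 0. The case r0 = 0 is included.\<close>

lemma extend_agreement_critical:
  assumes u: "sol 0 d u" and v: "sol 0 d v" and r0: "r0 \<in> {0..<R}"
    and agree: "\<And>s. s \<in> {0..r0} \<Longrightarrow> u s = v s" and Y0: "Y u r0 = 0" and u0: "u r0 \<noteq> 0"
  obtains \<delta> where "\<delta> > 0" "r0 + \<delta> \<le> R" "\<And>s. s \<in> {r0..r0 + \<delta>} \<Longrightarrow> u s = v s"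
proof -
  note uc = sol_cont[OF u] and vc = sol_cont[OF v]
  have uv0: "u r0 = v r0" using agree r0 by simp
  have WW: "W u r0 = W v r0"
    unfolding W_def using agree by (intro arg_cong[where f = uminus] integral_cong) auto
  have W0: "W u r0 = 0" "W v r0 = 0"
    using Y0 r0 WW[symmetric] by (cases "r0 = 0"; simp add: Y_def)+
  obtain \<delta>0 L where \<delta>0: "\<delta>0 > 0"
    and L0: "\<And>s t. \<bar>s - u r0\<bar> < \<delta>0 \<Longrightarrow> \<bar>t - u r0\<bar> < \<delta>0 \<Longrightarrow> \<bar>f s - f t\<bar> \<le> L * \<bar>s - t\<bar>"
    using f_lip[OF u0] by blast
  define \<sigma> where "\<sigma> = sgn (f (u r0))"
  define c where "c = \<bar>f (u r0)\<bar> / 2"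
  have f0: "f (u r0) \<noteq> 0" using f_sign[OF u0] by auto
  then have \<sigma>: "\<sigma> * \<sigma> = 1" "\<bar>\<sigma>\<bar> = 1" and c: "c > 0" and \<sigma>f: "\<sigma> * f (u r0) = 2 * c"
    by (auto simp: \<sigma>_def c_def sgn_if)
  have fuc: "continuous_on {0..R} (\<lambda>s. f (u s))" and fvc: "continuous_on {0..R} (\<lambda>s. f (v s))"
    by (auto intro!: continuous_on_compose2[OF f_cont[of UNIV]] uc vc)
  obtain \<delta>1 where \<delta>1: "\<delta>1 > 0" "r0 + \<delta>1 \<le> R" "\<And>s. s \<in> {r0..r0 + \<delta>1} \<Longrightarrow> \<bar>u s - u r0\<bar> < \<delta>0"
    using continuous_near_right[OF uc r0 \<delta>0] by blast
  obtain \<delta>2 where \<delta>2: "\<delta>2 > 0" "r0 + \<delta>2 \<le> R" "\<And>s. s \<in> {r0..r0 + \<delta>2} \<Longrightarrow> \<bar>v s - v r0\<bar> < \<delta>0"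
    using continuous_near_right[OF vc r0 \<delta>0] by blast
  obtain \<delta>3 where \<delta>3: "\<delta>3 > 0" "r0 + \<delta>3 \<le> R" "\<And>s. s \<in> {r0..r0 + \<delta>3} \<Longrightarrow> \<bar>f (u s) - f (u r0)\<bar> < c"
    using continuous_near_right[OF fuc r0 c] by blast
  obtain \<delta>4 where \<delta>4: "\<delta>4 > 0" "r0 + \<delta>4 \<le> R" "\<And>s. s \<in> {r0..r0 + \<delta>4} \<Longrightarrow> \<bar>f (v s) - f (v r0)\<bar> < c"
    using continuous_near_right[OF fvc r0 c] by blast
  define b where "b = B * C"
  define \<kappa> where "\<kappa> = p * g b * \<bar>L\<bar> / c"
  have b: "b \<ge> 0" using B_nonneg C_pos by (simp add: b_def)
  have \<kappa>: "\<kappa> \<ge> 0" using p_pos b c by (auto simp: \<kappa>_def intro!: mult_nonneg_nonneg divide_nonneg_nonneg)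
  \<comment> \<open>The last entry makes \<delta> \<kappa> at most 1/2, so that the mean value
    theorem yields M \<le> M / 2.\<close>
  define \<delta> where "\<delta> = Min {\<delta>1, \<delta>2, \<delta>3, \<delta>4, 1 / (2 * (\<kappa> + 1))}"
  have \<delta>: "\<delta> > 0" "\<delta> \<le> \<delta>1" "\<delta> \<le> \<delta>2" "\<delta> \<le> \<delta>3" "\<delta> \<le> \<delta>4" "\<delta> \<le> 1 / (2 * (\<kappa> + 1))"
    using \<delta>1 \<delta>2 \<delta>3 \<delta>4 \<kappa> by (auto simp: \<delta>_def)
  have sgn_pos: "\<sigma> * z \<ge> c" if "\<bar>z - f (u r0)\<bar> < c" for z
  proof -
    have "\<bar>\<sigma> * (z - f (u r0))\<bar> < c" using that \<sigma>(2) by (simp add: abs_mult)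
    then show ?thesis using \<sigma>f by (simp add: right_diff_distrib)
  qed
  have near: "\<bar>f (u s) - f (v s)\<bar> \<le> \<bar>L\<bar> * \<bar>u s - v s\<bar>" "\<sigma> * f (u s) \<ge> c" "\<sigma> * f (v s) \<ge> c" "s \<in> {0..R}"
    if s: "s \<in> {r0..r0 + \<delta>}" for s
  proof -
    have "\<bar>f (u s) - f (v s)\<bar> \<le> L * \<bar>u s - v s\<bar>"
      using \<delta>1(3)[of s] \<delta>2(3)[of s] s \<delta> uv0 by (intro L0) auto
    also have "\<dots> \<le> \<bar>L\<bar> * \<bar>u s - v s\<bar>" by (intro mult_right_mono) auto
    finally show "\<bar>f (u s) - f (v s)\<bar> \<le> \<bar>L\<bar> * \<bar>u s - v s\<bar>" .
    show "\<sigma> * f (u s) \<ge> c" "\<sigma> * f (v s) \<ge> c"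
      using \<delta>3(3)[of s] \<delta>4(3)[of s] s \<delta> uv0 by (auto intro!: sgn_pos)
    show "s \<in> {0..R}" using s r0 \<delta> \<delta>1 by auto
  qed
  have "continuous_on {r0..r0 + \<delta>} (\<lambda>s. \<bar>u s - v s\<bar>)"
    using near(4) by (intro continuous_intros continuous_on_subset[OF uc] continuous_on_subset[OF vc]) auto
  then obtain s0 where s0: "s0 \<in> {r0..r0 + \<delta>}"
    and max: "\<And>s. s \<in> {r0..r0 + \<delta>} \<Longrightarrow> \<bar>u s - v s\<bar> \<le> \<bar>u s0 - v s0\<bar>"
    using continuous_attains_sup[of "{r0..r0 + \<delta>}" "\<lambda>s. \<bar>u s - v s\<bar>"] \<delta>(1) by auto
  define M where "M = \<bar>u s0 - v s0\<bar>"
  have M: "M \<ge> 0" by (simp add: M_def)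
  have W_split: "W w s = - integral {r0..s} (\<lambda>s. k s * f (w s))"
    if w: "continuous_on {0..R} w" "W w r0 = 0" and s: "s \<in> {r0..r0 + \<delta>}" for w s
  proof -
    have "(\<lambda>s. k s * f (w s)) integrable_on {0..s}"
      using near(4)[OF s] by (intro integrable_continuous_real continuous_on_subset[OF kf_cont[OF w(1)]]) auto
    then have "integral {0..r0} (\<lambda>s. k s * f (w s)) + integral {r0..s} (\<lambda>s. k s * f (w s)) = integral {0..s} (\<lambda>s. k s * f (w s))"
      using r0 s by (intro Henstock_Kurzweil_Integration.integral_combine) auto
    then show ?thesis using w(2) by (simp add: W_def)
  qed
  have dV: "\<bar>V u s - V v s\<bar> \<le> \<kappa> * M" if s: "s \<in> {r0<..r0 + \<delta>}" for s
  proof -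
    have s': "s \<in> {r0..r0 + \<delta>}" "0 < s" using s r0 by auto
    define \<rho> where "\<rho> = integral {r0..s} k"
    have sub: "{r0..s} \<subseteq> {0..R}" using s' r0 near(4)[OF s'(1)] by auto
    have ik: "k integrable_on {r0..s}"
      using r0 by (intro integrable_continuous_real continuous_on_subset[OF k_cont]) auto
    have iw: "(\<lambda>t. k t * f (w t)) integrable_on {r0..s}" if "continuous_on {0..R} w" for w
      using sub by (intro integrable_continuous_real continuous_on_subset[OF kf_cont[OF that]])
    have "\<rho> > 0"
    proof -
      obtain z where z: "r0 < z" "z < s" "\<rho> = (s - r0) * k z"
      proof -
        have "((\<lambda>x. integral {r0..x} k) has_real_derivative k x) (at x within {r0..s})" if "x \<in> {r0..s}" for x
          using r0 that by (intro integral_has_real_derivative continuous_on_subset[OF k_cont]) auto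
        then show ?thesis
          using mean_value_within[of r0 s "\<lambda>x. integral {r0..x} k" k] s that by (auto simp: \<rho>_def)
      qed
      then show ?thesis using r0 s by (simp add: k_pos)
    qed
    have W_lower: "\<sigma> * - W w s \<ge> c * \<rho>"
      if w: "continuous_on {0..R} w" "W w r0 = 0" and "\<And>t. t \<in> {r0..r0 + \<delta>} \<Longrightarrow> \<sigma> * f (w t) \<ge> c" for w
    proof -
      have "integral {r0..s} (\<lambda>t. c * k t) \<le> integral {r0..s} (\<lambda>t. \<sigma> * (k t * f (w t)))"
      proof (intro integral_le integrable_on_mult_right ik iw w)
        fix t assume "t \<in> {r0..s}"
        then have "c * k t \<le> (\<sigma> * f (w t)) * k t" using that(3)[of t] s' by (intro mult_right_mono k_nonneg) auto
        then show "c * k t \<le> \<sigma> * (k t * f (w t))" by (simp add: algebra_simps)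
      qed
      then show ?thesis unfolding W_split[OF w s'(1)] by (simp add: \<rho>_def)
    qed
    note Wu = W_lower[OF uc W0(1) near(2)] and Wv = W_lower[OF vc W0(2) near(3)]
    have cr: "c * \<rho> > 0" using c \<open>\<rho> > 0\<close> by simp
    have "norm (integral {r0..s} (\<lambda>t. k t * f (u t) - k t * f (v t))) \<le> integral {r0..s} (\<lambda>t. \<bar>L\<bar> * M * k t)"
    proof (intro integral_norm_bound_integral integrable_on_mult_right ik integrable_diff iw uc vc)
      fix t assume "t \<in> {r0..s}"
      then have t: "t \<in> {r0..r0 + \<delta>}" using s' by auto
      have "\<bar>f (u t) - f (v t)\<bar> \<le> \<bar>L\<bar> * M"
        using near(1)[OF t] max[OF t] by (smt (verit) M_def abs_ge_zero mult_left_mono)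
      then have "k t * \<bar>f (u t) - f (v t)\<bar> \<le> k t * (\<bar>L\<bar> * M)" by (intro mult_left_mono k_nonneg)
      then show "norm (k t * f (u t) - k t * f (v t)) \<le> \<bar>L\<bar> * M * k t"
        using k_nonneg by (simp add: abs_mult mult.commute flip: right_diff_distrib)
    qed
    then have dW: "\<bar>W u s - W v s\<bar> \<le> \<bar>L\<bar> * M * \<rho>"
      unfolding W_split[OF uc W0(1) s'(1)] W_split[OF vc W0(2) s'(1)]
      using Henstock_Kurzweil_Integration.integral_diff[OF iw[OF uc] iw[OF vc]] by (simp add: \<rho>_def)
    define m where "m = s powr (-\<alpha>) * (c * \<rho>)"
    have m: "m > 0" using cr s' by (simp add: m_def)
    have "\<bar>V u s - V v s\<bar> \<le> p * g b / m * \<bar>Y u s - Y v s\<bar>"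
      unfolding V_def
    proof (rule g_lipschitz[OF m])
      have "\<bar>W u s\<bar> \<ge> c * \<rho>" "\<bar>W v s\<bar> \<ge> c * \<rho>"
        using Wu Wv abs_ge_self[of "\<sigma> * - W u s"] abs_ge_self[of "\<sigma> * - W v s"] \<sigma>(2)
        by (auto simp: abs_mult)
      then show "m \<le> \<bar>Y u s\<bar>" "m \<le> \<bar>Y v s\<bar>"
        by (auto simp: m_def Y_def abs_mult intro!: mult_left_mono)
      show "\<bar>Y u s\<bar> \<le> b" "\<bar>Y v s\<bar> \<le> b"
        unfolding b_def using near(4)[OF s'(1)] by (auto intro: Y_bound' uc vc)
      have "(\<sigma> * - W u s) * (\<sigma> * - W v s) > 0"
        by (rule mult_pos_pos[OF less_le_trans[OF cr Wu] less_le_trans[OF cr Wv]])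
      moreover have "(\<sigma> * - W u s) * (\<sigma> * - W v s) = (\<sigma> * \<sigma>) * (W u s * W v s)"
        by (simp add: algebra_simps)
      ultimately have "W u s * W v s > 0" by (metis \<sigma>(1) mult_1)
      moreover have "Y u s * Y v s = (s powr (-\<alpha>) * s powr (-\<alpha>)) * (W u s * W v s)"
        by (simp add: Y_def algebra_simps)
      ultimately show "Y u s * Y v s > 0" using s' by (simp add: zero_less_mult_iff)
    qed
    also have "\<bar>Y u s - Y v s\<bar> = s powr (-\<alpha>) * \<bar>W u s - W v s\<bar>"
      by (simp add: Y_def abs_mult flip: right_diff_distrib)
    also have "p * g b / m * (s powr (-\<alpha>) * \<bar>W u s - W v s\<bar>) \<le> p * g b / m * (s powr (-\<alpha>) * (\<bar>L\<bar> * M * \<rho>))"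
      using dW p_pos b m by (intro mult_left_mono mult_nonneg_nonneg divide_nonneg_nonneg) auto
    also have "\<dots> = \<kappa> * M"
      using s' cr c \<open>\<rho> > 0\<close> by (simp add: m_def \<kappa>_def field_simps)
    finally show ?thesis .
  qed
  have "M = 0"
  proof (cases "s0 = r0")
    case True
    then show ?thesis using uv0 by (simp add: M_def)
  next
    case False
    then have s0': "r0 < s0" "s0 \<le> R" using s0 near(4)[OF s0] by auto
    obtain z where z: "r0 < z" "z < s0" "(u s0 - v s0) - (u r0 - v r0) = (s0 - r0) * (V u z - V v z)"
    proof (rule mean_value_within[OF s0'(1)])
      fix x assume x: "x \<in> {r0..s0}"
      have sub: "{r0..s0} \<subseteq> {0..R}" using r0 s0' by auto
      then show "((\<lambda>s. u s - v s) has_real_derivative V u x - V v x) (at x within {r0..s0})"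
        using x by (intro DERIV_diff DERIV_subset[OF sol_deriv[OF u] sub] DERIV_subset[OF sol_deriv[OF v] sub]) auto
    qed
    have "M = (s0 - r0) * \<bar>V u z - V v z\<bar>"
      using z uv0 s0' by (simp add: M_def abs_mult)
    also have "\<dots> \<le> \<delta> * (\<kappa> * M)"
      using z s0 s0' \<delta> by (intro mult_mono dV) auto
    also have "\<dots> \<le> 1 / (2 * (\<kappa> + 1)) * (\<kappa> * M)"
      using \<delta> \<kappa> M by (intro mult_right_mono) auto
    also have "\<dots> \<le> M / 2"
      using \<kappa> M by (simp add: field_simps)
    finally show ?thesis using M by simp
  qed
  then have "u s = v s" if "s \<in> {r0..r0 + \<delta>}" for s
    using max[OF that] by (simp add: M_def)
  moreover have "r0 + \<delta> \<le> R" using \<delta> \<delta>1 by simp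
  ultimately show ?thesis using that \<delta>(1) by blast
qed

text \<open>At the supremum r0 of the interval of agreement either the flux is nonzero, or it
  vanishes and then u does not, by \<open>no_double_zero\<close>. Each case has its own extension
  lemma, so agreement cannot stop before R.\<close>

theorem sol_unique:
  assumes u: "sol 0 d u" and v: "sol 0 d v" and d: "d > 0" and r: "r \<in> {0..R}"
  shows "u r = v r"
proof -
  define A where "A = {r \<in> {0..R}. \<forall>s\<in>{0..r}. u s = v s}"
  define r0 where "r0 = Sup A"
  have A0: "0 \<in> A" using R_pos sol_0[OF u] sol_0[OF v] by (simp add: A_def)
  have A_bdd: "bdd_above A" by (rule bdd_aboveI[of _ R]) (simp add: A_def)
  have r0: "r0 \<in> {0..R}"
    unfolding r0_def using A0 A_bdd by (auto simp: A_def intro!: cSup_upper cSup_least)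
  have below: "u s = v s" if s: "0 \<le> s" "s < r0" for s
  proof -
    have "A \<noteq> {}" using A0 by blast
    then obtain a where "a \<in> A" "s < a"
      using s less_cSup_iff[OF _ A_bdd, of s] unfolding r0_def by blast
    then show ?thesis using s by (simp add: A_def)
  qed
  have at: "u r0 = v r0"
  proof (cases "r0 = 0")
    case True
    then show ?thesis using sol_0[OF u] sol_0[OF v] by simp
  next
    case False
    have "continuous_on {0..r0} (\<lambda>s. u s - v s)"
      using r0 by (intro continuous_intros continuous_on_subset[OF sol_cont[OF u]]
          continuous_on_subset[OF sol_cont[OF v]]) auto
    then have "u r0 - v r0 = 0"
      using r0 False below
      by (intro continuous_constant_on_closure[of "{0..<r0}" "\<lambda>s. u s - v s" 0 r0]) auto
    then show ?thesis by simp
  qed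
  have agree: "u s = v s" if "s \<in> {0..r0}" for s
    using that below[of s] at by (cases "s = r0") auto
  have "r0 = R"
  proof (rule ccontr)
    assume "r0 \<noteq> R"
    then have r0': "r0 \<in> {0..<R}" using r0 by simp
    obtain \<delta> where \<delta>: "\<delta> > 0" "r0 + \<delta> \<le> R" "\<And>s. s \<in> {r0..r0 + \<delta>} \<Longrightarrow> u s = v s"
    proof (cases "Y u r0 = 0")
      case False
      then show ?thesis using extend_agreement_noncritical[OF u v r0' agree] that by blast
    next
      case True
      then have "u r0 \<noteq> 0" using no_double_zero[OF u d r0] by (auto simp: V_def)
      then show ?thesis using extend_agreement_critical[OF u v r0' agree True] that by blast
    qed
    have "r0 + \<delta> \<in> A"
      using \<delta> r0 agree by (auto simp: A_def) (metis atLeastAtMost_iff linear)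
    then have "r0 + \<delta> \<le> r0" unfolding r0_def using A_bdd by (intro cSup_upper)
    then show False using \<delta> by simp
  qed
  then show ?thesis using agree r by simp
qed

end

section \<open>Counting zeros\<close>

lemma finite_positive_lower_bound:
  fixes h :: "'a \<Rightarrow> real"
  assumes "finite T" "\<And>x. x \<in> T \<Longrightarrow> h x > 0"
  obtains e where "e > 0" "\<And>x. x \<in> T \<Longrightarrow> e \<le> h x"
  using that[of "Min (insert 1 (h ` T))"] assms by auto

text \<open>At an accumulation point of zeros both h and its difference quotients along the zeros
  vanish in the limit, so that point would be a double zero.\<close>

lemma finite_simple_zeros:
  fixes h :: "real \<Rightarrow> real"
  assumes h: "\<And>r. r \<in> {0..R} \<Longrightarrow> (h has_real_derivative h' r) (at r within {0..R})"
    and simple: "\<And>r. r \<in> {0..R} \<Longrightarrow> h r = 0 \<Longrightarrow> h' r \<noteq> 0"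
  shows "finite {r \<in> {0..R}. h r = 0}" (is "finite ?Z")
proof (rule ccontr)
  assume "infinite ?Z"
  then obtain x where x: "x \<in> {0..R}" "x islimpt ?Z"
    using compact_Icc[of 0 R] unfolding compact_eq_Bolzano_Weierstrass by (metis (no_types, lifting) mem_Collect_eq subsetI)
  have nontriv: "at x within ?Z \<noteq> bot" using x(2) by (simp add: trivial_limit_within)
  have cont: "(h \<longlongrightarrow> h x) (at x within ?Z)"
    using DERIV_continuous[OF h[OF x(1)]] unfolding continuous_within
    by (rule tendsto_within_subset) auto
  have "\<forall>\<^sub>F y in at x within ?Z. h y = 0" by (auto simp: eventually_at_filter)
  then have "(h \<longlongrightarrow> 0) (at x within ?Z)" by (rule tendsto_eventually)
  then have hx: "h x = 0" using tendsto_unique[OF nontriv cont] by simp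
  have quot: "((\<lambda>y. (h y - h x) / (y - x)) \<longlongrightarrow> h' x) (at x within ?Z)"
    using h[OF x(1)] unfolding has_field_derivative_iff by (rule tendsto_within_subset) auto
  have "\<forall>\<^sub>F y in at x within ?Z. (h y - h x) / (y - x) = 0"
    using hx by (auto simp: eventually_at_filter)
  then have "((\<lambda>y. (h y - h x) / (y - x)) \<longlongrightarrow> 0) (at x within ?Z)" by (rule tendsto_eventually)
  then have "h' x = 0" using tendsto_unique[OF nontriv quot] by simp
  then show False using simple[OF x(1) hx] by simp
qed

text \<open>Around each zero of h the derivative stays away from 0, and off these balls |h| does. A
  zero of a C^1-close w must lie in one of the balls. By the mean value theorem two zeros in the
  same ball would produce a zero of w' there, so assigning to each zero of w the centre of such a
  ball is injective.\<close>

lemma simple_zeros_upper_semicontinuous: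
  fixes h :: "real \<Rightarrow> real"
  assumes h: "\<And>r. r \<in> {0..R} \<Longrightarrow> (h has_real_derivative h' r) (at r within {0..R})"
    and h'_cont: "continuous_on {0..R} h'"
    and simple: "\<And>r. r \<in> {0..R} \<Longrightarrow> h r = 0 \<Longrightarrow> h' r \<noteq> 0"
  obtains e where "e > 0"
    "\<And>w w'. (\<And>r. r \<in> {0..R} \<Longrightarrow> (w has_real_derivative w' r) (at r within {0..R})) \<Longrightarrow>
      (\<And>r. r \<in> {0..R} \<Longrightarrow> \<bar>w r - h r\<bar> < e \<and> \<bar>w' r - h' r\<bar> < e) \<Longrightarrow>
      card {r \<in> {0..R}. w r = 0} \<le> card {r \<in> {0..R}. h r = 0}"
proof -
  define Z where "Z = {r \<in> {0..R}. h r = 0}"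
  have finZ: "finite Z" unfolding Z_def by (rule finite_simple_zeros[OF h simple])
  have "\<exists>\<rho>>0. \<forall>r\<in>{0..R}. \<bar>r - z\<bar> < \<rho> \<longrightarrow> \<bar>h' r\<bar> > \<bar>h' z\<bar> / 2" if z: "z \<in> Z" for z
  proof -
    have "\<bar>h' z\<bar> / 2 > 0" using simple z by (auto simp: Z_def)
    then obtain \<rho> where "\<rho> > 0" "\<And>r. r \<in> {0..R} \<Longrightarrow> dist r z < \<rho> \<Longrightarrow> dist (h' r) (h' z) < \<bar>h' z\<bar> / 2"
      using h'_cont z unfolding continuous_on_iff Z_def by (metis (no_types, lifting) mem_Collect_eq)
    moreover have "\<bar>h' r\<bar> > \<bar>h' z\<bar> / 2" if "dist (h' r) (h' z) < \<bar>h' z\<bar> / 2" for r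
      using that unfolding dist_real_def by linarith
    ultimately show ?thesis by (intro exI[of _ \<rho>]) (auto simp: dist_real_def[of _ z])
  qed
  then obtain rad where rad: "\<And>z. z \<in> Z \<Longrightarrow> rad z > 0"
    "\<And>z r. z \<in> Z \<Longrightarrow> r \<in> {0..R} \<Longrightarrow> \<bar>r - z\<bar> < rad z \<Longrightarrow> \<bar>h' r\<bar> > \<bar>h' z\<bar> / 2" by metis
  obtain c where c: "c > 0" "\<And>z. z \<in> Z \<Longrightarrow> c \<le> \<bar>h' z\<bar> / 2"
    using finite_positive_lower_bound[OF finZ, of "\<lambda>z. \<bar>h' z\<bar> / 2"] simple by (auto simp: Z_def)
  \<comment> \<open>Compactness of the complement gives the positive lower bound c' for |h|.\<close>
  define N where "N = {0..R} - (\<Union>z\<in>Z. ball z (rad z))"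
  have "compact N" unfolding N_def by (intro compact_diff open_UN) auto
  moreover have "continuous_on N (\<lambda>r. \<bar>h r\<bar>)"
    using DERIV_continuous_on[OF h] by (intro continuous_intros) (auto simp: N_def intro: continuous_on_subset)
  moreover have N0: "h r \<noteq> 0" if "r \<in> N" for r using that rad(1) by (force simp: N_def Z_def)
  ultimately obtain c' where c': "c' > 0" "\<And>r. r \<in> N \<Longrightarrow> c' \<le> \<bar>h r\<bar>"
  proof (cases "N = {}")
    case True
    then show ?thesis using that[of 1] by simp
  next
    case False
    assume "compact N" "continuous_on N (\<lambda>r. \<bar>h r\<bar>)"
    then obtain x where "x \<in> N" "\<forall>r\<in>N. \<bar>h x\<bar> \<le> \<bar>h r\<bar>"
      using continuous_attains_inf False by blast
    then show ?thesis using that[of "\<bar>h x\<bar>"] N0[of x] by auto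
  qed
  show ?thesis
  proof (rule that[of "min c c'"])
    fix w w' :: "real \<Rightarrow> real"
    assume w: "\<And>r. r \<in> {0..R} \<Longrightarrow> (w has_real_derivative w' r) (at r within {0..R})"
      and near: "\<And>r. r \<in> {0..R} \<Longrightarrow> \<bar>w r - h r\<bar> < min c c' \<and> \<bar>w' r - h' r\<bar> < min c c'"
    have "\<exists>z\<in>Z. \<bar>x - z\<bar> < rad z" if x: "x \<in> {r \<in> {0..R}. w r = 0}" for x
    proof -
      have "\<bar>h x\<bar> < c'" using near[of x] x by simp
      then have "x \<notin> N" using c'(2)[of x] by auto
      then show ?thesis using x by (auto simp: N_def dist_real_def abs_minus_commute)
    qed
    then obtain \<zeta> where \<zeta>: "\<And>x. x \<in> {r \<in> {0..R}. w r = 0} \<Longrightarrow> \<zeta> x \<in> Z \<and> \<bar>x - \<zeta> x\<bar> < rad (\<zeta> x)"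
      by metis
    have no: False if x: "x \<in> {r \<in> {0..R}. w r = 0}" and y: "y \<in> {r \<in> {0..R}. w r = 0}"
      and "\<zeta> x = \<zeta> y" "x < y" for x y
    proof -
      have sub: "{x..y} \<subseteq> {0..R}" using x y by auto
      obtain s where s: "x < s" "s < y" "w y - w x = (y - x) * w' s"
        by (rule mean_value_within[OF \<open>x < y\<close>, of w w']) (use sub in \<open>auto intro: DERIV_subset[OF w]\<close>)
      then have "w' s = 0" using x y by simp
      moreover have "s \<in> {0..R}" using s sub by auto
      ultimately have "\<bar>h' s\<bar> < c" using near[of s] by simp
      moreover have "\<bar>s - \<zeta> x\<bar> < rad (\<zeta> x)"
      proof -
        have "\<bar>x - \<zeta> x\<bar> < rad (\<zeta> x)" "\<bar>y - \<zeta> x\<bar> < rad (\<zeta> x)"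
          using \<zeta>[OF x] \<zeta>[OF y] that(3) by auto
        then show ?thesis using s by linarith
      qed
      ultimately show False
        using rad(2)[of "\<zeta> x" s] c(2)[of "\<zeta> x"] \<zeta>[OF x] \<open>s \<in> {0..R}\<close> by force
    qed
    have "inj_on \<zeta> {r \<in> {0..R}. w r = 0}"
    proof (rule inj_onI)
      fix x y assume xy: "x \<in> {r \<in> {0..R}. w r = 0}" "y \<in> {r \<in> {0..R}. w r = 0}" "\<zeta> x = \<zeta> y"
      then show "x = y"
        using no[OF xy] no[OF xy(2,1) xy(3)[symmetric]] by (meson linorder_neqE)
    qed
    then show "card {r \<in> {0..R}. w r = 0} \<le> card {r \<in> {0..R}. h r = 0}"
      using \<zeta> finZ by (intro card_inj_on_le[of \<zeta>]) (auto simp: Z_def)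
  qed (use c c' in simp)
qed

lemma sign_change_near_simple_zero:
  fixes h :: "real \<Rightarrow> real"
  assumes h: "(h has_real_derivative l) (at z)" and "h z = 0" "l \<noteq> 0" "\<rho> > 0"
  obtains a b where "z - \<rho> < a" "a < b" "b < z + \<rho>" "h a * h b < 0"
proof -
  have pos: "\<exists>a b. z - \<rho> < a \<and> a < b \<and> b < z + \<rho> \<and> h a * h b < 0"
    if h: "(h has_real_derivative l) (at z)" and "h z = 0" and l: "l > 0" for h :: "real \<Rightarrow> real" and l
  proof -
    obtain d1 where d1: "d1 > 0" "\<And>s. 0 < s \<Longrightarrow> s < d1 \<Longrightarrow> h z < h (z + s)"
      using DERIV_pos_inc_right[OF h l] by blast
    obtain d2 where d2: "d2 > 0" "\<And>s. 0 < s \<Longrightarrow> s < d2 \<Longrightarrow> h (z - s) < h z"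
      using DERIV_pos_inc_left[OF h l] by blast
    define s where "s = Min {d1, d2, \<rho>} / 2"
    have s: "s > 0" "s < d1" "s < d2" "s < \<rho>" using d1 d2 \<open>\<rho> > 0\<close> by (auto simp: s_def)
    then show ?thesis
      using d1(2)[of s] d2(2)[of s] \<open>h z = 0\<close>
      by (intro exI[of _ "z - s"] exI[of _ "z + s"]) (auto simp: mult_neg_pos)
  qed
  show ?thesis
  proof (cases "l > 0")
    case True
    then show ?thesis using pos[OF assms(1,2)] that by blast
  next
    case False
    then show ?thesis using pos[of "\<lambda>x. - h x" "- l"] assms that by (auto intro: DERIV_minus)
  qed
qed

text \<open>Each simple zero is bracketed by a sign change, which survives uniform perturbation.
  This needs room on both sides, so only interior zeros are counted: a zero at R could leave the
  interval.\<close>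

lemma simple_zeros_lower_semicontinuous:
  fixes h :: "real \<Rightarrow> real"
  assumes S: "finite S" "S \<subseteq> {0<..<R}" "\<And>z. z \<in> S \<Longrightarrow> h z = 0"
    and h: "\<And>z. z \<in> S \<Longrightarrow> (h has_real_derivative h' z) (at z)" "\<And>z. z \<in> S \<Longrightarrow> h' z \<noteq> 0"
  obtains e where "e > 0"
    "\<And>w. continuous_on {0..R} w \<Longrightarrow> (\<And>r. r \<in> {0..R} \<Longrightarrow> \<bar>w r - h r\<bar> < e) \<Longrightarrow>
      \<exists>S'. S' \<subseteq> {0<..<R} \<and> card S' = card S \<and> finite S' \<and> (\<forall>z\<in>S'. w z = 0)"
proof -
  \<comment> \<open>Removing the diagonal makes all pairwise distances positive; half their minimum
    separates the brackets.\<close>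
  have "finite (S \<times> S - Id)" using S by simp
  then obtain \<rho>1 where \<rho>1: "\<rho>1 > 0" "\<And>x. x \<in> S \<times> S - Id \<Longrightarrow> \<rho>1 \<le> \<bar>fst x - snd x\<bar>"
    by (rule finite_positive_lower_bound[of _ "\<lambda>x. \<bar>fst x - snd x\<bar>"]) auto
  obtain \<rho>2 where \<rho>2: "\<rho>2 > 0" "\<And>z. z \<in> S \<Longrightarrow> \<rho>2 \<le> min z (R - z)"
    by (rule finite_positive_lower_bound[OF S(1), of "\<lambda>z. min z (R - z)"]) (use S in auto)
  define \<rho> where "\<rho> = min (\<rho>1 / 2) \<rho>2"
  have \<rho>_pos: "\<rho> > 0" using \<rho>1 \<rho>2 by (simp add: \<rho>_def)
  have sep: "2 * \<rho> \<le> \<bar>y - z\<bar>" if "y \<in> S" "z \<in> S" "y \<noteq> z" for y z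
    using \<rho>1(2)[of "(y, z)"] that by (auto simp: \<rho>_def)
  have margin: "\<rho> \<le> z \<and> \<rho> \<le> R - z" if "z \<in> S" for z
    using \<rho>2(2)[OF that] by (auto simp: \<rho>_def)
  note \<rho> = \<rho>_pos sep margin
  have "\<exists>a b. z - \<rho> < a \<and> a < b \<and> b < z + \<rho> \<and> h a * h b < 0" if "z \<in> S" for z
    using sign_change_near_simple_zero[OF h(1)[OF that] S(3)[OF that] h(2)[OF that] \<rho>(1)] by metis
  then obtain a b where ab: "\<And>z. z \<in> S \<Longrightarrow> z - \<rho> < a z \<and> a z < b z \<and> b z < z + \<rho> \<and> h (a z) * h (b z) < 0"
    by metis
  have h_ab: "h (a z) \<noteq> 0" "h (b z) \<noteq> 0" if "z \<in> S" for z
    using ab[OF that] by auto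
  obtain e where e: "e > 0" "\<And>z. z \<in> S \<Longrightarrow> e \<le> min \<bar>h (a z)\<bar> \<bar>h (b z)\<bar>"
    by (rule finite_positive_lower_bound[OF S(1), of "\<lambda>z. min \<bar>h (a z)\<bar> \<bar>h (b z)\<bar>"]) (use h_ab in auto)
  show ?thesis
  proof (rule that[OF e(1)])
    fix w :: "real \<Rightarrow> real"
    assume w: "continuous_on {0..R} w" and near: "\<And>r. r \<in> {0..R} \<Longrightarrow> \<bar>w r - h r\<bar> < e"
    have "\<exists>x. z - \<rho> < x \<and> x < z + \<rho> \<and> w x = 0" if z: "z \<in> S" for z
    proof -
      have in_R: "a z \<in> {0..R}" "b z \<in> {0..R}" using ab[OF z] \<rho>(3)[OF z] by auto
      have near': "\<bar>w (a z) - h (a z)\<bar> < \<bar>h (a z)\<bar>" "\<bar>w (b z) - h (b z)\<bar> < \<bar>h (b z)\<bar>"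
        using near[OF in_R(1)] near[OF in_R(2)] e(2)[OF z] by auto
      have wc: "continuous_on {a z..b z} w" using in_R by (intro continuous_on_subset[OF w]) auto
      have "h (a z) < 0 \<and> h (b z) > 0 \<or> h (a z) > 0 \<and> h (b z) < 0"
        using ab[OF z] by (auto simp: mult_less_0_iff)
      then have "\<exists>x. a z \<le> x \<and> x \<le> b z \<and> w x = 0"
      proof
        assume "h (a z) < 0 \<and> h (b z) > 0"
        then show ?thesis using IVT'[of w "a z" 0 "b z"] near' ab[OF z] wc by auto
      next
        assume "h (a z) > 0 \<and> h (b z) < 0"
        then show ?thesis using IVT2'[of w "b z" 0 "a z"] near' ab[OF z] wc by auto
      qed
      then obtain x where "a z \<le> x" "x \<le> b z" "w x = 0" by blast
      then show ?thesis using ab[OF z] by (intro exI[of _ x]) auto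
    qed
    then obtain \<xi> where \<xi>: "\<And>z. z \<in> S \<Longrightarrow> z - \<rho> < \<xi> z \<and> \<xi> z < z + \<rho> \<and> w (\<xi> z) = 0" by metis
    have "inj_on \<xi> S"
    proof (rule inj_onI, rule ccontr)
      fix y z assume yz: "y \<in> S" "z \<in> S" "\<xi> y = \<xi> z" "y \<noteq> z"
      then show False using \<rho>(2)[of y z] \<xi>[of y] \<xi>[of z] by linarith
    qed
    moreover have "\<xi> z \<in> {0<..<R}" if "z \<in> S" for z using \<xi>[OF that] \<rho>(3)[OF that] by auto
    ultimately show "\<exists>S'. S' \<subseteq> {0<..<R} \<and> card S' = card S \<and> finite S' \<and> (\<forall>z\<in>S'. w z = 0)"
      using \<xi> S(1) by (intro exI[of _ "\<xi> ` S"]) (auto simp: card_image)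
  qed
qed

text \<open>The value \<open>d l\<close> is the largest shooting parameter whose orbit has more than \<open>l\<close> zeros in \<open>(0,R]\<close>.\<close>

theorem nodal_shooting_parameters:
  fixes U U' :: "real \<Rightarrow> real \<Rightarrow> real"
  assumes D: "D > 0"
    and deriv: "\<And>d r. d > 0 \<Longrightarrow> r \<in> {0..R} \<Longrightarrow> (U d has_real_derivative U' d r) (at r within {0..R})"
    and deriv_cont: "\<And>d. d > 0 \<Longrightarrow> continuous_on {0..R} (U' d)"
    and flow_cont: "\<And>d0 e. d0 > 0 \<Longrightarrow> e > 0 \<Longrightarrow> \<exists>\<delta>>0. \<forall>d. \<bar>d - d0\<bar> < \<delta> \<longrightarrow>
      (\<forall>r\<in>{0..R}. \<bar>U d r - U d0 r\<bar> < e \<and> \<bar>U' d r - U' d0 r\<bar> < e)"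
    and init: "\<And>d. d > 0 \<Longrightarrow> U d 0 \<noteq> 0"
    and simple: "\<And>d r. d > 0 \<Longrightarrow> r \<in> {0..R} \<Longrightarrow> U d r = 0 \<Longrightarrow> U' d r \<noteq> 0"
    and top: "\<And>r. r \<in> {0..R} \<Longrightarrow> U D r \<noteq> 0"
    and many: "\<And>n. \<exists>d. 0 < d \<and> d \<le> D \<and> (\<exists>S. S \<subseteq> {0..R} \<and> card S = n \<and> (\<forall>r\<in>S. U d r = 0))"
  obtains d :: "nat \<Rightarrow> real" where
    "\<And>l. 0 < d l \<and> d l < D \<and> U (d l) R = 0 \<and> finite {r \<in> {0<..<R}. U (d l) r = 0} \<and>
       card {r \<in> {0<..<R}. U (d l) r = 0} = l \<and> d (Suc l) < d l"
proof -
  define Z where "Z d = {r \<in> {0..R}. U d r = 0}" for d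
  define Zo where "Zo d = {r \<in> {0<..<R}. U d r = 0}" for d
  \<comment> \<open>The count is over the closed interval, so that a zero at R is included; the
    point 0 never contributes because of \<open>init\<close>.\<close>
  define A where "A l = {d \<in> {0<..D}. card (Z d) > l}" for l
  define d where "d l = Sup (A l)" for l :: nat
  have finZ: "finite (Z d)" if "d > 0" for d
    unfolding Z_def using finite_simple_zeros[OF deriv simple] that by blast
  have Zo_sub: "Zo d \<subseteq> Z d" for d by (auto simp: Z_def Zo_def)
  have finZo: "finite (Zo d)" if "d > 0" for d using finZ[OF that] Zo_sub finite_subset by blast
  have A_bdd: "bdd_above (A l)" for l by (rule bdd_aboveI[of _ D]) (simp add: A_def)
  have A_ne: "A l \<noteq> {}" for l
  proof -
    obtain d S where d: "0 < d" "d \<le> D" "S \<subseteq> {0..R}" "card S = Suc l" "\<forall>r\<in>S. U d r = 0"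
      using many by blast
    then have "S \<subseteq> Z d" by (auto simp: Z_def)
    then have "card S \<le> card (Z d)" using finZ d by (intro card_mono) auto
    then show ?thesis using d by (auto simp: A_def)
  qed
  have d_pos: "d l > 0" and d_le: "d l \<le> D" for l
  proof -
    obtain a where a: "a \<in> A l" using A_ne by blast
    then have "a \<le> d l" unfolding d_def by (intro cSup_upper A_bdd)
    then show "d l > 0" using a by (simp add: A_def)
    show "d l \<le> D" unfolding d_def using A_ne by (intro cSup_least) (auto simp: A_def)
  qed
  have near: "\<exists>\<delta>>0. \<forall>x. \<bar>x - d l\<bar> < \<delta> \<longrightarrow> x > 0 \<and>
      (\<forall>r\<in>{0..R}. \<bar>U x r - U (d l) r\<bar> < e \<and> \<bar>U' x r - U' (d l) r\<bar> < e)" if e: "e > 0" for e l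
  proof -
    obtain \<delta> where "\<delta> > 0" "\<forall>x. \<bar>x - d l\<bar> < \<delta> \<longrightarrow>
        (\<forall>r\<in>{0..R}. \<bar>U x r - U (d l) r\<bar> < e \<and> \<bar>U' x r - U' (d l) r\<bar> < e)"
      using flow_cont[OF d_pos e] by blast
    then show ?thesis using d_pos[of l] by (intro exI[of _ "min \<delta> (d l)"]) auto
  qed
  \<comment> \<open>The supremum is attained: under C^1 convergence of orbits, upper semicontinuity
    forbids that nearby parameters have more zeros in [0, R] than the limit.\<close>
  have d_in: "d l \<in> A l" for l
  proof (rule ccontr)
    assume "d l \<notin> A l"
    then have le: "card (Z (d l)) \<le> l" using d_pos[of l] d_le[of l] by (auto simp: A_def)
    obtain e where e: "e > 0"
      "\<And>w w'. (\<And>r. r \<in> {0..R} \<Longrightarrow> (w has_real_derivative w' r) (at r within {0..R})) \<Longrightarrow>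
        (\<And>r. r \<in> {0..R} \<Longrightarrow> \<bar>w r - U (d l) r\<bar> < e \<and> \<bar>w' r - U' (d l) r\<bar> < e) \<Longrightarrow>
        card {r \<in> {0..R}. w r = 0} \<le> card {r \<in> {0..R}. U (d l) r = 0}"
      using simple_zeros_upper_semicontinuous[OF deriv[OF d_pos[of l]] deriv_cont[OF d_pos[of l]]
          simple[OF d_pos[of l]]] by blast
    obtain \<delta> where \<delta>: "\<delta> > 0" "\<And>x. \<bar>x - d l\<bar> < \<delta> \<Longrightarrow> x > 0 \<and>
        (\<forall>r\<in>{0..R}. \<bar>U x r - U (d l) r\<bar> < e \<and> \<bar>U' x r - U' (d l) r\<bar> < e)"
      using near[OF e(1)] by blast
    obtain a where a: "a \<in> A l" "d l - \<delta> < a"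
      using less_cSup_iff[OF A_ne A_bdd, of "d l - \<delta>" l] \<delta>(1) by (auto simp: d_def)
    have "a \<le> d l" unfolding d_def using a by (intro cSup_upper A_bdd)
    then have an: "\<bar>a - d l\<bar> < \<delta>" using a by simp
    have "card (Z a) \<le> card (Z (d l))"
      unfolding Z_def using \<delta>(2)[OF an] by (intro e(2)[of "U a" "U' a"] deriv) auto
    then show False using a le by (simp add: A_def)
  qed
  have d_less: "d l < D" for l
  proof -
    have "Z D = {}" using top by (auto simp: Z_def)
    then have "D \<notin> A l" by (simp add: A_def)
    then show ?thesis using d_in[of l] d_le[of l] by (metis order_le_less)
  qed
  \<comment> \<open>Otherwise the interior zeros persist at a slightly larger parameter, which would
    lie in \<open>A l\<close> beyond its supremum. The strict inequality d l < D leaves room for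
    such a parameter.\<close>
  have Zo_le: "card (Zo (d l)) \<le> l" for l
  proof (rule ccontr)
    assume "\<not> card (Zo (d l)) \<le> l"
    then have gt: "card (Zo (d l)) > l" by simp
    have h: "(U (d l) has_real_derivative U' (d l) z) (at z)" "U' (d l) z \<noteq> 0" "U (d l) z = 0"
      if "z \<in> Zo (d l)" for z
      using that deriv[OF d_pos, of z l] simple[OF d_pos, of z l] by (auto simp: Zo_def at_within_Icc_at)
    have Zo_in: "Zo (d l) \<subseteq> {0<..<R}" by (auto simp: Zo_def)
    obtain e where e: "e > 0"
      "\<And>w. continuous_on {0..R} w \<Longrightarrow> (\<And>r. r \<in> {0..R} \<Longrightarrow> \<bar>w r - U (d l) r\<bar> < e) \<Longrightarrow>
        \<exists>S'. S' \<subseteq> {0<..<R} \<and> card S' = card (Zo (d l)) \<and> finite S' \<and> (\<forall>z\<in>S'. w z = 0)"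
      using simple_zeros_lower_semicontinuous[OF finZo[OF d_pos[of l]] Zo_in h(3) h(1) h(2)] by blast
    obtain \<delta> where \<delta>: "\<delta> > 0" "\<And>x. \<bar>x - d l\<bar> < \<delta> \<Longrightarrow> x > 0 \<and>
        (\<forall>r\<in>{0..R}. \<bar>U x r - U (d l) r\<bar> < e \<and> \<bar>U' x r - U' (d l) r\<bar> < e)"
      using near[OF e(1)] by blast
    define x where "x = min (d l + \<delta> / 2) D"
    have x: "\<bar>x - d l\<bar> < \<delta>" "d l < x" "x \<le> D" using d_less[of l] \<delta>(1) by (auto simp: x_def)
    have x_pos: "x > 0" using \<delta>(2)[OF x(1)] by simp
    obtain S' where S': "S' \<subseteq> {0<..<R}" "card S' = card (Zo (d l))" "\<forall>z\<in>S'. U x z = 0"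
      using e(2)[OF DERIV_continuous_on[OF deriv[OF x_pos]]] \<delta>(2)[OF x(1)] by blast
    have "card S' \<le> card (Z x)"
      using S' by (intro card_mono finZ x_pos) (auto simp: Z_def)
    then have "x \<in> A l" using x x_pos gt S' by (simp add: A_def)
    then have "x \<le> d l" unfolding d_def by (intro cSup_upper A_bdd)
    then show False using x by simp
  qed
  have main: "U (d l) R = 0 \<and> card (Zo (d l)) = l" for l
  proof -
    \<comment> \<open>The closed count exceeds l, the interior count does not, and R is the only
      point where they can differ. Hence R is a zero and there are exactly l interior ones.\<close>
    have sub: "Z (d l) \<subseteq> Zo (d l) \<union> {r. r = R \<and> U (d l) R = 0}"
      using init[OF d_pos, of l] by (force simp: Z_def Zo_def)
    have gt: "card (Z (d l)) > l" using d_in by (simp add: A_def)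
    have R0: "U (d l) R = 0"
    proof (rule ccontr)
      assume "U (d l) R \<noteq> 0"
      then have "card (Z (d l)) \<le> card (Zo (d l))"
        using sub by (intro card_mono finZo d_pos) auto
      then show False using gt Zo_le[of l] by simp
    qed
    then have "card (Z (d l)) \<le> card (insert R (Zo (d l)))"
      using sub by (intro card_mono) (auto intro: finZo d_pos)
    also have "\<dots> \<le> Suc (card (Zo (d l)))" by (rule card_insert_le_m1) auto
    finally show ?thesis using gt Zo_le[of l] R0 by simp
  qed
  have "d (Suc l) < d l" for l
  proof -
    have "d (Suc l) \<in> A l" using d_in[of "Suc l"] by (simp add: A_def)
    then have "d (Suc l) \<le> d l" unfolding d_def[of l] by (intro cSup_upper A_bdd)
    \<comment> \<open>Equal parameters would give one orbit with both l and l + 1 interior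
      zeros.\<close>
    moreover have "d (Suc l) \<noteq> d l" using main[of l] main[of "Suc l"] by auto
    ultimately show ?thesis by simp
  qed
  then show ?thesis
    using that[of d] d_pos d_less main finZo[OF d_pos] by (simp add: Zo_def)
qed

section \<open>Continuous dependence on the shooting parameter\<close>

context shooting
begin

definition U where "U d = (SOME u. sol 0 d u)"

lemma sol_U: "sol 0 d (U d)"
  unfolding U_def using sol_exists by (metis someI_ex)

text \<open>A sequence of parameters violating the estimate has a subsequence whose orbits and
  derivatives converge uniformly to a solution starting at \<open>d0\<close>. By uniqueness this
  solution is \<open>U d0\<close> on [0, R], a contradiction.\<close>

lemma flow_continuous:
  assumes d0: "d0 > 0" and e: "e > 0"
  shows "\<exists>\<delta>>0. \<forall>d. \<bar>d - d0\<bar> < \<delta> \<longrightarrow>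
    (\<forall>r\<in>{0..R}. \<bar>U d r - U d0 r\<bar> < e \<and> \<bar>V (U d) r - V (U d0) r\<bar> < e)"
proof (rule ccontr)
  assume neg: "\<not> ?thesis"
  have "\<exists>d r. \<bar>d - d0\<bar> < 1 / real (Suc n) \<and> r \<in> {0..R} \<and>
      \<not> (\<bar>U d r - U d0 r\<bar> < e \<and> \<bar>V (U d) r - V (U d0) r\<bar> < e)" for n
  proof -
    have "1 / real (Suc n) > 0" by simp
    with neg show ?thesis by metis
  qed
  then obtain d r where d: "\<And>n. \<bar>d n - d0\<bar> < 1 / real (Suc n)" and r: "\<And>n. r n \<in> {0..R}"
    and far: "\<And>n. \<not> (\<bar>U (d n) (r n) - U d0 (r n)\<bar> < e \<and> \<bar>V (U (d n)) (r n) - V (U d0) (r n)\<bar> < e)"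
    by metis
  have "(\<lambda>n. d n - d0) \<longlonglongrightarrow> 0"
    by (rule LIMSEQ_norm_0) (use d in auto)
  then have "d \<longlonglongrightarrow> d0" by (simp add: LIM_zero_iff)
  then obtain l v where "strict_mono (l :: nat \<Rightarrow> nat)" and v: "sol 0 d0 v"
    and lim: "uniform_limit {0..R} (\<lambda>n. U (d (l n))) v sequentially"
      "uniform_limit {0..R} (\<lambda>n. V (U (d (l n)))) (V v) sequentially"
    using sol_compact[of "\<lambda>_. 0" d "\<lambda>n. U (d n)" d0] sol_U by auto
  have eq: "v r = U d0 r" if "r \<in> {0..R}" for r
    using sol_unique[OF v sol_U d0 that] .
  have eqV: "V v r = V (U d0) r" if "r \<in> {0..R}" for r
    using that by (intro V_cong eq) auto
  have "\<forall>\<^sub>F n in sequentially. False"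
    using uniform_limitD[OF lim(1) e] uniform_limitD[OF lim(2) e]
  proof eventually_elim
    case (elim n)
    then show ?case using far[of "l n"] r[of "l n"] eq eqV by (auto simp: dist_real_def)
  qed
  then show False by simp
qed

end

section \<open>Oscillation of small orbits\<close>

lemma affine_deriv:
  fixes u :: "real \<Rightarrow> real"
  assumes "(u has_real_derivative D) (at (c + \<sigma> * t) within S)" "(\<lambda>t. c + \<sigma> * t) ` T \<subseteq> S"
  shows "((\<lambda>t. u (c + \<sigma> * t)) has_real_derivative D * \<sigma>) (at t within T)"
proof -
  have "((\<lambda>t. c + \<sigma> * t) has_real_derivative \<sigma>) (at t within T)"
    by (auto intro!: derivative_eq_intros)
  moreover have "(u has_real_derivative D) (at (c + \<sigma> * t) within (\<lambda>t. c + \<sigma> * t) ` T)"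
    using assms by (rule DERIV_subset)
  ultimately show ?thesis using DERIV_image_chain[of u D "\<lambda>t. c + \<sigma> * t" t T \<sigma>] by (simp add: o_def)
qed

text \<open>Integrability near \<open>0\<close> of \<open>h powr (-p)\<close>, expressed through a primitive \<open>Q\<close>.\<close>
definition osgood :: "real \<Rightarrow> (real \<Rightarrow> real) \<Rightarrow> bool" where
  "osgood p h \<longleftrightarrow> (\<exists>q>0. \<exists>Q. (\<forall>x\<in>{0<..<q}. (Q has_real_derivative h x powr (-p)) (at x) \<and> Q x \<ge> 0) \<and>
    (Q \<longlongrightarrow> 0) (at_right 0))"

context odd_profile
begin

text \<open>\<open>branch h c0 c1 l v\<close>: on an interval of length \<open>l\<close>, \<open>v\<close> is a positive decreasing arc of a solution
  (or of its negative, or run backwards in \<open>r\<close>), \<open>w\<close> being the corresponding flux.\<close>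
definition branch where
  "branch h c0 c1 l v \<longleftrightarrow> (\<exists>w a b. w 0 \<ge> (0::real) \<and> (\<forall>t\<in>{0..l::real}. v t > (0::real) \<and> a t \<ge> (c1::real) \<and> b t \<ge> (c0::real) \<and>
    (v has_real_derivative - g (a t * w t)) (at t within {0..l}) \<and>
    (w has_real_derivative b t * h (v t)) (at t within {0..l})))"

text \<open>As v decreases and h is nondecreasing, integrating w' gives w(t) \<ge> c0 t h(v(t)). By
  \<open>g_lower_power\<close>, -v' is at least a constant times (t h(v))^p, whence (Q(v))' \<le>
  -\<kappa> (p + 1) t^p. Integration over [0, l] yields Q(v(0)) \<ge> \<kappa> l^(p + 1), which
  fails for small v(0) since Q tends to 0.\<close>

lemma short_branch:
  assumes osgood: "osgood p h" and h_pos: "\<And>x. x > 0 \<Longrightarrow> 0 < h x \<and> h x \<le> B" and h_mono: "mono h"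
    and c: "c0 > 0" "c1 > 0" and l: "l > 0"
  obtains \<tau> where "\<tau> > 0" "\<And>v. branch h c0 c1 l v \<Longrightarrow> v 0 \<ge> \<tau>"
proof -
  obtain q Q where q: "q > 0" and Q_all: "\<forall>x\<in>{0<..<q}. (Q has_real_derivative h x powr (-p)) (at x) \<and> Q x \<ge> 0"
    and Q_lim: "(Q \<longlongrightarrow> 0) (at_right 0)"
    using osgood unfolding osgood_def by blast
  have Q: "(Q has_real_derivative h x powr (-p)) (at x)" "Q x \<ge> 0" if "0 < x" "x < q" for x
    using Q_all that by auto
  have B: "B > 0" using h_pos[of 1] by simp
  \<comment> \<open>An upper bound for c1 c0 h(v(t)) t on [0, l], used as the reference point in
    \<open>g_lower_power\<close>.\<close>
  define top where "top = c1 * c0 * (B * l)"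
  have top: "top > 0" using c B l by (simp add: top_def)
  \<comment> \<open>Normalised so that the lower bound for g, multiplied by h(v)^(-p), becomes
    exactly the derivative of \<kappa> t^(p + 1).\<close>
  define \<kappa> where "\<kappa> = g top / (B * l) powr p / (p + 1)"
  have \<kappa>: "\<kappa> > 0" using top B l p_pos by (simp add: \<kappa>_def)
  have "\<forall>\<^sub>F x in at_right 0. Q x < \<kappa> * l powr (p + 1)"
    using \<kappa> l by (intro order_tendstoD(2)[OF Q_lim]) simp
  then obtain t0 where t0: "t0 > 0" "\<And>x. 0 < x \<Longrightarrow> x < t0 \<Longrightarrow> Q x < \<kappa> * l powr (p + 1)"
    by (auto simp: eventually_at_right_field)
  show ?thesis
  proof (rule that[of "min t0 q"])
    fix v assume "branch h c0 c1 l v"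
    then obtain w a b where w0: "w 0 \<ge> 0" and v_pos: "\<And>t. t \<in> {0..l} \<Longrightarrow> v t > 0"
      and a: "\<And>t. t \<in> {0..l} \<Longrightarrow> a t \<ge> c1" and b: "\<And>t. t \<in> {0..l} \<Longrightarrow> b t \<ge> c0"
      and v: "\<And>t. t \<in> {0..l} \<Longrightarrow> (v has_real_derivative - g (a t * w t)) (at t within {0..l})"
      and w: "\<And>t. t \<in> {0..l} \<Longrightarrow> (w has_real_derivative b t * h (v t)) (at t within {0..l})"
      unfolding branch_def by blast
    show "v 0 \<ge> min t0 q"
    proof (rule ccontr)
      assume "\<not> v 0 \<ge> min t0 q"
      then have v0: "v 0 < t0" "v 0 < q" by auto
      have w_nonneg: "w t \<ge> 0" if t: "t \<in> {0..l}" for t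
      proof (cases "t = 0")
        case False
        have "\<exists>z. 0 < z \<and> z < t \<and> w t - w 0 = (t - 0) * (b z * h (v z))"
          by (rule mean_value_within[of 0 t w "\<lambda>z. b z * h (v z)"])
            (use t False in \<open>auto intro!: DERIV_subset[OF w]\<close>)
        then obtain z where z: "0 < z" "z < t" "w t - w 0 = t * (b z * h (v z))" by auto
        have "b z * h (v z) \<ge> 0" using b[of z] c h_pos[OF v_pos[of z]] z t by simp
        then show ?thesis using z w0 t by (metis atLeastAtMost_iff diff_ge_0_iff_ge mult_nonneg_nonneg order_trans)
      qed (use w0 in simp)
      have v_anti: "v t \<le> v s" if st: "0 \<le> s" "s \<le> t" "t \<le> l" for s t
      proof (cases "s = t")
        case False
        have "\<exists>z. s < z \<and> z < t \<and> v t - v s = (t - s) * (- g (a z * w z))"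
          by (rule mean_value_within[of s t v "\<lambda>z. - g (a z * w z)"])
            (use st False in \<open>auto intro!: DERIV_subset[OF v]\<close>)
        then obtain z where z: "s < z" "z < t" "v t - v s = (t - s) * (- g (a z * w z))" by auto
        have "a z * w z \<ge> 0" using a[of z] c w_nonneg[of z] z st by simp
        then have "(t - s) * (- g (a z * w z)) \<le> 0" using st by (simp add: mult_nonneg_nonneg)
        then show ?thesis using z(3) by linarith
      qed simp
      have w_lower: "w t \<ge> c0 * (h (v t) * t)" if t: "0 < t" "t \<le> l" for t
      proof -
        have "\<exists>z. 0 < z \<and> z < t \<and> w t - w 0 = (t - 0) * (b z * h (v z))"
          by (rule mean_value_within[of 0 t w "\<lambda>z. b z * h (v z)"])
            (use t in \<open>auto intro!: DERIV_subset[OF w]\<close>)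
        then obtain z where z: "0 < z" "z < t" "w t - w 0 = t * (b z * h (v z))" by auto
        have "h (v t) \<le> h (v z)" using v_anti[of z t] z t h_mono by (auto dest: monoD)
        then have "c0 * h (v t) \<le> b z * h (v z)"
          using b[of z] z t c h_pos[OF v_pos[of t]] by (intro mult_mono) auto
        then have "t * (c0 * h (v t)) \<le> t * (b z * h (v z))" using t by simp
        moreover have "c0 * (h (v t) * t) = t * (c0 * h (v t))" by simp
        ultimately show ?thesis using z w0 by linarith
      qed
      have v_range: "0 < v t \<and> v t < q" if "t \<in> {0..l}" for t
        using v_pos[OF that] v_anti[of 0 t] that v0 by auto
      let ?Z = "\<lambda>t. Q (v t) + \<kappa> * t powr (p + 1)"
      have "?Z l \<le> ?Z 0"
      proof (rule DERIV_nonpos_imp_decreasing_open[of 0 l ?Z])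
        fix t assume t: "0 < t" "t < l"
        then have t': "t \<in> {0..l}" by simp
        have vd: "(v has_real_derivative - g (a t * w t)) (at t)"
          using v[OF t'] t by (simp add: at_within_Icc_at)
        let ?D = "h (v t) powr (-p) * - g (a t * w t) + \<kappa> * ((p + 1) * t powr (p + 1 - 1))"
        have "(?Z has_real_derivative ?D) (at t)"
          using v_range[OF t'] by (intro DERIV_add DERIV_cmult has_real_derivative_powr t DERIV_chain2[OF Q(1) vd]) auto
        moreover have "?D \<le> 0"
        proof -
          have hv: "0 < h (v t)" "h (v t) \<le> B" using h_pos v_range[OF t'] by auto
          let ?y = "c1 * (c0 * (h (v t) * t))"
          have y: "0 \<le> ?y" "?y \<le> top" "?y / top = (h (v t) * t) / (B * l)"
            using c hv t l B by (auto simp: top_def intro!: mult_left_mono mult_mono)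
          have "?y \<le> a t * w t"
            using a[OF t'] w_lower[of t] c hv t by (intro mult_mono) auto
          then have "g ?y \<le> g (a t * w t)" by simp
          moreover have "g top * (?y / top) powr p \<le> g ?y" using y top by (intro g_lower_power) auto
          ultimately have "g top * ((h (v t) * t) / (B * l)) powr p \<le> g (a t * w t)"
            by (metis order_trans y(3))
          then have "h (v t) powr (-p) * (g top * ((h (v t) * t) / (B * l)) powr p) \<le> h (v t) powr (-p) * g (a t * w t)"
            by (intro mult_left_mono) auto
          also have "h (v t) powr (-p) * (g top * ((h (v t) * t) / (B * l)) powr p) = \<kappa> * ((p + 1) * t powr (p + 1 - 1))"
          proof -
            have 1: "h (v t) powr (-p) * h (v t) powr p = 1" using hv by (simp flip: powr_add)
            have 2: "((h (v t) * t) / (B * l)) powr p = h (v t) powr p * t powr p / (B * l) powr p"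
              by (simp add: powr_mult powr_divide)
            have "h (v t) powr (-p) * (g top * ((h (v t) * t) / (B * l)) powr p)
                = (h (v t) powr (-p) * h (v t) powr p) * (g top / (B * l) powr p * t powr p)"
              unfolding 2 by simp
            also have "g top / (B * l) powr p = \<kappa> * (p + 1)" using p_pos by (simp add: \<kappa>_def)
            finally show ?thesis unfolding 1 by simp
          qed
          finally show ?thesis by simp
        qed
        ultimately show "\<exists>y. (?Z has_real_derivative y) (at t) \<and> y \<le> 0" by blast
      next
        have "continuous_on {0<..<q} Q"
          using Q(1) by (intro DERIV_continuous_on[of _ Q "\<lambda>x. h x powr (-p)"]) (auto intro: has_field_derivative_at_within)
        then have "continuous_on {0..l} (\<lambda>t. Q (v t))"
          by (rule continuous_on_compose2[OF _ DERIV_continuous_on[OF v]]) (use v_range in auto)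
        moreover have "continuous_on {0..l} (\<lambda>t. t powr (p + 1))"
          using p_pos by (intro continuous_on_powr' continuous_intros) auto
        ultimately show "continuous_on {0..l} ?Z"
          by (intro continuous_on_add continuous_on_mult_left)
      qed (use l in simp)
      then have "Q (v l) + \<kappa> * l powr (p + 1) \<le> Q (v 0)" by simp
      moreover have "Q (v l) \<ge> 0" using Q(2) v_range[of l] l by simp
      moreover have "Q (v 0) < \<kappa> * l powr (p + 1)" using t0(2) v_pos[of 0] v0 l by simp
      ultimately show False by simp
    qed
  qed (use t0 q in simp)
qed

end

section \<open>Zeros of orbits of small amplitude\<close>

context shooting
begin

lemma flux_derivs:
  assumes u: "sol 0 d u" and r: "r \<in> {0..R}"
  shows "(u has_real_derivative g (r powr (-\<alpha>) * W u r)) (at r within {0..R})"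
    "(W u has_real_derivative - (k r * f (u r))) (at r within {0..R})"
  using sol_deriv[OF u r] W_deriv[OF sol_cont[OF u] r] by (simp_all add: V_def Y_def)

text \<open>\<mu> is the sign of u and \<sigma> the direction in which r is traversed; the flux
  condition says that |u| does not increase at c in that direction. Confinement to [R/2, R] keeps
  the weights r^\<gamma> and r^(-\<alpha>) bounded below by positive constants.\<close>

lemma branch_from_flux:
  assumes u: "sol 0 d u" and \<sigma>: "\<sigma> \<in> {1, -1}" and \<mu>: "\<mu> \<in> {1, -1}"
    and range: "\<And>t. t \<in> {0..l} \<Longrightarrow> c + \<sigma> * t \<in> {R / 2..R}"
    and pos: "\<And>t. t \<in> {0..l} \<Longrightarrow> \<mu> * u (c + \<sigma> * t) > 0"
    and flux: "\<sigma> * \<mu> * W u c \<le> 0"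
  shows "branch (\<lambda>x. \<mu> * f (\<mu> * x)) ((R / 2) powr \<gamma>) (min ((R / 2) powr (-\<alpha>)) (R powr (-\<alpha>))) l
    (\<lambda>t. \<mu> * u (c + \<sigma> * t))"
  unfolding branch_def
proof (intro exI conjI ballI)
  let ?w = "\<lambda>t. - (\<sigma> * \<mu>) * W u (c + \<sigma> * t)"
  show "?w 0 \<ge> 0" using flux by simp
  fix t assume t: "t \<in> {0..l}"
  let ?r = "c + \<sigma> * t"
  have r: "R / 2 \<le> ?r" "?r \<le> R" "?r \<in> {0..R}" using range[OF t] R_pos by auto
  have sub: "(\<lambda>t. c + \<sigma> * t) ` {0..l} \<subseteq> {0..R}" using range R_pos by force
  have r0: "?r > 0" using r R_pos by linarith
  have signs: "\<sigma> * \<sigma> = 1" "\<mu> * \<mu> = 1" using \<sigma> \<mu> by auto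
  show "\<mu> * u ?r > 0" by (rule pos[OF t])
  show "?r powr (-\<alpha>) \<ge> min ((R / 2) powr (-\<alpha>)) (R powr (-\<alpha>))"
  proof (cases "\<alpha> \<ge> 0")
    case True
    then have "R powr (-\<alpha>) \<le> ?r powr (-\<alpha>)" using r r0 by (intro powr_mono2') auto
    then show ?thesis by simp
  next
    case False
    then have "(R / 2) powr (-\<alpha>) \<le> ?r powr (-\<alpha>)" using r R_pos by (intro powr_mono2) auto
    then show ?thesis by simp
  qed
  show "k ?r \<ge> (R / 2) powr \<gamma>"
    using r R_pos gamma k_pos[OF r0] by (auto intro: powr_mono2)
  have "((\<lambda>t. \<mu> * u (c + \<sigma> * t)) has_real_derivative \<mu> * (g (?r powr (-\<alpha>) * W u ?r) * \<sigma>)) (at t within {0..l})"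
    by (intro DERIV_cmult affine_deriv[OF flux_derivs(1)[OF u r(3)] sub])
  moreover have "\<mu> * (g (?r powr (-\<alpha>) * W u ?r) * \<sigma>) = - g (?r powr (-\<alpha>) * ?w t)"
    using \<sigma> \<mu> by (auto simp: g_odd)
  ultimately show "((\<lambda>t. \<mu> * u (c + \<sigma> * t)) has_real_derivative - g (?r powr (-\<alpha>) * ?w t)) (at t within {0..l})"
    by simp
  have "(?w has_real_derivative - (\<sigma> * \<mu>) * ((- (k ?r * f (u ?r))) * \<sigma>)) (at t within {0..l})"
    by (intro DERIV_cmult affine_deriv[OF flux_derivs(2)[OF u r(3)] sub])
  moreover have "- (\<sigma> * \<mu>) * ((- (k ?r * f (u ?r))) * \<sigma>) = k ?r * (\<mu> * f (\<mu> * (\<mu> * u ?r)))"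
    using \<sigma> \<mu> by auto
  ultimately show "(?w has_real_derivative k ?r * (\<mu> * f (\<mu> * (\<mu> * u ?r)))) (at t within {0..l})"
    by metis
qed

text \<open>If u has no zero on the interval, then from the centre |u| decreases throughout the left
  or the right half. That half is a branch of length l, so |u| at the centre is bounded below. Both
  signs of u are covered by the smaller of two thresholds.\<close>

lemma zero_in_every_long_interval:
  assumes mono: "mono f" and osgood: "osgood p f" "osgood p (\<lambda>x. - f (- x))" and l: "l > 0"
  obtains \<tau> where "\<tau> > 0" "\<And>d u c. sol 0 d u \<Longrightarrow> (\<And>r. r \<in> {0..R} \<Longrightarrow> \<bar>u r\<bar> < \<tau>) \<Longrightarrow>
    R / 2 \<le> c - l \<Longrightarrow> c + l \<le> R \<Longrightarrow> \<exists>r\<in>{c - l..c + l}. u r = 0"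
proof -
  define c0 where "c0 = (R / 2) powr \<gamma>"
  define c1 where "c1 = min ((R / 2) powr (-\<alpha>)) (R powr (-\<alpha>))"
  have c: "c0 > 0" "c1 > 0" using R_pos by (auto simp: c0_def c1_def)
  have "\<exists>\<tau>>0. \<forall>v. branch (\<lambda>x. \<mu> * f (\<mu> * x)) c0 c1 l v \<longrightarrow> v 0 \<ge> \<tau>" if \<mu>: "\<mu> \<in> {1, -1}" for \<mu>
  proof -
    have "osgood p (\<lambda>x. \<mu> * f (\<mu> * x))" using \<mu> osgood by auto
    moreover have "0 < \<mu> * f (\<mu> * x) \<and> \<mu> * f (\<mu> * x) \<le> B" if "x > 0" for x
      using \<mu> that f_bound[of x] f_bound[of "-x"] f_pos[of x] f_neg[of "-x"] by auto
    moreover have "mono (\<lambda>x. \<mu> * f (\<mu> * x))" using \<mu> mono by (auto simp: mono_def)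
    ultimately obtain \<tau> where "\<tau> > 0" "\<And>v. branch (\<lambda>x. \<mu> * f (\<mu> * x)) c0 c1 l v \<Longrightarrow> v 0 \<ge> \<tau>"
      using short_branch[OF _ _ _ c l, of "\<lambda>x. \<mu> * f (\<mu> * x)" B] by blast
    then show ?thesis by blast
  qed
  then obtain T where T: "\<And>\<mu>. \<mu> \<in> {1, -1} \<Longrightarrow> T \<mu> > 0"
    "\<And>\<mu> v. \<mu> \<in> {1, -1} \<Longrightarrow> branch (\<lambda>x. \<mu> * f (\<mu> * x)) c0 c1 l v \<Longrightarrow> v 0 \<ge> T \<mu>" by metis
  show ?thesis
  proof (rule that[of "min (T 1) (T (-1))"])
    fix d u c assume u: "sol 0 d u" and small: "\<And>r. r \<in> {0..R} \<Longrightarrow> \<bar>u r\<bar> < min (T 1) (T (-1))"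
      and c: "R / 2 \<le> c - l" "c + l \<le> R"
    show "\<exists>r\<in>{c - l..c + l}. u r = 0"
    proof (rule ccontr)
      assume none: "\<not> (\<exists>r\<in>{c - l..c + l}. u r = 0)"
      have sub: "{c - l..c + l} \<subseteq> {0..R}" using c R_pos by auto
      have uc: "continuous_on {x..y} u" if "{x..y} \<subseteq> {c - l..c + l}" for x y
        using sub that by (intro continuous_on_subset[OF sol_cont[OF u]]) auto
      define \<mu> where "\<mu> = sgn (u c)"
      have "u c \<noteq> 0" using none l by auto
      then have \<mu>: "\<mu> \<in> {1, -1}" "\<mu> * u c > 0" by (auto simp: \<mu>_def sgn_if)
      have same: "\<mu> * u r > 0" if r: "r \<in> {c - l..c + l}" for r
      proof (rule ccontr)
        assume "\<not> \<mu> * u r > 0"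
        then have le: "\<mu> * u r \<le> 0" by simp
        have "\<exists>x\<in>{c - l..c + l}. \<mu> * u x = 0"
        proof (cases "r \<le> c")
          case True
          have "continuous_on {r..c} (\<lambda>x. \<mu> * u x)" using r by (intro continuous_intros uc) auto
          then obtain x where "r \<le> x" "x \<le> c" "\<mu> * u x = 0"
            using IVT'[of "\<lambda>x. \<mu> * u x" r 0 c] le \<mu>(2) True by auto
          then show ?thesis using r l by (intro bexI[of _ x]) auto
        next
          case False
          have "continuous_on {c..r} (\<lambda>x. \<mu> * u x)" using r by (intro continuous_intros uc) auto
          then obtain x where "c \<le> x" "x \<le> r" "\<mu> * u x = 0"
            using IVT2'[of "\<lambda>x. \<mu> * u x" r 0 c] le \<mu>(2) False by auto
          then show ?thesis using r l by (intro bexI[of _ x]) auto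
        qed
        then show False using none \<mu> by auto
      qed
      \<comment> \<open>The direction is chosen by the sign of the flux at the centre, so that |u|
        starts nonincreasing.\<close>
      define \<sigma> :: real where "\<sigma> = (if \<mu> * W u c \<le> 0 then 1 else -1)"
      have \<sigma>: "\<sigma> \<in> {1, -1}" "\<sigma> * \<mu> * W u c \<le> 0" by (auto simp: \<sigma>_def)
      have in_int: "c + \<sigma> * t \<in> {c - l..c + l}" if "t \<in> {0..l}" for t using \<sigma>(1) that by auto
      have "branch (\<lambda>x. \<mu> * f (\<mu> * x)) c0 c1 l (\<lambda>t. \<mu> * u (c + \<sigma> * t))"
        unfolding c0_def c1_def
      proof (rule branch_from_flux[OF u \<sigma>(1) \<mu>(1) _ _ \<sigma>(2)])
        show "c + \<sigma> * t \<in> {R / 2..R}" if "t \<in> {0..l}" for t using in_int[OF that] c by auto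
        show "\<mu> * u (c + \<sigma> * t) > 0" if "t \<in> {0..l}" for t using same in_int[OF that] by blast
      qed
      then have "\<mu> * u c \<ge> T \<mu>" using T(2)[OF \<mu>(1)] by fastforce
      moreover have "\<mu> * u c \<le> \<bar>u c\<bar>" using \<mu>(1) by auto
      moreover have "\<bar>u c\<bar> < T \<mu>" using small[of c] sub l \<mu>(1) by auto
      ultimately show False by simp
    qed
  qed (use T(1) in auto)
qed

text \<open>The energy bound F(u) \<le> F(d) confines the orbit to a sublevel set of F, which
  shrinks to 0 with d because F vanishes only at 0 and is strictly monotone on each side.\<close>

lemma small_orbit:
  assumes "\<tau> > 0"
  obtains d where "0 < d" "d < \<tau>" "\<And>u r. sol 0 d u \<Longrightarrow> r \<in> {0..R} \<Longrightarrow> \<bar>u r\<bar> < \<tau>"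
proof -
  have "(F \<longlongrightarrow> F 0) (at_right 0)"
    using DERIV_isCont[OF F_deriv, of 0] by (simp add: isCont_def filterlim_at_split)
  then have "\<forall>\<^sub>F d in at_right 0. F d < F (- \<tau>)"
    using F_pos[of "-\<tau>"] assms by (intro order_tendstoD(2)) auto
  moreover have "\<forall>\<^sub>F d in at_right 0. d \<in> {0<..<\<tau>}" using eventually_at_right_real[OF assms] .
  ultimately have "\<forall>\<^sub>F d in at_right 0. F d < F (- \<tau>) \<and> d \<in> {0<..<\<tau>}" by eventually_elim simp
  then obtain d where d: "F d < F (- \<tau>)" "0 < d" "d < \<tau>"
    using eventually_happens[of _ "at_right (0::real)"] by fastforce
  have "\<bar>u r\<bar> < \<tau>" if u: "sol 0 d u" "r \<in> {0..R}" for u r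
  proof -
    note le = F_sol_le[OF u]
    have "u r \<le> d" using le F_strict_mono_pos[of d "u r"] d by linarith
    moreover have "u r > - \<tau>"
      using le d F_strict_mono_neg[of "-\<tau>" "u r"] by (cases "u r" "-\<tau>" rule: linorder_cases) auto
    ultimately show ?thesis using d by linarith
  qed
  then show ?thesis using that d by blast
qed

lemma many_zeros:
  assumes mono: "mono f" and osgood: "osgood p f" "osgood p (\<lambda>x. - f (- x))" and D: "D > 0"
  shows "\<exists>d. 0 < d \<and> d \<le> D \<and> (\<exists>S. S \<subseteq> {0..R} \<and> card S = n \<and> (\<forall>r\<in>S. U d r = 0))"
proof (cases "n = 0")
  case True
  then show ?thesis using D by (intro exI[of _ D] conjI exI[of _ "{}"]) auto
next
  case False
  \<comment> \<open>Then n blocks of length 4 l fill [R/2, R] exactly. The zero-containing interval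
    takes up the first half of its block, which leaves gaps of length 2 l and makes the zeros
    distinct.\<close>
  define l where "l = R / (8 * real n)"
  have l: "l > 0" using R_pos False by (simp add: l_def)
  have nl: "4 * (real n * l) = R / 2" using False by (simp add: l_def)
  obtain \<tau> where \<tau>: "\<tau> > 0" "\<And>d u c. sol 0 d u \<Longrightarrow> (\<And>r. r \<in> {0..R} \<Longrightarrow> \<bar>u r\<bar> < \<tau>) \<Longrightarrow>
    R / 2 \<le> c - l \<Longrightarrow> c + l \<le> R \<Longrightarrow> \<exists>r\<in>{c - l..c + l}. u r = 0"
    using zero_in_every_long_interval[OF mono osgood l] by metis
  obtain d where d: "0 < d" "d < min \<tau> D" "\<And>u r. sol 0 d u \<Longrightarrow> r \<in> {0..R} \<Longrightarrow> \<bar>u r\<bar> < min \<tau> D"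
    using small_orbit[of "min \<tau> D"] \<tau>(1) D by (metis min_less_iff_conj)
  define c where "c i = R / 2 + (4 * real i + 1) * l" for i :: nat
  have c: "R / 2 \<le> c i - l" "c i + l \<le> R" if "i < n" for i
  proof -
    show "R / 2 \<le> c i - l" using l by (simp add: c_def algebra_simps)
    have "(real i + 1) * l \<le> real n * l" using that l by (intro mult_right_mono) auto
    then show "c i + l \<le> R" using nl l by (simp add: c_def algebra_simps)
  qed
  have "\<exists>r\<in>{c i - l..c i + l}. U d r = 0" if "i < n" for i
    using d(3)[OF sol_U] by (intro \<tau>(2)[OF sol_U _ c[OF that]]) simp
  then obtain x where x: "\<And>i. i < n \<Longrightarrow> x i \<in> {c i - l..c i + l} \<and> U d (x i) = 0" by metis
  have less: "x i < x j" if ij: "i < j" "j < n" for i j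
  proof -
    have "(real i + 1) * l \<le> real j * l" using ij l by (intro mult_right_mono) auto
    moreover have "x i \<le> c i + l" "c j - l \<le> x j" using x[of i] x[of j] ij by auto
    ultimately show ?thesis using l by (simp add: c_def algebra_simps)
  qed
  have "inj_on x {..<n}"
  proof (rule inj_onI)
    fix i j assume "i \<in> {..<n}" "j \<in> {..<n}" "x i = x j"
    then show "i = j" using less[of i j] less[of j i] by (cases i j rule: linorder_cases) auto
  qed
  then have "card (x ` {..<n}) = n" by (simp add: card_image)
  moreover have "x ` {..<n} \<subseteq> {0..R}"
  proof
    fix r assume "r \<in> x ` {..<n}"
    then obtain i where "i < n" "r = x i" by auto
    then show "r \<in> {0..R}" using x[of i] c[of i] R_pos by auto
  qed
  ultimately show ?thesis
    using d x by (intro exI[of _ d] conjI exI[of _ "x ` {..<n}"]) auto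
qed

end

section \<open>Reduction to the integral equation\<close>

lemma set_nn_integral_finite_imp_integrable_on:
  fixes h :: "real \<Rightarrow> real"
  assumes h: "h \<in> borel_measurable borel" "\<And>t. h t \<ge> 0" and S: "S \<in> sets borel"
    and fin: "(\<integral>\<^sup>+t\<in>S. ennreal (h t) \<partial>lborel) < \<infinity>"
  shows "h integrable_on S"
proof -
  have eq: "ennreal (indicator S t *\<^sub>R h t) = ennreal (h t) * indicator S t" for t
    by (auto simp: indicator_def)
  have "integrable lborel (\<lambda>t. indicator S t *\<^sub>R h t)"
  proof (rule integrableI_nonneg)
    show "(\<lambda>t. indicator S t *\<^sub>R h t) \<in> borel_measurable lborel" using h S by simp
    show "(\<integral>\<^sup>+t. ennreal (indicator S t *\<^sub>R h t) \<partial>lborel) < \<infinity>" unfolding eq by (rule fin)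
  qed (use h in auto)
  then show ?thesis
    using set_borel_integral_eq_integral(1)[of S h] by (simp add: set_integrable_def)
qed

lemma osgoodI:
  assumes q: "q > 0" and h: "continuous_on UNIV h" "\<And>x. x > 0 \<Longrightarrow> h x > 0"
    and int: "(\<lambda>x. h x powr (-p)) integrable_on {0..q}"
  shows "osgood p h"
proof -
  define Q where "Q x = integral {0..x} (\<lambda>x. h x powr (-p))" for x
  have "(Q has_real_derivative h x powr (-p)) (at x) \<and> Q x \<ge> 0" if x: "x \<in> {0<..<q}" for x
  proof
    have "isCont h x" using h(1) by (simp add: continuous_on_eq_continuous_at)
    then have "isCont (\<lambda>x. h x powr (-p)) x" using h(2)[of x] x by (intro continuous_intros) auto
    then have "continuous (at x within {0..q} - {}) (\<lambda>x. h x powr (-p))"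
      by (rule continuous_at_imp_continuous_at_within)
    then have "(Q has_real_derivative h x powr (-p)) (at x within {0..q} - {})"
      using integral_has_vector_derivative_continuous_at[OF int, of x "{}"] x
      by (auto simp: has_real_derivative_iff_has_vector_derivative Q_def[abs_def])
    then show "(Q has_real_derivative h x powr (-p)) (at x)"
      using x by (simp add: at_within_Icc_at)
    show "Q x \<ge> 0" unfolding Q_def using x
      by (intro integral_nonneg integrable_on_subinterval[OF int]) auto
  qed
  moreover have "continuous_on {0..q} Q"
    using indefinite_integral_continuous_1[OF int] by (simp add: Q_def[abs_def])
  then have "(Q \<longlongrightarrow> Q 0) (at 0 within {0..q})"
    using q by (simp add: continuous_on_def)
  then have "(Q \<longlongrightarrow> 0) (at_right 0)"
    using at_within_Icc_at_right[OF q] by (simp add: Q_def)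
  ultimately show ?thesis unfolding osgood_def using q by blast
qed

text \<open>Only the behaviour near 0 matters, where the cut-off function is a multiple of the
  original one; the primitive is multiplied by c^(-p).\<close>

lemma osgood_scale:
  assumes h: "osgood p h" and c: "c > 0" and q: "q > 0"
    and eq: "\<And>x. 0 < x \<Longrightarrow> x < q \<Longrightarrow> h' x = c * h x \<and> h x \<ge> 0"
  shows "osgood p h'"
proof -
  obtain q1 Q where q1: "q1 > 0" and Q: "\<forall>x\<in>{0<..<q1}. (Q has_real_derivative h x powr (-p)) (at x) \<and> Q x \<ge> 0"
    and lim: "(Q \<longlongrightarrow> 0) (at_right 0)"
    using h unfolding osgood_def by blast
  let ?Q = "\<lambda>x. c powr (-p) * Q x"
  have "(?Q has_real_derivative h' x powr (-p)) (at x) \<and> ?Q x \<ge> 0" if x: "x \<in> {0<..<min q q1}" for x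
  proof -
    have "h' x powr (-p) = c powr (-p) * h x powr (-p)"
      using eq[of x] x c by (simp add: powr_mult)
    then show ?thesis using Q x by (auto intro!: DERIV_cmult)
  qed
  moreover have "(?Q \<longlongrightarrow> 0) (at_right 0)" using tendsto_mult_left[OF lim, of "c powr (-p)"] by simp
  ultimately show ?thesis
    unfolding osgood_def using q q1 by (intro exI[of _ "min q q1"] conjI exI[of _ ?Q]) auto
qed

lemma C1_locally_lipschitz:
  fixes h :: "real \<Rightarrow> real"
  assumes h: "h C1_differentiable_on S" and S: "open S" "x \<in> S"
  obtains \<delta> L where "\<delta> > 0" "L \<ge> 0"
    "\<And>s t. \<bar>s - x\<bar> < \<delta> \<Longrightarrow> \<bar>t - x\<bar> < \<delta> \<Longrightarrow> \<bar>h s - h t\<bar> \<le> L * \<bar>s - t\<bar>"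
proof -
  obtain h' where h': "\<And>y. y \<in> S \<Longrightarrow> (h has_real_derivative h' y) (at y)" and cont: "continuous_on S h'"
    using h by (auto simp: C1_differentiable_on_def has_real_derivative_iff_has_vector_derivative)
  obtain \<delta> where \<delta>: "\<delta> > 0" "cball x \<delta> \<subseteq> S" using S open_contains_cball by blast
  have "bounded (h' ` cball x \<delta>)"
    by (intro compact_imp_bounded compact_continuous_image continuous_on_subset[OF cont \<delta>(2)]) auto
  then obtain L where L: "L > 0" "\<And>y. y \<in> cball x \<delta> \<Longrightarrow> norm (h' y) \<le> L"
    by (auto simp: bounded_pos)
  show ?thesis
  proof (rule that[of \<delta> L])
    fix s t assume "\<bar>s - x\<bar> < \<delta>" "\<bar>t - x\<bar> < \<delta>"
    then have st: "s \<in> cball x \<delta>" "t \<in> cball x \<delta>" by (auto simp: dist_real_def)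
    have "(h has_real_derivative h' z) (at z within cball x \<delta>)" if "z \<in> cball x \<delta>" for z
      using h'[of z] \<delta>(2) that by (blast intro: has_field_derivative_at_within)
    then have "norm (h s - h t) \<le> L * norm (s - t)"
      by (rule field_differentiable_bound[OF convex_cball _ L(2) st])
    then show "\<bar>h s - h t\<bar> \<le> L * \<bar>s - t\<bar>" by simp
  qed (use \<delta> L in auto)
qed

text \<open>For \<psi>(t) = t \<phi>(|t|), (\<phi>_3) gives \<psi>'(t) \<ge> (c - 1) \<phi>(t) on t
  > 0. At t = g(y) one has \<phi>(t) = y / g(y), so the inverse function rule yields g'(y) \<le>
  g(y) / ((c - 1) y). The limits in (\<phi>_1) provide continuity of \<psi> at 0 and
  surjectivity.\<close>

lemma profile_inverse:
  fixes \<phi> :: "real \<Rightarrow> real" and c :: real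
  assumes c: "c > 1"
    and phi_pos: "\<forall>t>0. \<phi> t > 0" and phi_C1: "\<phi> C1_differentiable_on {0<..}"
    and phi_1: "((\<lambda>t. t * \<phi> t) \<longlongrightarrow> 0) (at_right 0)" "filterlim (\<lambda>t. t * \<phi> t) at_top at_top"
    and phi_2: "strict_mono_on {0<..} (\<lambda>t. t * \<phi> t)"
    and phi_3: "\<forall>t>0. c - 1 \<le> deriv (\<lambda>s. s * \<phi> s) t / \<phi> t"
  shows "\<exists>g. odd_profile g (1 / (c - 1)) \<and> (\<forall>y. g y * \<phi> \<bar>g y\<bar> = y) \<and> (\<forall>t. g (t * \<phi> \<bar>t\<bar>) = t)"
proof -
  define \<psi> where "\<psi> t = t * \<phi> \<bar>t\<bar>" for t
  define g where "g = inv \<psi>"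
  have \<psi>_odd: "\<psi> (- t) = - \<psi> t" for t by (simp add: \<psi>_def)
  have \<psi>_pos: "\<psi> t > 0" if "t > 0" for t using that phi_pos by (simp add: \<psi>_def)
  have \<psi>_less: "\<psi> s < \<psi> t" if "0 < s" "s < t" for s t
    using strict_mono_onD[OF phi_2, of s t] that by (simp add: \<psi>_def)
  have \<psi>_mono: "strict_mono \<psi>"
  proof (rule strict_monoI)
    fix s t :: real assume st: "s < t"
    consider "0 < s" | "s \<le> 0" "0 \<le> t" | "t < 0" using st by linarith
    then show "\<psi> s < \<psi> t"
    proof cases
      case 1
      then show ?thesis using \<psi>_less st by simp
    next
      case 2
      then have "\<psi> s \<le> 0" "\<psi> t \<ge> 0" "\<psi> s < 0 \<or> \<psi> t > 0"
        using st \<psi>_pos[of t] \<psi>_pos[of "-s"] \<psi>_odd[of s] by (cases "s = 0"; cases "t = 0"; force simp: \<psi>_def)+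
      then show ?thesis by linarith
    next
      case 3
      then show ?thesis using \<psi>_less[of "-t" "-s"] st by (simp add: \<psi>_odd)
    qed
  qed
  have phi_deriv: "\<exists>D. (\<phi> has_real_derivative D) (at t)" if "t > 0" for t
    using phi_C1 that by (auto simp: C1_differentiable_on_def has_real_derivative_iff_has_vector_derivative)
  have \<psi>_deriv: "\<exists>D. (\<psi> has_real_derivative D) (at t) \<and> D \<ge> (c - 1) * \<phi> t" if t: "t > 0" for t
  proof -
    obtain D where D: "(\<phi> has_real_derivative D) (at t)" using phi_deriv[OF t] by blast
    have D': "((\<lambda>s. s * \<phi> s) has_real_derivative 1 * \<phi> t + D * t) (at t)"
      by (intro DERIV_mult DERIV_ident D)
    then have "deriv (\<lambda>s. s * \<phi> s) t = 1 * \<phi> t + D * t" by (rule DERIV_imp_deriv)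
    then have "c - 1 \<le> (1 * \<phi> t + D * t) / \<phi> t" using phi_3 t by metis
    then have "1 * \<phi> t + D * t \<ge> (c - 1) * \<phi> t"
      using phi_pos t by (simp only: pos_le_divide_eq)
    moreover have "(\<psi> has_real_derivative 1 * \<phi> t + D * t) (at t)"
      by (rule has_field_derivative_transform_within_open[OF D' open_greaterThan[of 0]]) (use t in \<open>auto simp: \<psi>_def\<close>)
    ultimately show ?thesis by blast
  qed
  have cont_pos: "isCont \<psi> t" if "t > 0" for t using \<psi>_deriv[OF that] DERIV_isCont by blast
  have "isCont \<psi> t" for t
  proof (cases t "0::real" rule: linorder_cases)
    case greater
    then show ?thesis by (rule cont_pos)
  next
    case less
    have "isCont (\<lambda>s. - \<psi> (- s)) t"
      using less by (intro continuous_intros isCont_o2[OF _ cont_pos]) auto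
    then show ?thesis by (simp add: \<psi>_odd)
  next
    case equal
    have right: "(\<psi> \<longlongrightarrow> 0) (at_right 0)"
      by (rule Lim_transform_eventually[OF phi_1(1)])
        (auto simp: eventually_at_right_field \<psi>_def intro!: exI[of _ 1])
    then have "((\<lambda>s. - \<psi> s) \<longlongrightarrow> 0) (at_right 0)" using tendsto_minus[OF right] by simp
    then have "((\<lambda>s. \<psi> (- s)) \<longlongrightarrow> 0) (at_right 0)" by (simp add: \<psi>_odd)
    then have "(\<psi> \<longlongrightarrow> 0) (at_left 0)" using filterlim_at_left_to_right[of \<psi> "nhds 0" 0] by simp
    then show ?thesis using right equal
      by (simp add: isCont_def filterlim_at_split \<psi>_def)
  qed
  then have \<psi>_cont: "continuous_on A \<psi>" for A by (simp add: continuous_at_imp_continuous_on)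
  have onto_pos: "\<exists>t. \<psi> t = y" if y: "y \<ge> 0" for y
  proof -
    have "\<forall>\<^sub>F t in at_top. t * \<phi> t \<ge> y" using phi_1(2) by (simp add: filterlim_at_top)
    then have "\<forall>\<^sub>F t in at_top. t * \<phi> t \<ge> y \<and> t \<ge> 0" using eventually_ge_at_top[of 0] by eventually_elim simp
    then obtain t where "t * \<phi> t \<ge> y" "t \<ge> 0" using eventually_happens[of _ "at_top :: real filter"] by auto
    then show ?thesis
      using IVT'[of \<psi> 0 y t] y \<psi>_cont by (auto simp: \<psi>_def)
  qed
  have "\<exists>t. \<psi> t = y" for y
  proof (cases "y \<ge> 0")
    case False
    then obtain t where "\<psi> t = - y" using onto_pos[of "-y"] by auto
    then show ?thesis by (intro exI[of _ "-t"]) (simp add: \<psi>_odd)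
  qed (rule onto_pos)
  then have "surj \<psi>" by (metis surj_def)
  then have \<psi>g: "\<psi> (g y) = y" for y by (simp add: g_def surj_f_inv_f)
  have g\<psi>: "g (\<psi> t) = t" for t
    using strict_mono_imp_inj_on[OF \<psi>_mono] by (simp add: g_def)
  have g_mono: "strict_mono g"
  proof (rule strict_monoI)
    fix x y :: real assume "x < y"
    then have "\<psi> (g x) < \<psi> (g y)" by (simp add: \<psi>g)
    then show "g x < g y" using strict_mono_less[OF \<psi>_mono] by simp
  qed
  have "range g = UNIV" using g\<psi> by (metis surj_def)
  then have g_cont: "continuous_on UNIV g"
    using g_mono by (intro continuous_onI_mono) (auto dest: strict_mono_less_eq)
  have "odd_profile g (1 / (c - 1))"
  proof
    show "1 / (c - 1) > 0" using c by simp
    show "continuous_on UNIV g" by (rule g_cont)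
    show "g (- y) = - g y" for y using g\<psi>[of "- g y"] by (simp add: \<psi>_odd \<psi>g)
    show "strict_mono g" by (rule g_mono)
    fix y :: real assume y: "y > 0"
    have "g 0 = 0" using g\<psi>[of 0] by (simp add: \<psi>_def)
    then have t: "g y > 0" using strict_mono_less[OF g_mono, of 0 y] y by simp
    obtain D where D: "(\<psi> has_real_derivative D) (at (g y))" "D \<ge> (c - 1) * \<phi> (g y)"
      using \<psi>_deriv[OF t] by blast
    have ph: "\<phi> (g y) > 0" using phi_pos t by simp
    then have cph: "(c - 1) * \<phi> (g y) > 0" using c by simp
    then have "D > 0" using D by linarith
    have "(g has_real_derivative inverse D) (at y)"
      by (rule DERIV_inverse_function[where f = \<psi> and a = "y - 1" and b = "y + 1"])
        (use D \<open>D > 0\<close> \<psi>g g_cont in \<open>auto simp: continuous_on_eq_continuous_at\<close>)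
    moreover have "inverse D \<le> inverse ((c - 1) * \<phi> (g y))"
      using D cph by (intro le_imp_inverse_le)
    moreover have "y = g y * \<phi> (g y)" using \<psi>g[of y] t by (simp add: \<psi>_def)
    then have "g y / y = 1 / \<phi> (g y)" using t by (metis nonzero_divide_mult_cancel_left order_less_irrefl)
    then have "inverse ((c - 1) * \<phi> (g y)) = 1 / (c - 1) * g y / y" by (simp add: divide_inverse)
    ultimately show "\<exists>g'. (g has_real_derivative g') (at y) \<and> g' \<le> 1 / (c - 1) * g y / y" by auto
  qed
  then show ?thesis using \<psi>g g\<psi> by (intro exI[of _ g]) (simp add: \<psi>_def)
qed

text \<open>To the left of -1 the function is at most f(-1) < 0, so its primitive grows at least
  linearly towards minus infinity. This provides a level -m which the energy forbids orbits to
  reach.\<close>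

lemma prim_coercive_left:
  fixes f :: "real \<Rightarrow> real"
  assumes f: "continuous_on UNIV f" and mono: "mono_on {..0} f" and neg: "f (-1) < 0"
  obtains m where "m > 0" "prim f (- m) > b"
proof -
  define m where "m = 2 + (\<bar>b\<bar> + \<bar>prim f (-1)\<bar>) / - f (-1)"
  have q: "(\<bar>b\<bar> + \<bar>prim f (-1)\<bar>) / - f (-1) \<ge> 0" using neg by (intro divide_nonneg_pos) auto
  then have m: "m \<ge> 2" by (simp add: m_def)
  obtain z where z: "- m < z" "z < -1" "prim f (-1) - prim f (-m) = (-1 - - m) * f z"
    using MVT2[of "-m" "-1" "prim f" f] m DERIV_prim[OF f] by auto
  have "f z \<le> f (-1)" using mono_onD[OF mono, of z "-1"] z by simp
  then have "(m - 1) * f z \<le> (m - 1) * f (-1)" using m by (intro mult_left_mono) auto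
  moreover have "(m - 1) * - f (-1) = - f (-1) + (\<bar>b\<bar> + \<bar>prim f (-1)\<bar>)"
    using neg by (simp add: m_def field_simps)
  ultimately have "prim f (-m) > b" using z(3) neg by simp
  then show ?thesis using that[of m] m by simp
qed

section \<open>Back to the boundary value problem\<close>

context shooting
begin

text \<open>Since \<phi>(|g(y)|) g(y) = y, the flux formed from u' = \<open>V u\<close> is
  \<open>W u\<close>, an integral whose derivative is known. The nonlinearities need to coincide
  only along the orbit, which is what makes the cut-off removable.\<close>

lemma sol_bvp_solution:
  assumes u: "sol 0 d u" and R0: "u R = 0"
    and \<phi>: "\<And>y. g y * \<phi> \<bar>g y\<bar> = y" and f_eq: "\<And>r. r \<in> {0..R} \<Longrightarrow> f (u r) = lam * f0 (u r)"
  shows "bvp_solution R \<alpha> \<gamma> \<phi> f0 lam u"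
  unfolding bvp_solution_def
proof (intro exI conjI ballI)
  show "(u has_real_derivative V u r) (at r within {0..R})" if "r \<in> {0..R}" for r
    by (rule sol_deriv[OF u that])
  show "continuous_on {0..R} (V u)" by (rule V_cont[OF sol_cont[OF u]])
  fix r assume r: "r \<in> {0<..<R}"
  have flux: "W u s = s powr \<alpha> * \<phi> \<bar>V u s\<bar> * V u s" if "s > 0" for s
  proof -
    have "s powr \<alpha> * \<phi> \<bar>V u s\<bar> * V u s = s powr \<alpha> * (s powr (-\<alpha>) * W u s)"
      using \<phi>[of "Y u s"] by (simp add: V_def Y_def algebra_simps)
    also have "\<dots> = W u s" using that by (simp add: mult.assoc[symmetric] flip: powr_add)
    finally show ?thesis by simp
  qed
  have "(W u has_real_derivative - (r powr \<gamma> * f (u r))) (at r)"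
    using W_deriv_at[OF sol_cont[OF u]] r by simp
  then have "((\<lambda>s. s powr \<alpha> * \<phi> \<bar>V u s\<bar> * V u s) has_real_derivative - (r powr \<gamma> * f (u r))) (at r)"
    by (rule has_field_derivative_transform_within_open[OF _ open_greaterThan[of 0]]) (use r flux in auto)
  then show "(\<lambda>s. s powr \<alpha> * \<phi> \<bar>V u s\<bar> * V u s) differentiable (at r)"
    "- deriv (\<lambda>s. s powr \<alpha> * \<phi> \<bar>V u s\<bar> * V u s) r = lam * r powr \<gamma> * f0 (u r)"
    using f_eq[of r] r by (auto simp: DERIV_imp_deriv real_differentiable_def)
qed (use R0 in auto)

text \<open>The derivative of any orbit is at most g(BC) in modulus, so \<open>small\<close>
  prevents the orbit from D from descending to 0 before R. This orbit serves as the zero-free end of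
  the shooting range.\<close>

theorem nodal_solutions:
  assumes mono: "mono f" and osgood: "osgood p f" "osgood p (\<lambda>x. - f (- x))" and D: "D > 0"
    and small: "g (B * C) * R < D"
  obtains d :: "nat \<Rightarrow> real" where
    "\<And>l. 0 < d l \<and> d l < D \<and> U (d l) R = 0 \<and> finite {r \<in> {0<..<R}. U (d l) r = 0} \<and>
       card {r \<in> {0<..<R}. U (d l) r = 0} = l \<and> d (Suc l) < d l"
proof (rule nodal_shooting_parameters[OF D, where U = U and U' = "\<lambda>d. V (U d)" and R = R])
  show "U D r \<noteq> 0" if r: "r \<in> {0..R}" for r
  proof -
    have "\<bar>U D r - U D 0\<bar> \<le> g (B * C) * \<bar>r - 0\<bar>"
      using r R_pos by (intro sol_lipschitz[OF sol_U]) auto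
    also have "\<dots> \<le> g (B * C) * R" using r B_nonneg C_pos by (intro mult_left_mono) auto
    also note small
    finally show ?thesis using sol_0[OF sol_U, of D] by auto
  qed
qed (use sol_deriv[OF sol_U] V_cont[OF sol_cont[OF sol_U]] flow_continuous sol_0[OF sol_U]
    no_double_zero[OF sol_U] many_zeros[OF mono osgood D] that in auto)

end

text \<open>Clamping the argument to [-m, D] is 1-Lipschitz, monotone and sign-preserving, so it
  passes on uniform continuity, monotonicity, the sign condition and the local Lipschitz property.
  Monotonicity of f puts the extreme values at the two levels.\<close>

lemma bvp_cutoff:
  fixes f :: "real \<Rightarrow> real" and m D lam \<alpha> \<gamma> p R :: real
  defines "h \<equiv> (\<lambda>x. lam * f (max (- m) (min D x)))"
  assumes profile: "odd_profile g p" and R: "R > 0" and gamma: "\<gamma> \<ge> 0" "\<gamma> \<ge> \<alpha>" "\<gamma> \<ge> - \<alpha> * p"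
    and f: "continuous_on UNIV f" "f C1_differentiable_on (UNIV - {0})" "\<forall>t. t \<noteq> 0 \<longrightarrow> t * f t > 0"
      "mono_on {..D} f"
    and m: "m > 0" and D: "D > 0" and lam: "lam > 0"
  shows "shooting g p R \<alpha> \<gamma> (lam * max (f D) (- f (- m))) h" and "mono h"
proof -
  define K where "K x = max (- m) (min D x)" for x
  have K: "K x \<in> {- m..D}" for x using m D by (auto simp: K_def)
  have K_lip: "\<bar>K x - K y\<bar> \<le> \<bar>x - y\<bar>" for x y by (simp add: K_def max_def min_def)
  have h_K: "h x = lam * f (K x)" for x by (simp add: h_def K_def)
  have mono_f: "f x \<le> f y" if "x \<le> y" "y \<le> D" for x y using mono_onD[OF f(4)] that by simp
  interpret odd_profile g p by (rule profile)
  show "shooting g p R \<alpha> \<gamma> (lam * max (f D) (- f (- m))) h"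
  proof
    have "uniformly_continuous_on {- m..D} f"
      using f(1) by (intro compact_uniformly_continuous) (auto intro: continuous_on_subset)
    show "uniformly_continuous_on UNIV h"
      unfolding uniformly_continuous_on_def
    proof (intro allI impI)
      fix e :: real assume "e > 0"
      then have "e / lam > 0" using lam by simp
      then obtain \<delta> where \<delta>: "\<delta> > 0"
        "\<And>x y. x \<in> {- m..D} \<Longrightarrow> y \<in> {- m..D} \<Longrightarrow> dist y x < \<delta> \<Longrightarrow> dist (f y) (f x) < e / lam"
        using \<open>uniformly_continuous_on {- m..D} f\<close> unfolding uniformly_continuous_on_def by metis
      have "dist (h y) (h x) < e" if "dist y x < \<delta>" for x y
      proof -
        have "dist (K y) (K x) < \<delta>" using K_lip[of y x] that by (simp add: dist_real_def)
        from \<delta>(2)[OF K K this] have "lam * \<bar>f (K y) - f (K x)\<bar> < e"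
          using lam by (simp add: dist_real_def field_simps)
        moreover have "\<bar>h y - h x\<bar> = lam * \<bar>f (K y) - f (K x)\<bar>"
          using lam by (simp add: h_K abs_mult flip: right_diff_distrib)
        ultimately show ?thesis by (simp add: dist_real_def)
      qed
      then show "\<exists>d>0. \<forall>x\<in>UNIV. \<forall>y\<in>UNIV. dist y x < d \<longrightarrow> dist (h y) (h x) < e"
        using \<delta>(1) by blast
    qed
    show "\<bar>h x\<bar> \<le> lam * max (f D) (- f (- m))" for x
    proof -
      have "f (- m) \<le> f (K x)" "f (K x) \<le> f D" using K[of x] by (auto intro!: mono_f)
      then have "\<bar>f (K x)\<bar> \<le> max (f D) (- f (- m))" by (simp add: abs_le_iff max_def)
      then show ?thesis using lam by (simp add: h_K abs_mult)
    qed
    show "x * h x > 0" if "x \<noteq> 0" for x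
    proof -
      have fs: "f t > 0 \<longleftrightarrow> t > 0" "f t < 0 \<longleftrightarrow> t < 0" if "t \<noteq> 0" for t
        using f(3) that by (auto simp: zero_less_mult_iff)
      have "K x > 0 \<longleftrightarrow> x > 0" "K x < 0 \<longleftrightarrow> x < 0" using m D by (auto simp: K_def)
      then show ?thesis using that lam fs[of "K x"] by (auto simp: h_K zero_less_mult_iff mult_less_0_iff)
    qed
    show "\<exists>\<delta>>0. \<exists>L. \<forall>s t. \<bar>s - x\<bar> < \<delta> \<longrightarrow> \<bar>t - x\<bar> < \<delta> \<longrightarrow> \<bar>h s - h t\<bar> \<le> L * \<bar>s - t\<bar>" if x: "x \<noteq> 0" for x
    proof -
      have "K x \<in> UNIV - {0}" using m D x by (auto simp: K_def)
      then obtain \<delta> L where \<delta>: "\<delta> > 0" "L \<ge> 0"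
        "\<And>s t. \<bar>s - K x\<bar> < \<delta> \<Longrightarrow> \<bar>t - K x\<bar> < \<delta> \<Longrightarrow> \<bar>f s - f t\<bar> \<le> L * \<bar>s - t\<bar>"
        using C1_locally_lipschitz[OF f(2)] by (metis open_UNIV open_delete)
      have "\<bar>h s - h t\<bar> \<le> (lam * L) * \<bar>s - t\<bar>" if "\<bar>s - x\<bar> < \<delta>" "\<bar>t - x\<bar> < \<delta>" for s t
      proof -
        have "\<bar>f (K s) - f (K t)\<bar> \<le> L * \<bar>K s - K t\<bar>"
          using K_lip[of s x] K_lip[of t x] that by (intro \<delta>(3)) auto
        also have "\<dots> \<le> L * \<bar>s - t\<bar>" using \<delta>(2) K_lip by (intro mult_left_mono)
        finally have "lam * \<bar>f (K s) - f (K t)\<bar> \<le> lam * (L * \<bar>s - t\<bar>)" using lam by simp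
        moreover have "\<bar>h s - h t\<bar> = lam * \<bar>f (K s) - f (K t)\<bar>"
          using lam by (simp add: h_K abs_mult flip: right_diff_distrib)
        ultimately show ?thesis by simp
      qed
      then show ?thesis using \<delta>(1) by blast
    qed
  qed (use R gamma in auto)
  show "mono h"
  proof (rule monoI)
    fix x y :: real assume "x \<le> y"
    then have "K x \<le> K y" by (auto simp: K_def)
    then have "f (K x) \<le> f (K y)" using K[of y] by (intro mono_f) auto
    then show "h x \<le> h y" using lam by (simp add: h_K)
  qed
qed

theorem theorem1p1:
  fixes R \<alpha> \<gamma> \<gamma>\<^sub>1 \<gamma>\<^sub>2 d_inf :: real
    and \<phi> f :: "real \<Rightarrow> real"
  assumes R_pos: "R > 0"
    and gammas: "\<gamma>\<^sub>1 > 1" "\<gamma>\<^sub>2 > 1"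
    and phi_pos: "\<forall>t>0. \<phi> t > 0"
    and phi_C1: "\<phi> C1_differentiable_on {0<..}"
    and phi_twice: "\<forall>t>0. deriv \<phi> differentiable (at t)"
    and phi_1: "((\<lambda>t. t * \<phi> t) \<longlongrightarrow> 0) (at_right 0)"
               "filterlim (\<lambda>t. t * \<phi> t) at_top at_top"
    and phi_2: "strict_mono_on {0<..} (\<lambda>t. t * \<phi> t)"
    and phi_3: "\<forall>t>0. \<gamma>\<^sub>1 - 1 \<le> deriv (\<lambda>s. s * \<phi> s) t / \<phi> t \<and>
                      deriv (\<lambda>s. s * \<phi> s) t / \<phi> t \<le> \<gamma>\<^sub>2 - 1"
    and f_cont: "continuous_on UNIV f"
    and f_C1: "f C1_differentiable_on (UNIV - {0})"
    and f_1: "\<forall>t. t \<noteq> 0 \<longrightarrow> t * f t > 0"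
    and f_2: "d_inf > 0" "mono_on {..d_inf} f"
    and f_3: "\<forall>x>0. (\<integral>\<^sup>+t\<in>{-x..0}. ennreal ((- f t) powr (-1 / (\<gamma>\<^sub>1 - 1))) \<partial>lborel) < \<infinity>"
             "\<forall>y>0. (\<integral>\<^sup>+t\<in>{0..y}. ennreal (f t powr (-1 / (\<gamma>\<^sub>1 - 1))) \<partial>lborel) < \<infinity>"
    and gamma_ge: "\<gamma> \<ge> max \<alpha> (- \<alpha> / (\<gamma>\<^sub>1 - 1))"
  shows "\<exists>\<Lambda>>0. \<forall>lam\<in>{0<..\<Lambda>}.
           (\<exists>u\<^sub>0. positive_bvp_solution R \<alpha> \<gamma> \<phi> f lam u\<^sub>0) \<and>
           (\<exists>(u :: nat \<Rightarrow> real \<Rightarrow> real) (d :: nat \<Rightarrow> real).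
              (\<forall>l\<ge>1. bvp_solution R \<alpha> \<gamma> \<phi> f lam (u l) \<and>
                      u l 0 = d l \<and>
                      finite {r\<in>{0<..<R}. u l r = 0} \<and>
                      card {r\<in>{0<..<R}. u l r = 0} = l) \<and>
              d_inf > d 1 \<and>
              (\<forall>l\<ge>1. d l > d (Suc l) \<and> d l > 0))"
proof -
  define p where "p = 1 / (\<gamma>\<^sub>1 - 1)"
  have p: "p > 0" "-1 / (\<gamma>\<^sub>1 - 1) = - p" using gammas by (simp_all add: p_def)
  have \<gamma>: "\<gamma> \<ge> \<alpha>" "\<gamma> \<ge> - \<alpha> * p" using gamma_ge by (simp_all add: p_def)
  \<comment> \<open>One of the two lower bounds for \<gamma> is always nonnegative, as they are
    \<alpha> and a negative multiple of \<alpha>.\<close>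
  have \<gamma>0: "\<gamma> \<ge> 0"
  proof (cases "\<alpha> \<ge> 0")
    case False
    then have "- \<alpha> * p \<ge> 0" using p by (intro mult_nonneg_nonneg) auto
    then show ?thesis using \<gamma>(2) by linarith
  qed (use \<gamma> in simp)
  have f_pos: "f t > 0" if "t > 0" for t using f_1[rule_format, of t] that by (simp add: zero_less_mult_iff)
  have f_neg: "f t < 0" if "t < 0" for t using f_1[rule_format, of t] that by (simp add: zero_less_mult_iff)
  have phi_3': "\<forall>t>0. \<gamma>\<^sub>1 - 1 \<le> deriv (\<lambda>s. s * \<phi> s) t / \<phi> t" using phi_3 by blast
  have "\<exists>g. odd_profile g p \<and> (\<forall>y. g y * \<phi> \<bar>g y\<bar> = y) \<and> (\<forall>t. g (t * \<phi> \<bar>t\<bar>) = t)"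
    unfolding p_def by (rule profile_inverse[OF gammas(1) phi_pos phi_C1 phi_1 phi_2 phi_3'])
  then obtain g where g: "odd_profile g p" and g_phi: "\<And>y. g y * \<phi> \<bar>g y\<bar> = y" "\<And>t. g (t * \<phi> \<bar>t\<bar>) = t"
    by auto
  interpret odd_profile g p by (rule g)
  have "mono_on {..0} f" using f_2(1) by (intro mono_on_subset[OF f_2(2)]) auto
  moreover have "f (-1) < 0" using f_neg[of "-1"] by simp
  \<comment> \<open>The lower cut-off level is fixed before lam, since the inequality between the
    two primitives survives multiplication by lam.\<close>
  ultimately obtain m where m: "m > 0" "prim f (- m) > prim f d_inf"
    by (rule prim_coercive_left[OF f_cont])
  define B where "B = max (f d_inf) (- f (- m))"
  define C where "C = R powr (1 + \<gamma> - \<alpha>)"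
  have BC: "B * C > 0" using f_pos[OF f_2(1)] R_pos by (simp add: B_def C_def max_def)
  \<comment> \<open>Chosen so that lam \<le> \<Lambda> means g(lam B C) \<le> d_inf / (2 R): over
    [0, R] an orbit then moves by at most d_inf / 2.\<close>
  define \<Lambda> where "\<Lambda> = (d_inf / (2 * R)) * \<phi> \<bar>d_inf / (2 * R)\<bar> / (B * C)"
  have \<Lambda>: "\<Lambda> > 0" using phi_pos f_2(1) R_pos BC by (simp add: \<Lambda>_def)
  have f_meas: "f \<in> borel_measurable borel" using f_cont by (rule borel_measurable_continuous_onI)
  have osgood_f: "osgood p f"
  proof (rule osgoodI[OF f_2(1) f_cont f_pos])
    show "(\<lambda>x. f x powr (-p)) integrable_on {0..d_inf}"
      using f_3(2) f_2(1) f_meas unfolding p(2)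
      by (intro set_nn_integral_finite_imp_integrable_on) auto
  qed
  have osgood_neg: "osgood p (\<lambda>x. - f (- x))"
  proof (rule osgoodI[OF m(1)])
    have "(\<lambda>x. (- f x) powr (-p)) integrable_on {- m..0}"
      using f_3(1) m(1) f_meas unfolding p(2)
      by (intro set_nn_integral_finite_imp_integrable_on) auto
    then show "(\<lambda>x. (- f (- x)) powr (-p)) integrable_on {0..m}"
      using Henstock_Kurzweil_Integration.integrable_reflect_real[of "\<lambda>x. (- f x) powr (-p)" 0 "-m"] by simp
    show "continuous_on UNIV (\<lambda>x. - f (- x))"
      by (intro continuous_intros continuous_on_compose2[OF f_cont]) auto
  qed (use f_neg in auto)
  show ?thesis
  proof (intro exI[of _ \<Lambda>] conjI ballI)
    show "\<Lambda> > 0" by (rule \<Lambda>)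
    fix lam assume "lam \<in> {0<..\<Lambda>}"
    then have lam: "lam > 0" "lam \<le> \<Lambda>" by auto
    define h where "h = (\<lambda>x. lam * f (max (- m) (min d_inf x)))"
    have h_eq: "h x = lam * f x" if "x \<in> {- m..d_inf}" for x
      using that by (auto simp: h_def max_def min_def)
    interpret S: shooting g p R \<alpha> \<gamma> "lam * B" h
      unfolding h_def B_def
      by (rule bvp_cutoff[OF g R_pos \<gamma>0 \<gamma> f_cont f_C1 f_1 f_2(2) m(1) f_2(1) lam(1)])
    have h_mono: "mono h"
      unfolding h_def by (rule bvp_cutoff[OF g R_pos \<gamma>0 \<gamma> f_cont f_C1 f_1 f_2(2) m(1) f_2(1) lam(1)])
    have h_osgood: "osgood p h"
      by (rule osgood_scale[OF osgood_f lam(1) f_2(1)]) (use h_eq m f_pos in \<open>auto intro: less_imp_le\<close>)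
    have h_osgood_neg: "osgood p (\<lambda>x. - h (- x))"
      by (rule osgood_scale[OF osgood_neg lam(1) m(1)]) (use h_eq f_2 f_neg in \<open>auto intro: less_imp_le\<close>)
    have small: "g (lam * B * S.C) * R < d_inf"
    proof -
      have "lam * (B * C) \<le> \<Lambda> * (B * C)" using lam BC by (intro mult_right_mono) auto
      also have "\<dots> = (d_inf / (2 * R)) * \<phi> \<bar>d_inf / (2 * R)\<bar>"
        unfolding \<Lambda>_def using BC by (metis nonzero_divide_eq_eq order_less_irrefl)
      finally have "g (lam * (B * C)) \<le> d_inf / (2 * R)" using g_le_iff g_phi(2) by metis
      then have "g (lam * (B * C)) * R \<le> d_inf / (2 * R) * R" using R_pos by (intro mult_right_mono) auto
      also have "\<dots> < d_inf" using R_pos f_2(1) by simp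
      finally show ?thesis by (simp add: S.C_def C_def mult.assoc)
    qed
    obtain d :: "nat \<Rightarrow> real" where d: "\<And>l. 0 < d l \<and> d l < d_inf \<and> S.U (d l) R = 0 \<and>
        finite {r \<in> {0<..<R}. S.U (d l) r = 0} \<and> card {r \<in> {0<..<R}. S.U (d l) r = 0} = l \<and> d (Suc l) < d l"
      using S.nodal_solutions[OF h_mono h_osgood h_osgood_neg f_2(1) small] by blast
    \<comment> \<open>On the range where the cut-off is inactive, the potential is lam times that of
      f, so the inequality that fixed m carries over.\<close>
    have F_eq: "S.F x = lam * prim f x" if x: "x \<in> {- m..d_inf}" for x
    proof -
      have "\<exists>c. \<forall>x\<in>{- m..d_inf}. S.F x - lam * prim f x = c"
      proof (rule has_field_derivative_zero_constant)
        fix x assume x: "x \<in> {- m..d_inf}"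
        have "((\<lambda>x. S.F x - lam * prim f x) has_real_derivative h x - lam * f x) (at x)"
          by (intro DERIV_diff DERIV_cmult S.F_deriv DERIV_prim f_cont)
        then show "((\<lambda>x. S.F x - lam * prim f x) has_real_derivative 0) (at x within {- m..d_inf})"
          using h_eq[OF x] by (simp add: has_field_derivative_at_within)
      qed simp
      then obtain c where c: "\<And>x. x \<in> {- m..d_inf} \<Longrightarrow> S.F x - lam * prim f x = c" by blast
      show ?thesis using c[OF x] c[of 0] m(1) f_2(1) by (simp add: prim_0[OF f_cont])
    qed
    have F_less: "S.F d_inf < S.F (- m)"
      using F_eq[of d_inf] F_eq[of "-m"] m f_2(1) lam(1) by simp
    \<comment> \<open>The orbit stays below the potential at both cut-off levels and therefore
      between them, so it solves the original equation.\<close>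
    have range: "S.U (d l) r \<in> {- m..d_inf}" if r: "r \<in> {0..R}" for l r
    proof -
      have "S.F (S.U (d l) r) \<le> S.F (d l)" by (rule S.F_sol_le[OF S.sol_U r])
      also have "\<dots> < S.F d_inf" using d[of l] by (intro S.F_strict_mono_pos) auto
      finally have less: "S.F (S.U (d l) r) < S.F d_inf" .
      have "S.U (d l) r \<le> d_inf"
        using S.F_strict_mono_pos[of d_inf "S.U (d l) r"] less f_2(1) by linarith
      moreover have "S.U (d l) r \<ge> - m"
        using S.F_strict_mono_neg[of "-m" "S.U (d l) r"] less F_less m(1) by linarith
      ultimately show ?thesis by simp
    qed
    have bvp: "bvp_solution R \<alpha> \<gamma> \<phi> f lam (S.U (d l))" for l
      using d[of l] by (intro S.sol_bvp_solution[OF S.sol_U _ g_phi(1)] h_eq range) auto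
    have U0: "S.U (d l) 0 = d l" for l by (rule S.sol_0[OF S.sol_U])
    \<comment> \<open>The index 0 supplies the positive solution: it has no interior zero and starts
      at a positive value.\<close>
    have "S.U (d 0) r > 0" if r: "r \<in> {0<..<R}" for r
    proof (rule ccontr)
      assume "\<not> S.U (d 0) r > 0"
      moreover have "continuous_on {0..r} (S.U (d 0))"
        using r by (intro continuous_on_subset[OF S.sol_cont[OF S.sol_U]]) auto
      ultimately obtain x where x: "0 \<le> x" "x \<le> r" "S.U (d 0) x = 0"
        using IVT2'[of "S.U (d 0)" r 0 0] U0[of 0] d[of 0] r by auto
      then have "x \<noteq> 0" using U0[of 0] d[of 0] by auto
      then have "x \<in> {r \<in> {0<..<R}. S.U (d 0) r = 0}" using x r by auto
      moreover have "{r \<in> {0<..<R}. S.U (d 0) r = 0} = {}" using d[of 0] by (metis card_0_eq)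
      ultimately show False by blast
    qed
    then show "\<exists>u\<^sub>0. positive_bvp_solution R \<alpha> \<gamma> \<phi> f lam u\<^sub>0"
      using bvp[of 0] unfolding positive_bvp_solution_def by blast
    show "\<exists>(u :: nat \<Rightarrow> real \<Rightarrow> real) (d :: nat \<Rightarrow> real).
        (\<forall>l\<ge>1. bvp_solution R \<alpha> \<gamma> \<phi> f lam (u l) \<and> u l 0 = d l \<and>
          finite {r\<in>{0<..<R}. u l r = 0} \<and> card {r\<in>{0<..<R}. u l r = 0} = l) \<and>
        d_inf > d 1 \<and> (\<forall>l\<ge>1. d l > d (Suc l) \<and> d l > 0)"
      using bvp U0 d by (intro exI[of _ "\<lambda>l. S.U (d l)"] exI[of _ d] conjI allI impI) blast+
  qed
qed

end
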